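(* Let $(M,g)$ be a Riemannian manifold of dimension $n\ge3$. For even $n$ and all $N\ge 1$ with $2N\le n$, and for odd $n$ and all $N\ge1$, $$(-1)^NQ_{2N}=\sum_{|I|+a=N}n_{(I,a)}\,a!\,(a-1)!\,2^{2a}\,\mathcal M_{2I}(w_{2a}),$$ where the sum runs over all pairs of an integer $a\ge1$ and a (possibly empty) composition $I$ with $|I|+a=N$; for empty $I$ (that is, $a=N$) the term is $N!\,(N-1)!\,2^{2N}w_{2N}$.
   Context: Conventions: $\delta$ is the formal adjoint of $d$ with respect to $g$, and $\Delta_g=-\delta d$ (so $-\Delta_g\ge0$). Poincaré–Einstein metric: on $X=M\times(0,\varepsilon)$ let $g_+=r^{-2}(dr^2+g_r)$, $g_0=g$, with $g_r=g+r^2g_{(2)}+r^4g_{(4)}+\cdots$ even in $r$. For odd $n$, $\mathrm{Ric}(g_+)+ng_+$ is required to vanish to infinite order at $r=0$; this determines the formal power series $g_r$. For even $n$, one requires $\mathrm{Ric}(g_+)+ng_+=O(r^{n-2})$ together with vanishing of the $g$-trace of the coefficient of $r^{n-2}$; this determines $g_{(2)},\dots,g_{(n-2)}$ and $\mathrm{tr}_g\,g_{(n)}$, and one sets $g_r=g+r^2g_{(2)}+\cdots+r^ng_{(n)}$. Set $v(r)=\mathrm{vol}(g_r)/\mathrm{vol}(g)=1+v_2r^2+v_4r^4+\cdots$ and $w(r)=\sqrt{v(r)}=1+w_2r^2+w_4r^4+\cdots$ (for even $n$ these are determined by $g$ up to $w_n$). GJMS-operators: let $\tilde g=2t\,dt\,d\rho+2\rho\,dt^2+t^2g(\rho)$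 be the ambient metric, where $g(\rho)=g_r$ for $\rho=-r^2/2$. Then $P_{2N}(g)u=\Delta_{\tilde g}^N(t^{N-n/2}\tilde u)|_{\rho=0,t=1}$, where $\tilde u(x,\rho)$ is any smooth extension of $u\in C^\infty(M)$. It is defined for all $N\ge1$ if $n$ is odd and for $2N\le n$ if $n$ is even. $Q$-curvatures: for $2N\ne n$, $Q_{2N}$ is defined by $P_{2N}(g)(1)=(-1)^N\left(\frac n2-N\right)Q_{2N}(g)$. The critical $Q$-curvature $Q_n$ ($n$ even, $2N=n$) is defined from the non-critical $Q_{2N}$ by a limiting process (continuation in the dimension $n\to2N$); equivalently, $Q_n=(-1)^{n/2+1}\Delta_{\tilde g}^{n/2}(\log t)|_{\rho=0,t=1}$. Combinatorics: a composition $I=(I_1,\dots,I_r)$ is a finite sequence of integers $I_j\ge1$; its size is $|I|=I_1+\cdots+I_r$. $(I,a)$ denotes the composition $(I_1,\dots,I_r,a)$. Put $$m_I=-(-1)^r|I|!\,(|I|-1)!\prod_{j=1}^r\frac{1}{I_j!\,(I_j-1)!}\prod_{j=1}^{r-1}\frac{1}{I_j+I_{j+1}},\qquad n_I=\prod_{j=1}^r\binom{\sum_{k\le j}I_k-1}{I_j-1}\binom{\sum_{k\ge j}I_k-1}{I_j-1}.$$ Set $P_{2I}=P_{2I_1}\circ\cdots\circ P_{2I_r}$, $\mathcal M_{2N}=\sum_{|I|=N}m_IP_{2I}$, $\mathcal M_{2I}=\mathcal M_{2I_1}\circ\cdots\circ\mathcal M_{2I_r}$ (identity for empty $I$). *)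

theory Defs
  imports "HOL-Analysis.Analysis" "HOL-Library.Landau_Symbols"
begin

section \<open>Smooth functions on open subsets of a Euclidean space\<close>

text \<open>Both notions are meant for open sets.\<close>

primrec Ck_on ::
  "nat \<Rightarrow> 'e::euclidean_space set \<Rightarrow> ('e \<Rightarrow> 'f::real_normed_vector) \<Rightarrow> bool" where
  "Ck_on 0 S f \<longleftrightarrow> continuous_on S f"
| "Ck_on (Suc k) S f \<longleftrightarrow> (\<forall>x\<in>S. f differentiable (at x)) \<and>
     (\<forall>v. Ck_on k S (\<lambda>x. frechet_derivative f (at x) v))"

definition smooth_on :: "'e::euclidean_space set \<Rightarrow> ('e \<Rightarrow> 'f::real_normed_vector) \<Rightarrow> bool" where
  "smooth_on S f \<longleftrightarrow> (\<forall>k. Ck_on k S f)"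


section \<open>Pseudo-Riemannian geometry in one chart\<close>

text \<open>
  A bilinear form is a curried function \<open>B\<close>; a metric on an open set is a function \<open>G\<close> that
  assigns a symmetric nondegenerate bilinear form \<open>G x\<close> to every point \<open>x\<close>.
\<close>

type_synonym 'e form2 = "'e \<Rightarrow> 'e \<Rightarrow> real"

text \<open>Raising an index: the vector that represents the linear form \<open>\<xi>\<close> with respect to \<open>B\<close>.\<close>

definition sharp :: "'e::euclidean_space form2 \<Rightarrow> ('e \<Rightarrow> real) \<Rightarrow> 'e" where
  "sharp B \<xi> = (THE v. \<forall>w. B v w = \<xi> w)"

text \<open>\<open>B\<close>-trace of a bilinear form, i.e. \<open>B\<^sup>i\<^sup>j C\<^sub>i\<^sub>j\<close>.\<close>

definition metric_trace :: "'e::euclidean_space form2 \<Rightarrow> 'e form2 \<Rightarrow> real" where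
  "metric_trace B C = (\<Sum>b\<in>Basis. sharp B (C b) \<bullet> b)"

definition gram_det :: "'e::euclidean_space form2 \<Rightarrow> real" where
  "gram_det B = (\<Sum>p | p permutes (Basis :: 'e set). of_int (sign p) * (\<Prod>b\<in>Basis. B b (p b)))"

definition vol_density :: "'e::euclidean_space form2 \<Rightarrow> real" where
  "vol_density B = sqrt \<bar>gram_det B\<bar>"

text \<open>
  The formal adjoint \<open>\<delta>\<close> of \<open>d\<close> on 1-forms,
  \<open>\<delta>\<omega> = - |det G|\<^sup>-\<^sup>1\<^sup>/\<^sup>2 \<partial>\<^sub>b (|det G|\<^sup>1\<^sup>/\<^sup>2 G\<^sup>b\<^sup>c \<omega>\<^sub>c)\<close>; the adjointness relation is lemma
  \<open>codiff_formal_adjoint\<close> below.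
\<close>

definition codiff ::
  "('e::euclidean_space \<Rightarrow> 'e form2) \<Rightarrow> ('e \<Rightarrow> 'e \<Rightarrow> real) \<Rightarrow> 'e \<Rightarrow> real" where
  "codiff G \<omega> x = - (\<Sum>b\<in>Basis.
     frechet_derivative (\<lambda>y. vol_density (G y) * (sharp (G y) (\<omega> y) \<bullet> b)) (at x) b)
     / vol_density (G x)"

definition coord_laplacian ::
  "('e::euclidean_space \<Rightarrow> 'e form2) \<Rightarrow> ('e \<Rightarrow> real) \<Rightarrow> 'e \<Rightarrow> real" where
  "coord_laplacian G u x = - codiff G (\<lambda>y. frechet_derivative u (at y)) x"

lemma integral_directional_derivative_eq_0:
  fixes F :: "'e::euclidean_space \<Rightarrow> real"
  assumes diff: "\<And>x. F differentiable (at x)"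
    and K: "compact K" "\<And>x. x \<notin> K \<Longrightarrow> F x = 0"
    and cont: "continuous_on UNIV (\<lambda>x. frechet_derivative F (at x) b)"
  shows "(\<integral>x. frechet_derivative F (at x) b \<partial>lborel) = 0"
proof -
  define D where "D x = frechet_derivative F (at x) b" for x
  have line: "((\<lambda>t. F (x + t *\<^sub>R b)) has_real_derivative D (x + t *\<^sub>R b)) (at t)" for x t
  proof -
    have "(F has_derivative frechet_derivative F (at (x + t *\<^sub>R b))) (at (x + t *\<^sub>R b))"
      using diff frechet_derivative_works by blast
    moreover have "((\<lambda>t. x + t *\<^sub>R b) has_derivative (\<lambda>h. h *\<^sub>R b)) (at t)"
      by (auto intro!: derivative_eq_intros)
    ultimately have h: "((\<lambda>t. F (x + t *\<^sub>R b)) has_derivative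
        (\<lambda>h. frechet_derivative F (at (x + t *\<^sub>R b)) (h *\<^sub>R b))) (at t)"
      using has_derivative_compose by blast
    have "linear (frechet_derivative F (at (x + t *\<^sub>R b)))"
      by (rule linear_frechet_derivative[OF diff])
    then have "(\<lambda>h. frechet_derivative F (at (x + t *\<^sub>R b)) (h *\<^sub>R b)) = (*) (D (x + t *\<^sub>R b))"
      by (auto simp: D_def linear_scale mult.commute)
    with h show ?thesis by (simp add: has_field_derivative_def)
  qed
  have D0: "D x = 0" if "x \<notin> K" for x
  proof -
    have "open (- K)" using K(1) by (simp add: compact_imp_closed open_Compl)
    have "(F has_derivative (\<lambda>_. 0)) (at x)"
      by (rule has_derivative_transform_within_open[OF has_derivative_const[of 0] \<open>open (- K)\<close>])
         (use that K(2) in auto)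
    then show ?thesis unfolding D_def using frechet_derivative_at by metis
  qed
  have contF: "continuous_on UNIV F"
    using diff by (simp add: continuous_on_eq_continuous_at differentiable_imp_continuous_within)
  have contD: "continuous_on UNIV D" using cont by (simp add: D_def[abs_def])
  obtain R where R: "\<And>x. x \<in> K \<Longrightarrow> norm x \<le> R"
    using compact_imp_bounded[OF K(1)] bounded_iff by blast
  have "compact (D ` K)"
    using compact_continuous_image continuous_on_subset[OF contD] K(1) by blast
  then obtain C0 where C0: "\<And>x. x \<in> K \<Longrightarrow> \<bar>D x\<bar> \<le> C0"
    using compact_imp_bounded[of "D ` K"] unfolding bounded_iff by auto
  define C where "C = max C0 0"
  have C: "\<bar>D x\<bar> \<le> C" for x using C0 D0[of x] by (cases "x \<in> K") (fastforce simp: C_def)+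
  define s where "s n x = (F (x + (1 / real (Suc n)) *\<^sub>R b) - F x) * real (Suc n)" for n x
  define w where "w x = C * indicator (cball 0 (R + norm b)) x" for x :: 'e
  have intF: "integrable lborel F"
  proof -
    have "integrable lborel (\<lambda>x. indicator K x *\<^sub>R F x)"
      by (rule borel_integrable_compact[OF K(1)]) (use continuous_on_subset[OF contF] in blast)
    moreover have "(\<lambda>x. indicator K x *\<^sub>R F x) = F"
      using K(2) by (intro ext) (metis indicator_simps mult_zero_right pth_1 real_scaleR_def)
    ultimately show ?thesis by simp
  qed
  have shift: "integrable lborel (\<lambda>x. F (x + c))" "(\<integral>x. F (x + c) \<partial>lborel) = (\<integral>x. F x \<partial>lborel)" for c
  proof -
    have m: "F \<in> borel_measurable borel" using contF by (rule borel_measurable_continuous_onI)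
    have e: "distr lborel borel (\<lambda>x. x + c) = lborel"
      using lborel_distr_plus[of c] unfolding add.commute[of c, abs_def] .
    show "(\<integral>x. F (x + c) \<partial>lborel) = (\<integral>x. F x \<partial>lborel)"
      using integral_distr[of "\<lambda>x. x + c" lborel borel F] m e by simp
    show "integrable lborel (\<lambda>x. F (x + c))"
      using integrable_distr[of "\<lambda>x. x + c" lborel borel F] intF e by simp
  qed
  have int0: "(\<integral>x. s n x \<partial>lborel) = 0" for n
    using shift intF by (simp add: s_def)
  have lim: "(\<lambda>n. s n x) \<longlonglongrightarrow> D x" for x
  proof -
    have "(\<lambda>h. (F (x + h *\<^sub>R b) - F x) / h) \<midarrow>0\<rightarrow> D x"
      using line[of x 0] by (simp add: DERIV_def)
    moreover have "filterlim (\<lambda>n. 1 / real (Suc n)) (at 0) sequentially"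
      unfolding filterlim_at using LIMSEQ_inverse_real_of_nat by (auto simp: inverse_eq_divide)
    ultimately have "(\<lambda>n. (F (x + (1 / real (Suc n)) *\<^sub>R b) - F x) / (1 / real (Suc n))) \<longlonglongrightarrow> D x"
      by (rule filterlim_compose)
    then show ?thesis by (simp add: s_def)
  qed
  have bound: "norm (s n x) \<le> w x" for n x
  proof (cases "norm x \<le> R + norm b")
    case True
    define h where "h = 1 / real (Suc n)"
    have "0 < h" by (simp add: h_def)
    obtain z where z: "F (x + h *\<^sub>R b) - F (x + 0 *\<^sub>R b) = (h - 0) * D (x + z *\<^sub>R b)"
      using MVT2[OF \<open>0 < h\<close>, of "\<lambda>t. F (x + t *\<^sub>R b)" "\<lambda>t. D (x + t *\<^sub>R b)"] line by blast
    have "s n x = D (x + z *\<^sub>R b)" using z by (simp add: s_def h_def field_simps)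
    with C True show ?thesis by (simp add: w_def)
  next
    case False
    have "norm ((1 / real (Suc n)) *\<^sub>R b) \<le> norm b"
      by (simp add: field_simps mult_left_le)
    then have "norm x - norm b \<le> norm (x + (1 / real (Suc n)) *\<^sub>R b)"
      using norm_diff_ineq[of x "(1 / real (Suc n)) *\<^sub>R b"] by linarith
    then have "R < norm (x + (1 / real (Suc n)) *\<^sub>R b)" using False by linarith
    then have "x + (1 / real (Suc n)) *\<^sub>R b \<notin> K" using R by fastforce
    moreover have "x \<notin> K" using R[of x] False norm_ge_zero[of b] by linarith
    ultimately show ?thesis using False K(2) by (simp add: s_def w_def)
  qed
  have "(\<lambda>n. \<integral>x. s n x \<partial>lborel) \<longlonglongrightarrow> (\<integral>x. D x \<partial>lborel)"
  proof (rule integral_dominated_convergence)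
    show "D \<in> borel_measurable lborel" using contD by (simp add: borel_measurable_continuous_onI)
    show "s n \<in> borel_measurable lborel" for n
      unfolding s_def[abs_def] using shift(1) intF
      by (intro borel_measurable_times borel_measurable_diff) auto
    show "integrable lborel w" unfolding w_def[abs_def]
      by (intro integrable_mult_right integrable_real_indicator) (auto intro: emeasure_bounded_finite[simplified])
  qed (use lim bound in auto)
  then have "(\<integral>x. D x \<partial>lborel) = 0" using int0 by (simp add: LIMSEQ_const_iff)
  then show ?thesis by (simp add: D_def)
qed

lemma codiff_formal_adjoint:
  fixes G :: "'e::euclidean_space \<Rightarrow> 'e form2" and \<omega> :: "'e \<Rightarrow> 'e \<Rightarrow> real" and \<phi> :: "'e \<Rightarrow> real"
  assumes S: "open S" "\<And>x. x \<in> S \<Longrightarrow> gram_det (G x) \<noteq> 0"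
    and V: "Ck_on 1 S (\<lambda>x. vol_density (G x) *\<^sub>R sharp (G x) (\<omega> x))"
    and phi: "Ck_on 1 S \<phi>" "compact K" "K \<subseteq> S" "\<And>x. x \<notin> K \<Longrightarrow> \<phi> x = 0"
  shows "(\<integral>x\<in>S. frechet_derivative \<phi> (at x) (sharp (G x) (\<omega> x)) * vol_density (G x) \<partial>lborel)
       = (\<integral>x\<in>S. \<phi> x * codiff G \<omega> x * vol_density (G x) \<partial>lborel)"
proof -
  define V where "V x = vol_density (G x) *\<^sub>R sharp (G x) (\<omega> x)" for x
  define F where "F b x = \<phi> x * (V x \<bullet> b)" for b x
  define DV where "DV x = frechet_derivative V (at x)" for x
  define D\<phi> where "D\<phi> x = frechet_derivative \<phi> (at x)" for x
  have opK: "open (- K)" using phi(2) by (simp add: compact_imp_closed open_Compl)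
  have Vd: "(V has_derivative DV x) (at x)" if "x \<in> S" for x
    using V that frechet_derivative_works by (auto simp: V_def[abs_def] DV_def)
  have Pd: "(\<phi> has_derivative D\<phi> x) (at x)" if "x \<in> S" for x
    using phi(1) that frechet_derivative_works by (auto simp: D\<phi>_def)
  have Fd: "(F b has_derivative (\<lambda>h. \<phi> x * (DV x h \<bullet> b) + D\<phi> x h * (V x \<bullet> b))) (at x)"
    if "x \<in> S" for x b
    unfolding F_def[abs_def] by (rule derivative_eq_intros Vd Pd that refl)+ auto
  have Fd0: "(F b has_derivative (\<lambda>_. 0)) (at x)" if "x \<notin> K" for x b
    by (rule has_derivative_transform_within_open[OF has_derivative_const[of 0] opK])
       (use that phi(4) in \<open>auto simp: F_def\<close>)
  have un: "S \<union> - K = UNIV" using phi(3) by auto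
  have diff: "F b differentiable (at x)" for b x
    using Fd[of x b] Fd0[of x b] un unfolding differentiable_def by blast
  have fr: "frechet_derivative (F b) (at x) b = \<phi> x * (DV x b \<bullet> b) + D\<phi> x b * (V x \<bullet> b)"
    if "x \<in> S" for b x using frechet_derivative_at[OF Fd[OF that, of b]] by metis
  have fr0: "frechet_derivative (F b) (at x) b = 0" if "x \<notin> K" for b x
    using frechet_derivative_at[OF Fd0[OF that, of b]] by metis
  have cV: "continuous_on S V"
    using Vd by (meson S(1) continuous_on_eq_continuous_at has_derivative_continuous)
  have cP: "continuous_on S \<phi>"
    using Pd by (meson S(1) continuous_on_eq_continuous_at has_derivative_continuous)
  have cont: "continuous_on UNIV (\<lambda>x. frechet_derivative (F b) (at x) b)" for b
  proof -
    have "continuous_on S (\<lambda>x. DV x b)" "continuous_on S (\<lambda>x. D\<phi> x b)"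
      using V phi(1) by (auto simp: DV_def D\<phi>_def V_def[abs_def])
    then have "continuous_on S (\<lambda>x. \<phi> x * (DV x b \<bullet> b) + D\<phi> x b * (V x \<bullet> b))"
      using cV cP by (intro continuous_intros)
    then have 1: "continuous_on S (\<lambda>x. frechet_derivative (F b) (at x) b)"
      by (rule continuous_on_eq) (simp add: fr)
    have 2: "continuous_on (- K) (\<lambda>x. frechet_derivative (F b) (at x) b)"
      by (rule continuous_on_eq[OF continuous_on_const[of _ 0]]) (simp add: fr0)
    show ?thesis using continuous_on_open_Un[OF S(1) opK 1 2] un by simp
  qed
  have i0: "(\<integral>x. frechet_derivative (F b) (at x) b \<partial>lborel) = 0" for b
    by (rule integral_directional_derivative_eq_0[OF diff phi(2) _ cont])
       (use phi(4) in \<open>auto simp: F_def\<close>)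
  have intK: "set_integrable lborel S f" if "continuous_on K f" "\<And>x. x \<in> S - K \<Longrightarrow> f x = 0"
    for f :: "'e \<Rightarrow> real"
  proof -
    have "(\<lambda>x. indicator S x *\<^sub>R f x) = (\<lambda>x. indicator K x *\<^sub>R f x)"
      using that(2) phi(3) by (auto simp: indicator_def fun_eq_iff)
    then show ?thesis using borel_integrable_compact[OF phi(2) that(1)]
      by (simp add: set_integrable_def)
  qed
  have P0: "D\<phi> x = (\<lambda>_. 0)" if "x \<notin> K" for x
  proof -
    have "(\<phi> has_derivative (\<lambda>_. 0)) (at x)"
      by (rule has_derivative_transform_within_open[OF has_derivative_const[of 0] opK])
         (use that phi(4) in auto)
    then show ?thesis unfolding D\<phi>_def using frechet_derivative_at by metis
  qed
  have vp: "vol_density (G x) > 0" if "x \<in> S" for x using S(2)[OF that] by (simp add: vol_density_def)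
  let ?l = "\<lambda>x. \<Sum>b\<in>Basis. D\<phi> x b * (V x \<bullet> b)"
  let ?r = "\<lambda>x. - (\<Sum>b\<in>Basis. \<phi> x * (DV x b \<bullet> b))"
  have l: "frechet_derivative \<phi> (at x) (sharp (G x) (\<omega> x)) * vol_density (G x) = ?l x"
    if "x \<in> S" for x
  proof -
    have lin: "linear (D\<phi> x)" using Pd[OF that] has_derivative_linear by blast
    have "D\<phi> x (V x) = D\<phi> x (\<Sum>b\<in>Basis. (V x \<bullet> b) *\<^sub>R b)" by (simp add: euclidean_representation)
    also have "\<dots> = ?l x" by (simp add: linear_sum[OF lin] linear_scale[OF lin] mult.commute)
    finally show ?thesis using linear_scale[OF lin] by (simp add: V_def D\<phi>_def mult.commute)
  qed
  have r: "\<phi> x * codiff G \<omega> x * vol_density (G x) = ?r x" if "x \<in> S" for x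
  proof -
    have "frechet_derivative (\<lambda>y. vol_density (G y) * (sharp (G y) (\<omega> y) \<bullet> b)) (at x) b = DV x b \<bullet> b"
      for b
    proof -
      have "((\<lambda>y. V y \<bullet> b) has_derivative (\<lambda>h. DV x h \<bullet> b)) (at x)"
        by (rule derivative_eq_intros Vd that refl)+ auto
      from frechet_derivative_at[OF this, symmetric] show ?thesis by (simp add: V_def)
    qed
    then show ?thesis using vp[OF that] by (simp add: codiff_def sum_distrib_left)
  qed
  have cK: "continuous_on K \<phi>" "continuous_on K V" "\<And>b. continuous_on K (\<lambda>x. DV x b)"
     "\<And>b. continuous_on K (\<lambda>x. D\<phi> x b)"
    using cV cP V phi(1,3) continuous_on_subset
    by (auto simp: DV_def D\<phi>_def V_def[abs_def]) blast+
  have il: "set_integrable lborel S ?l" using cK P0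
    by (intro intK continuous_intros) auto
  have ir: "set_integrable lborel S ?r" using cK phi(4)
    by (intro intK continuous_intros) auto
  have ib: "set_integrable lborel S (\<lambda>x. frechet_derivative (F b) (at x) b)" for b
    by (rule intK) (use cont continuous_on_subset fr0 in blast)+
  have "(\<integral>x\<in>S. ?l x \<partial>lborel) - (\<integral>x\<in>S. ?r x \<partial>lborel) = (\<integral>x\<in>S. ?l x - ?r x \<partial>lborel)"
    using set_integral_diff[OF il ir] by simp
  also have "\<dots> = (\<integral>x\<in>S. (\<Sum>b\<in>Basis. frechet_derivative (F b) (at x) b) \<partial>lborel)"
    using S(1) by (intro set_lebesgue_integral_cong) (auto simp: fr sum.distrib)
  also have "\<dots> = (\<Sum>b\<in>Basis. (\<integral>x\<in>S. frechet_derivative (F b) (at x) b \<partial>lborel))"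
    using ib unfolding set_lebesgue_integral_def set_integrable_def scaleR_sum_right
    by (intro Bochner_Integration.integral_sum)
  also have "\<dots> = (\<Sum>b\<in>Basis. (\<integral>x. frechet_derivative (F b) (at x) b \<partial>lborel))"
    unfolding set_lebesgue_integral_def
    by (intro sum.cong Bochner_Integration.integral_cong refl)
       (use fr0 phi(3) in \<open>auto simp: indicator_def\<close>)
  also have "\<dots> = 0" by (simp add: i0)
  finally have eq: "(\<integral>x\<in>S. ?l x \<partial>lborel) = (\<integral>x\<in>S. ?r x \<partial>lborel)" by simp
  have "(\<integral>x\<in>S. frechet_derivative \<phi> (at x) (sharp (G x) (\<omega> x)) * vol_density (G x) \<partial>lborel)
      = (\<integral>x\<in>S. ?l x \<partial>lborel)"
    using S(1) l by (intro set_lebesgue_integral_cong) auto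
  also have "\<dots> = (\<integral>x\<in>S. \<phi> x * codiff G \<omega> x * vol_density (G x) \<partial>lborel)"
    unfolding eq using S(1) r by (intro set_lebesgue_integral_cong) auto
  finally show ?thesis .
qed

text \<open>
  Levi-Civita connection (Koszul formula for constant coordinate fields), curvature
  \<open>R(u,v)w = \<nabla>\<^sub>u \<nabla>\<^sub>v w - \<nabla>\<^sub>v \<nabla>\<^sub>u w\<close> for constant coordinate fields, and
  \<open>Ric(v,w) = tr (u \<mapsto> R(u,v)w)\<close>, which is positive on round spheres.
\<close>

definition christoffel :: "('e::euclidean_space \<Rightarrow> 'e form2) \<Rightarrow> 'e \<Rightarrow> 'e \<Rightarrow> 'e \<Rightarrow> 'e" where
  "christoffel G x v w = sharp (G x) (\<lambda>y.
     (frechet_derivative (\<lambda>z. G z w y) (at x) v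
    + frechet_derivative (\<lambda>z. G z v y) (at x) w
    - frechet_derivative (\<lambda>z. G z v w) (at x) y) / 2)"

definition curvature ::
  "('e::euclidean_space \<Rightarrow> 'e form2) \<Rightarrow> 'e \<Rightarrow> 'e \<Rightarrow> 'e \<Rightarrow> 'e \<Rightarrow> 'e" where
  "curvature G x u v w =
     frechet_derivative (\<lambda>z. christoffel G z v w) (at x) u
   - frechet_derivative (\<lambda>z. christoffel G z u w) (at x) v
   + christoffel G x u (christoffel G x v w)
   - christoffel G x v (christoffel G x u w)"

definition ricci :: "('e::euclidean_space \<Rightarrow> 'e form2) \<Rightarrow> 'e \<Rightarrow> 'e form2" where
  "ricci G x v w = (\<Sum>b\<in>Basis. curvature G x b v w \<bullet> b)"


section \<open>Manifolds, metrics and the Laplacian\<close>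

text \<open>
  An atlas is an indexed family of charts; a chart is a pair of its domain and its coordinate map.
  The model space is an arbitrary Euclidean space \<open>'e\<close>, so the dimension is \<open>DIM('e)\<close>.
  The manifold is the union of the chart domains, an open subset of the ambient type.
\<close>

type_synonym ('i, 'a, 'e) atlas = "'i \<Rightarrow> 'a set \<times> ('a \<Rightarrow> 'e)"

abbreviation cdom :: "('i, 'a, 'e) atlas \<Rightarrow> 'i \<Rightarrow> 'a set" where
  "cdom A i \<equiv> fst (A i)"

abbreviation cmap :: "('i, 'a, 'e) atlas \<Rightarrow> 'i \<Rightarrow> 'a \<Rightarrow> 'e" where
  "cmap A i \<equiv> snd (A i)"

definition cimg :: "('i, 'a, 'e) atlas \<Rightarrow> 'i \<Rightarrow> 'e set" where
  "cimg A i = cmap A i ` cdom A i"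

definition cinv :: "('i, 'a, 'e) atlas \<Rightarrow> 'i \<Rightarrow> 'e \<Rightarrow> 'a" where
  "cinv A i = inv_into (cdom A i) (cmap A i)"

definition carrier :: "('i, 'a, 'e) atlas \<Rightarrow> 'a set" where
  "carrier A = (\<Union>i. cdom A i)"

definition transition :: "('i, 'a, 'e) atlas \<Rightarrow> 'i \<Rightarrow> 'i \<Rightarrow> 'e \<Rightarrow> 'e" where
  "transition A i j = cmap A j \<circ> cinv A i"

definition smooth_manifold ::
  "('i, 'a::{t2_space, second_countable_topology}, 'e::euclidean_space) atlas \<Rightarrow> bool" where
  "smooth_manifold A \<longleftrightarrow>
     (\<forall>i. open (cdom A i) \<and> open (cimg A i) \<and>
          homeomorphism (cdom A i) (cimg A i) (cmap A i) (cinv A i)) \<and>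
     (\<forall>i j. smooth_on (cmap A i ` (cdom A i \<inter> cdom A j)) (transition A i j))"

definition smooth_fun :: "('i, 'a, 'e::euclidean_space) atlas \<Rightarrow> ('a \<Rightarrow> real) \<Rightarrow> bool" where
  "smooth_fun A u \<longleftrightarrow> (\<forall>i. smooth_on (cimg A i) (u \<circ> cinv A i))"

text \<open>A covariant 2-tensor is given by its component functions in every chart.\<close>

type_synonym ('i, 'e) tensor2 = "'i \<Rightarrow> 'e \<Rightarrow> 'e form2"

definition riemannian_metric ::
  "('i, 'a, 'e::euclidean_space) atlas \<Rightarrow> ('i, 'e) tensor2 \<Rightarrow> bool" where
  "riemannian_metric A g \<longleftrightarrow>
     (\<forall>i. \<forall>x\<in>cimg A i. bilinear (g i x) \<and> (\<forall>v w. g i x v w = g i x w v) \<and>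
        (\<forall>v. v \<noteq> 0 \<longrightarrow> 0 < g i x v v)) \<and>
     (\<forall>i v w. smooth_on (cimg A i) (\<lambda>x. g i x v w)) \<and>
     (\<forall>i j. \<forall>x\<in>cmap A i ` (cdom A i \<inter> cdom A j). \<forall>v w.
        g i x v w = g j (transition A i j x)
          (frechet_derivative (transition A i j) (at x) v)
          (frechet_derivative (transition A i j) (at x) w))"

text \<open>
  The Laplacian \<open>- \<delta> d\<close> of a pseudo-Riemannian manifold. The coordinate expression is invariant
  under change of coordinates, so the choice of the chart is immaterial.
\<close>

definition laplacian ::
  "('i, 'a, 'e::euclidean_space) atlas \<Rightarrow> ('i, 'e) tensor2 \<Rightarrow> ('a \<Rightarrow> real) \<Rightarrow> 'a \<Rightarrow> real" where
  "laplacian A g u p = (let i = (SOME i. p \<in> cdom A i)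
     in coord_laplacian (g i) (u \<circ> cinv A i) (cmap A i p))"

text \<open>The product atlases of \<open>M \<times> J\<close> and \<open>(0,\<infinity>) \<times> M \<times> J\<close>, for an open interval \<open>J\<close>.\<close>

definition times_atlas ::
  "('i, 'a, 'e) atlas \<Rightarrow> real set \<Rightarrow> ('i, 'a \<times> real, 'e \<times> real) atlas" where
  "times_atlas A J i = (cdom A i \<times> J, \<lambda>(q, s). (cmap A i q, s))"

definition cone_atlas ::
  "('i, 'a, 'e) atlas \<Rightarrow> real set \<Rightarrow> ('i, real \<times> 'a \<times> real, real \<times> 'e \<times> real) atlas" where
  "cone_atlas A J i = ({0<..} \<times> cdom A i \<times> J, \<lambda>(t, q, s). (t, cmap A i q, s))"


section \<open>Poincare-Einstein metrics\<close>

text \<open>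
  The primary datum is the family \<open>\<gamma> \<rho>\<close> of metrics on \<open>M\<close>, smooth in all variables near
  \<open>\<rho> = 0\<close>, and \<open>g\<^sub>r = \<gamma> (- r\<^sup>2 / 2)\<close>. This is how \<open>g\<^sub>r\<close> is even in \<open>r\<close>, with
  Taylor series \<open>g + r\<^sup>2 g\<^sub>(\<^sub>2\<^sub>) + \<dots>\<close>. With \<open>0 < r < \<epsilon>\<close> the parameter \<open>\<rho>\<close> runs through
  the negative half of \<open>rho_range \<epsilon>\<close>; for \<open>\<rho> > 0\<close> the family is any smooth continuation, which
  influences no Taylor coefficient at \<open>\<rho> = 0\<close>.
\<close>

type_synonym ('i, 'e) metric_family = "real \<Rightarrow> ('i, 'e) tensor2"

definition rho_range :: "real \<Rightarrow> real set" where
  "rho_range \<epsilon> = {- (\<epsilon>\<^sup>2 / 2) <..< \<epsilon>\<^sup>2 / 2}"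

definition rho_of :: "real \<Rightarrow> real" where
  "rho_of r = - (r\<^sup>2 / 2)"

definition smooth_metric_family ::
  "('i, 'a, 'e::euclidean_space) atlas \<Rightarrow> real set \<Rightarrow> ('i, 'e) metric_family \<Rightarrow> bool" where
  "smooth_metric_family A J \<gamma> \<longleftrightarrow>
     (\<forall>\<rho>\<in>J. riemannian_metric A (\<gamma> \<rho>)) \<and>
     (\<forall>i v w. smooth_on (cimg A i \<times> J) (\<lambda>(x, \<rho>). \<gamma> \<rho> i x v w))"

text \<open>\<open>g\<^sub>+ = r\<^sup>-\<^sup>2 (dr\<^sup>2 + g\<^sub>r)\<close> on \<open>M \<times> (0,\<epsilon>)\<close>, in the charts of the product atlas.\<close>

definition pe_metric ::
  "('i, 'e::euclidean_space) metric_family \<Rightarrow> ('i, 'e \<times> real) tensor2" where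
  "pe_metric \<gamma> i = (\<lambda>(x, r) (v, a) (w, b). (a * b + \<gamma> (rho_of r) i x v w) / r\<^sup>2)"

text \<open>The Einstein tensor \<open>Ric(g\<^sub>+) + n g\<^sub>+\<close>, where \<open>n = dim M\<close>.\<close>

definition pe_tensor ::
  "('i, 'e::euclidean_space) metric_family \<Rightarrow> ('i, 'e \<times> real) tensor2" where
  "pe_tensor \<gamma> i z \<xi> \<eta> =
     ricci (pe_metric \<gamma> i) z \<xi> \<eta> + real (DIM('e)) * pe_metric \<gamma> i z \<xi> \<eta>"

text \<open>
  For a tensor whose components extend smoothly to \<open>r = 0\<close>, as those of \<open>pe_tensor \<gamma>\<close> do,
  \<open>O(r\<^sup>m)\<close> means this estimate for each component at each point of \<open>M\<close>.
\<close>

definition vanishes_to_order ::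
  "('i, 'a, 'e::euclidean_space) atlas \<Rightarrow> ('i, 'e \<times> real) tensor2 \<Rightarrow> nat \<Rightarrow> bool" where
  "vanishes_to_order A E m \<longleftrightarrow>
     (\<forall>i. \<forall>x\<in>cimg A i. \<forall>\<xi> \<eta>. (\<lambda>r. E i (x, r) \<xi> \<eta>) \<in> O[at_right 0](\<lambda>r. r ^ m))"

text \<open>
  The \<open>g\<close>-trace of the coefficient \<open>C\<close> of \<open>r\<^sup>m\<close> (in the directions tangent to \<open>M\<close>) of a tensor
  that is \<open>O(r\<^sup>m)\<close>.
\<close>

definition traceless_leading_coeff ::
  "('i, 'a, 'e::euclidean_space) atlas \<Rightarrow> ('i, 'e) tensor2 \<Rightarrow> ('i, 'e \<times> real) tensor2 \<Rightarrow> nat \<Rightarrow> bool"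
  where
  "traceless_leading_coeff A g E m \<longleftrightarrow>
     (\<forall>i. \<forall>x\<in>cimg A i. \<exists>C.
        (\<forall>v w. ((\<lambda>r. E i (x, r) (v, 0) (w, 0) / r ^ m) \<longlongrightarrow> C v w) (at_right 0)) \<and>
        metric_trace (g i x) C = 0)"

definition poincare_einstein ::
  "('i, 'a, 'e::euclidean_space) atlas \<Rightarrow> ('i, 'e) tensor2 \<Rightarrow> real \<Rightarrow> ('i, 'e) metric_family \<Rightarrow> bool"
  where
  "poincare_einstein A g \<epsilon> \<gamma> \<longleftrightarrow>
     0 < \<epsilon> \<and> smooth_metric_family A (rho_range \<epsilon>) \<gamma> \<and>
     (\<forall>i. \<forall>x\<in>cimg A i. \<gamma> 0 i x = g i x) \<and>
     (if odd (DIM('e)) then \<forall>m. vanishes_to_order A (pe_tensor \<gamma>) m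
      else vanishes_to_order A (pe_tensor \<gamma>) (DIM('e) - 2) \<and>
           traceless_leading_coeff A g (pe_tensor \<gamma>) (DIM('e) - 2))"

text \<open>
  \<open>v(r) = vol(g\<^sub>r) / vol(g)\<close>, a function on \<open>M\<close> that does not depend on the chart, and the Taylor
  coefficients of \<open>w = \<surd>v\<close>: \<open>w_coeff A g \<gamma> k\<close> is \<open>w\<^sub>k\<close>, the coefficient of \<open>r\<^sup>k\<close>.
\<close>

definition vol_ratio ::
  "('i, 'a, 'e::euclidean_space) atlas \<Rightarrow> ('i, 'e) tensor2 \<Rightarrow> ('i, 'e) metric_family \<Rightarrow> 'a \<Rightarrow> real \<Rightarrow> real"
  where
  "vol_ratio A g \<gamma> p r = (let i = (SOME i. p \<in> cdom A i); x = cmap A i p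
     in vol_density (\<gamma> (rho_of r) i x) / vol_density (g i x))"

definition w_coeff ::
  "('i, 'a, 'e::euclidean_space) atlas \<Rightarrow> ('i, 'e) tensor2 \<Rightarrow> ('i, 'e) metric_family \<Rightarrow> nat \<Rightarrow> 'a \<Rightarrow> real"
  where
  "w_coeff A g \<gamma> k p = (deriv ^^ k) (\<lambda>r. sqrt (vol_ratio A g \<gamma> p r)) 0 / fact k"


section \<open>GJMS operators and Q-curvatures\<close>

text \<open>The ambient metric \<open>2 t dt d\<rho> + 2 \<rho> dt\<^sup>2 + t\<^sup>2 g(\<rho>)\<close>; a point is \<open>(t, x, \<rho>)\<close>.\<close>

definition ambient_metric ::
  "('i, 'e::euclidean_space) metric_family \<Rightarrow> ('i, real \<times> 'e \<times> real) tensor2" where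
  "ambient_metric \<gamma> i = (\<lambda>(t, x, \<rho>) (a, v, \<alpha>) (b, w, \<beta>).
     t * (a * \<beta> + \<alpha> * b) + 2 * \<rho> * a * b + t\<^sup>2 * \<gamma> \<rho> i x v w)"

definition ambient_laplacian ::
  "('i, 'a, 'e::euclidean_space) atlas \<Rightarrow> real \<Rightarrow> ('i, 'e) metric_family \<Rightarrow>
     (real \<times> 'a \<times> real \<Rightarrow> real) \<Rightarrow> real \<times> 'a \<times> real \<Rightarrow> real" where
  "ambient_laplacian A \<epsilon> \<gamma> = laplacian (cone_atlas A (rho_range \<epsilon>)) (ambient_metric \<gamma>)"

definition smooth_extension ::
  "('i, 'a, 'e::euclidean_space) atlas \<Rightarrow> real \<Rightarrow> ('a \<Rightarrow> real) \<Rightarrow> ('a \<times> real \<Rightarrow> real) \<Rightarrow> bool" where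
  "smooth_extension A \<epsilon> u U \<longleftrightarrow>
     smooth_fun (times_atlas A (rho_range \<epsilon>)) U \<and> (\<forall>q\<in>carrier A. U (q, 0) = u q)"

text \<open>
  \<open>gjms A \<epsilon> \<gamma> N\<close> is \<open>P\<^sub>2\<^sub>N\<close>: its value is the number that all smooth extensions of \<open>u\<close> yield.
\<close>

definition gjms ::
  "('i, 'a, 'e::euclidean_space) atlas \<Rightarrow> real \<Rightarrow> ('i, 'e) metric_family \<Rightarrow> nat \<Rightarrow>
     ('a \<Rightarrow> real) \<Rightarrow> 'a \<Rightarrow> real" where
  "gjms A \<epsilon> \<gamma> N u p = (THE y. \<forall>U. smooth_extension A \<epsilon> u U \<longrightarrow>
     y = (ambient_laplacian A \<epsilon> \<gamma> ^^ N)
           (\<lambda>(t, q, \<rho>). t powr (real N - real (DIM('e)) / 2) * U (q, \<rho>)) (1, p, 0))"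

definition q_curvature ::
  "('i, 'a, 'e::euclidean_space) atlas \<Rightarrow> real \<Rightarrow> ('i, 'e) metric_family \<Rightarrow> nat \<Rightarrow> 'a \<Rightarrow> real" where
  "q_curvature A \<epsilon> \<gamma> N p =
     (if 2 * N = DIM('e)
      then (- 1) ^ (N + 1) * (ambient_laplacian A \<epsilon> \<gamma> ^^ N) (\<lambda>(t, q, \<rho>). ln t) (1, p, 0)
      else gjms A \<epsilon> \<gamma> N (\<lambda>_. 1) p / ((- 1) ^ N * (real (DIM('e)) / 2 - real N)))"


section \<open>Compositions\<close>

text \<open>
  \<open>compositions k\<close> are the compositions of size \<open>k\<close>; list positions are counted from 0.
\<close>

definition compositions :: "nat \<Rightarrow> nat list set" where
  "compositions k = {I. (\<forall>j\<in>set I. 1 \<le> j) \<and> sum_list I = k}"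

definition m_coeff :: "nat list \<Rightarrow> real" where
  "m_coeff I = - ((- 1) ^ length I) * fact (sum_list I) * fact (sum_list I - 1)
     * (\<Prod>j<length I. 1 / (fact (I ! j) * fact (I ! j - 1)))
     * (\<Prod>j<length I - 1. 1 / (real (I ! j) + real (I ! (j + 1))))"

definition n_coeff :: "nat list \<Rightarrow> real" where
  "n_coeff I = (\<Prod>j<length I.
     real (((\<Sum>k\<le>j. I ! k) - 1) choose (I ! j - 1))
   * real (((\<Sum>k\<in>{j..<length I}. I ! k) - 1) choose (I ! j - 1)))"

text \<open>\<open>op_comp P [I\<^sub>1, \<dots>, I\<^sub>r] = P I\<^sub>1 \<circ> \<dots> \<circ> P I\<^sub>r\<close>\<close>

definition op_comp :: "(nat \<Rightarrow> 'f \<Rightarrow> 'f) \<Rightarrow> nat list \<Rightarrow> 'f \<Rightarrow> 'f" where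
  "op_comp P I = foldr P I"

definition m_op ::
  "('i, 'a, 'e::euclidean_space) atlas \<Rightarrow> real \<Rightarrow> ('i, 'e) metric_family \<Rightarrow> nat \<Rightarrow>
     ('a \<Rightarrow> real) \<Rightarrow> 'a \<Rightarrow> real" where
  "m_op A \<epsilon> \<gamma> N u p = (\<Sum>I\<in>compositions N. m_coeff I * op_comp (gjms A \<epsilon> \<gamma>) I u p)"

lemma finite_compositions: "finite (compositions k)"
proof (rule finite_subset)
  have "length I \<le> sum_list I" if "\<forall>j\<in>set I. 1 \<le> j" for I :: "nat list"
    using that by (induction I) auto
  then show "compositions k \<subseteq> {I. set I \<subseteq> {..k} \<and> length I \<le> k}"
    by (auto simp: compositions_def intro: member_le_sum_list)
  show "finite {I. set I \<subseteq> {..k} \<and> length I \<le> k}"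
    by (rule finite_lists_length_le) simp
qed

end

theory Submission
  imports Defs "HOL-Library.Function_Algebras"
begin

text \<open>
  The family \<open>\<gamma> \<rho>\<close> of metrics enters the ambient metric only through its slices, and with
  \<open>w = \<surd>v\<close>, regarded as a function of \<open>(x, \<rho>)\<close>, one computes
  that the ambient Laplacian maps \<open>t\<^sup>s w\<^sup>-\<^sup>1 V\<close> to \<open>t\<^bsup>s-2\<^esup> w\<^sup>-\<^sup>1 D\<^sub>c V\<close> with
  \<open>D\<^sub>c = - 2 \<rho> \<partial>\<^sub>\<rho>\<^sup>2 + 2 c \<partial>\<^sub>\<rho> + M(\<rho>)\<close> and \<open>2 c = 2 s + n - 2\<close>,
  where \<open>M(\<rho>)\<close> differentiates in \<open>x\<close> only and does not depend on \<open>s\<close>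
  (\<open>cone_laplacian_product\<close>, \<open>conjugation\<close>). Hence \<open>P\<^sub>2\<^sub>N u\<close> is the value at
  \<open>\<rho> = 0\<close> of \<open>D\<^bsub>1-N\<^esub> \<dots> D\<^bsub>N-3\<^esub> D\<^bsub>N-1\<^esub> V\<close> for any \<open>V\<close> with \<open>V = u\<close> at
  \<open>\<rho> = 0\<close>. This is a statement about Taylor coefficients in \<open>\<rho>\<close>, that is, about formal
  power series whose coefficients are smooth functions of \<open>x\<close>.

  On formal power series, \<open>D\<^sub>c \<rho> = \<rho> D\<^bsub>c-2\<^esub> + 2c\<close>, and the parameters
  \<open>N - 1, N - 3, \<dots>, 1 - N\<close> sum to zero, so that the product depends on \<open>V\<close> at \<open>\<rho> = 0\<close>
  only (\<open>dops_depends_on_0\<close>). The product \<open>T = D\<^bsub>1-N\<^esub> \<dots> D\<^bsub>N-3\<^esub>\<close> of the last \<open>N - 1\<close>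
  factors maps \<open>\<rho>\<^bsup>N-1\<^esup> R + O(\<rho>\<^bsup>N\<^esup>)\<close> to \<open>(-2)\<^bsup>N-1\<^esup> (N-1)!\<^sup>2 R\<close> at
  \<open>\<rho> = 0\<close>. For a given series \<open>f\<close> the equation \<open>D\<^bsub>N-1\<^esub> F = f\<close>, \<open>F = u\<close> at \<open>\<rho> = 0\<close>,
  can be solved recursively up to the coefficient of \<open>\<rho>\<^bsup>N-2\<^esup>\<close>, and comparing
  coefficients of \<open>\<rho>\<^bsup>N-1\<^esup>\<close> yields \<open>(T f)(0)\<close> (\<open>formal_juhl\<close>). Unwinding the recursion
  produces one term for each composition, and its weights \<open>1 / (s (N - s))\<close> at the partial sums
  \<open>s\<close> multiply up to \<open>n\<^sub>I\<close> (\<open>n_coeff_eq_nu\<close>). With \<open>f = 0\<close> this expresses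
  \<open>P\<^sub>2\<^sub>N\<close> by the normalized Taylor coefficients of \<open>M(\<rho>)\<close>; since the expression is
  triangular and is inverted by the coefficients \<open>m\<^sub>I\<close> (\<open>juhl_inversion\<close>), these
  coefficients are the operators \<open>\<M>\<^sub>2\<^sub>N\<close>. With \<open>f = \<partial>\<^sub>\<rho> w\<close> and \<open>u = 0\<close> it gives
  the right-hand side of the theorem, because \<open>(-1)\<^sup>N Q\<^sub>2\<^sub>N = - 2 (T \<partial>\<^sub>\<rho> w)(0)\<close>: the constant
  function corresponds to \<open>V = w\<close>, and \<open>M(\<rho>) w = 2 \<rho> w'' - (n - 2) w'\<close> implies
  \<open>D\<^bsub>N-1\<^esub> w = 2 (N - n/2) \<partial>\<^sub>\<rho> w\<close>; in the critical case the first ambient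
  Laplacian turns \<open>log t\<close> into \<open>2 t\<^sup>-\<^sup>2 w\<^sup>-\<^sup>1 \<partial>\<^sub>\<rho> w\<close>.

  These computations take place in one chart. They describe iterates of the ambient Laplacian
  because the coordinate expression of the Laplacian is invariant
  (\<open>coord_laplacian_change_of_coordinates\<close>).
\<close>

section \<open>Calculus of smooth functions\<close>

lemma frechet_derivative_cong_open:
  assumes "open S" "x \<in> S" "\<And>y. y \<in> S \<Longrightarrow> f y = g y"
  shows "frechet_derivative f (at x) = frechet_derivative g (at x)"
    and "f differentiable (at x) \<longleftrightarrow> g differentiable (at x)"
proof -
  have "(f has_derivative D) (at x) \<longleftrightarrow> (g has_derivative D) (at x)" for D
    using has_derivative_transform_within_open[OF _ assms(1,2), of f D UNIV g]
      has_derivative_transform_within_open[OF _ assms(1,2), of g D UNIV f] assms(3) by auto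
  then show "frechet_derivative f (at x) = frechet_derivative g (at x)"
    and "f differentiable (at x) \<longleftrightarrow> g differentiable (at x)"
    by (simp_all add: frechet_derivative_def differentiable_def)
qed

lemma Ck_on_cong:
  assumes "open S" "\<And>y. y \<in> S \<Longrightarrow> f y = g y"
  shows "Ck_on k S f \<longleftrightarrow> Ck_on k S g"
  using assms(2)
proof (induction k arbitrary: f g)
  case 0
  then show ?case by (simp cong: continuous_on_cong)
next
  case (Suc k)
  have "Ck_on k S (\<lambda>x. frechet_derivative f (at x) v) \<longleftrightarrow> Ck_on k S (\<lambda>x. frechet_derivative g (at x) v)"
    for v
    by (rule Suc.IH) (simp add: frechet_derivative_cong_open(1)[OF assms(1) _ Suc.prems])
  then show ?case
    using frechet_derivative_cong_open(2)[OF assms(1) _ Suc.prems] by simp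
qed

lemma Ck_on_SucI:
  assumes "open S" "\<And>x. x \<in> S \<Longrightarrow> (f has_derivative f' x) (at x)" "\<And>v. Ck_on k S (\<lambda>x. f' x v)"
  shows "Ck_on (Suc k) S f"
proof -
  have "Ck_on k S (\<lambda>x. frechet_derivative f (at x) v)" for v
    by (subst Ck_on_cong[OF assms(1), of _ "\<lambda>x. f' x v"])
       (use assms frechet_derivative_at in \<open>fastforce+\<close>)
  then show ?thesis using assms(2) by (auto simp: differentiable_def)
qed

lemma Ck_on_has_derivative:
  "Ck_on (Suc k) S f \<Longrightarrow> x \<in> S \<Longrightarrow> (f has_derivative frechet_derivative f (at x)) (at x)"
  using frechet_derivative_works by auto

lemma Ck_on_SucD:
  assumes "open S" shows "Ck_on (Suc k) S f \<Longrightarrow> Ck_on k S f"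
proof (induction k arbitrary: f)
  case 0
  then show ?case
    by (auto intro!: continuous_at_imp_continuous_on differentiable_imp_continuous_within)
qed auto

lemma Ck_on_const: "open S \<Longrightarrow> Ck_on k S (\<lambda>x. c)"
proof (induction k arbitrary: c)
  case (Suc k)
  then show ?case by (intro Ck_on_SucI[where f' = "\<lambda>_ _. 0"]) auto
qed auto

lemma Ck_on_bounded_linear:
  assumes "bounded_linear L" and "open S"
  shows "Ck_on k S f \<Longrightarrow> Ck_on k S (\<lambda>x. L (f x))"
proof (induction k arbitrary: f)
  case 0
  then show ?case using bounded_linear.continuous_on[OF assms(1)] by simp
next
  case (Suc k)
  have "Ck_on k S (\<lambda>x. L (frechet_derivative f (at x) v))" for v
    using Suc by (intro Suc.IH) simp
  then show ?case
    by (intro Ck_on_SucI[OF assms(2), where f' = "\<lambda>x v. L (frechet_derivative f (at x) v)"])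
       (auto intro: bounded_linear.has_derivative[OF assms(1)] Ck_on_has_derivative[OF Suc.prems]
         \<open>\<And>v. Ck_on k S (\<lambda>x. L (frechet_derivative f (at x) v))\<close>)
qed

lemma Ck_on_linear_id:
  assumes "bounded_linear L" "open S" shows "Ck_on k S L"
proof (cases k)
  case 0
  then show ?thesis using linear_continuous_on[OF assms(1)] by simp
next
  case (Suc m)
  have "Ck_on (Suc m) S L"
    by (intro Ck_on_SucI[OF assms(2), where f' = "\<lambda>_. L"] bounded_linear_imp_has_derivative
        assms Ck_on_const)
  then show ?thesis using Suc by simp
qed

lemma Ck_on_add:
  assumes "open S"
  shows "Ck_on k S f \<Longrightarrow> Ck_on k S g \<Longrightarrow> Ck_on k S (\<lambda>x. f x + g x)"
proof (induction k arbitrary: f g)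
  case 0
  then show ?case by (simp add: continuous_intros)
next
  case (Suc k)
  show ?case
    by (intro Ck_on_SucI[OF assms, where
          f' = "\<lambda>x v. frechet_derivative f (at x) v + frechet_derivative g (at x) v"]
        has_derivative_add Ck_on_has_derivative[OF Suc.prems(1)]
        Ck_on_has_derivative[OF Suc.prems(2)] Suc.IH) (use Suc.prems in auto)
qed

lemma Ck_on_sum:
  assumes "open S" "\<And>i. i \<in> I \<Longrightarrow> Ck_on k S (f i)"
  shows "Ck_on k S (\<lambda>x. \<Sum>i\<in>I. f i x)"
  using assms(2)
proof (induction I rule: infinite_finite_induct)
  case (insert x F)
  then show ?case by (simp add: Ck_on_add[OF assms(1)])
qed (simp_all add: Ck_on_const[OF assms(1)])

lemma Ck_on_bilinear:
  assumes "bounded_bilinear B" and "open S"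
  shows "Ck_on k S f \<Longrightarrow> Ck_on k S g \<Longrightarrow> Ck_on k S (\<lambda>x. B (f x) (g x))"
proof (induction k arbitrary: f g)
  case 0
  then show ?case using bounded_bilinear.continuous_on[OF assms(1)] by simp
next
  case (Suc k)
  have "Ck_on k S f" "Ck_on k S g"
    using Ck_on_SucD[OF assms(2)] Suc.prems by blast+
  then show ?case
    by (intro Ck_on_SucI[OF assms(2), where
          f' = "\<lambda>x v. B (f x) (frechet_derivative g (at x) v) + B (frechet_derivative f (at x) v) (g x)"]
        bounded_bilinear.FDERIV[OF assms(1)] Ck_on_has_derivative[OF Suc.prems(1)] Ck_on_add[OF assms(2)]
        Ck_on_has_derivative[OF Suc.prems(2)] Suc.IH) (use Suc.prems in auto)
qed

lemma Ck_on_compose: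
  fixes f :: "'e::euclidean_space \<Rightarrow> 'h::euclidean_space" and g :: "'h \<Rightarrow> 'f::real_normed_vector"
  assumes "open S" "f ` S \<subseteq> T" "open T"
  shows "Ck_on k T g \<Longrightarrow> Ck_on k S f \<Longrightarrow> Ck_on k S (\<lambda>x. g (f x))"
proof (induction k arbitrary: g)
  case 0
  then show ?case using assms(2) continuous_on_compose2[of T g S f] by simp
next
  case (Suc k)
  note fd = Ck_on_has_derivative[OF Suc.prems(2)] and gd = Ck_on_has_derivative[OF Suc.prems(1)]
  have f: "Ck_on k S f" using Ck_on_SucD[OF assms(1) Suc.prems(2)] .
  have "Ck_on k S (\<lambda>x. frechet_derivative g (at (f x)) (frechet_derivative f (at x) v))" for v
  proof -
    have eq: "frechet_derivative g (at (f x)) (frechet_derivative f (at x) v) =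
      (\<Sum>b\<in>Basis. (frechet_derivative f (at x) v \<bullet> b) *\<^sub>R frechet_derivative g (at (f x)) b)"
      if "x \<in> S" for x
    proof -
      interpret l: linear "frechet_derivative g (at (f x))"
        using gd[of "f x"] that assms(2) has_derivative_linear by blast
      show ?thesis
        by (subst euclidean_representation[symmetric, of "frechet_derivative f (at x) v"])
           (simp only: l.sum l.scale)
    qed
    have "Ck_on k S (\<lambda>x. \<Sum>b\<in>Basis. (frechet_derivative f (at x) v \<bullet> b) *\<^sub>R frechet_derivative g (at (f x)) b)"
      by (intro Ck_on_sum[OF assms(1)] Ck_on_bilinear[OF bounded_bilinear_scaleR assms(1)]
           Ck_on_bounded_linear[OF bounded_linear_inner_left assms(1)] Suc.IH f)
         (use Suc.prems in auto)
    then show ?thesis by (subst Ck_on_cong[OF assms(1) eq])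
  qed
  then show ?case
    by (intro Ck_on_SucI[OF assms(1), where
          f' = "\<lambda>x v. frechet_derivative g (at (f x)) (frechet_derivative f (at x) v)"])
       (use has_derivative_compose[OF fd gd] assms(2) in auto)
qed

named_theorems smooth_intros

lemma smooth_on_cong:
  assumes "open S" "\<And>y. y \<in> S \<Longrightarrow> f y = g y"
  shows "smooth_on S f \<longleftrightarrow> smooth_on S g"
  using Ck_on_cong[OF assms] by (simp add: smooth_on_def)

lemma smooth_on_has_derivative:
  "smooth_on S f \<Longrightarrow> x \<in> S \<Longrightarrow> (f has_derivative frechet_derivative f (at x)) (at x)"
  unfolding smooth_on_def using Ck_on_has_derivative by blast

lemma smooth_on_linear_derivative:
  "smooth_on S f \<Longrightarrow> x \<in> S \<Longrightarrow> linear (frechet_derivative f (at x))"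
  using smooth_on_has_derivative has_derivative_linear by blast

lemma smooth_on_imp_continuous_on: "smooth_on S f \<Longrightarrow> continuous_on S f"
  unfolding smooth_on_def using Ck_on.simps(1) by blast

lemma smooth_on_subset:
  assumes "smooth_on S f" "T \<subseteq> S" shows "smooth_on T f"
proof -
  have "Ck_on k S f \<Longrightarrow> Ck_on k T f" for k
  proof (induction k arbitrary: f)
    case 0
    then show ?case using assms(2) continuous_on_subset by auto
  qed (use assms(2) in auto)
  then show ?thesis using assms(1) by (simp add: smooth_on_def)
qed

lemma smooth_on_frechet_derivative [smooth_intros]:
  "smooth_on S f \<Longrightarrow> smooth_on S (\<lambda>x. frechet_derivative f (at x) v)"
  unfolding smooth_on_def by (metis Ck_on.simps(2))

lemma smooth_on_const [smooth_intros]: "open S \<Longrightarrow> smooth_on S (\<lambda>x. c)"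
  by (simp add: smooth_on_def Ck_on_const)

lemma smooth_on_linear: "bounded_linear L \<Longrightarrow> open S \<Longrightarrow> smooth_on S L"
  by (simp add: smooth_on_def Ck_on_linear_id)

lemma smooth_on_bounded_linear:
  "bounded_linear L \<Longrightarrow> open S \<Longrightarrow> smooth_on S f \<Longrightarrow> smooth_on S (\<lambda>x. L (f x))"
  by (simp add: smooth_on_def Ck_on_bounded_linear)

lemma smooth_on_add [smooth_intros]:
  "open S \<Longrightarrow> smooth_on S f \<Longrightarrow> smooth_on S g \<Longrightarrow> smooth_on S (\<lambda>x. f x + g x)"
  by (simp add: smooth_on_def Ck_on_add)

lemma smooth_on_sum [smooth_intros]:
  "open S \<Longrightarrow> (\<And>i. i \<in> I \<Longrightarrow> smooth_on S (f i)) \<Longrightarrow> smooth_on S (\<lambda>x. \<Sum>i\<in>I. f i x)"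
  by (simp add: smooth_on_def Ck_on_sum)

lemma smooth_on_mult [smooth_intros]:
  fixes f g :: "'e::euclidean_space \<Rightarrow> real"
  shows "open S \<Longrightarrow> smooth_on S f \<Longrightarrow> smooth_on S g \<Longrightarrow> smooth_on S (\<lambda>x. f x * g x)"
  by (simp add: smooth_on_def Ck_on_bilinear[OF bounded_bilinear_mult])

lemma smooth_on_scaleR [smooth_intros]:
  fixes f :: "'e::euclidean_space \<Rightarrow> real"
  shows "open S \<Longrightarrow> smooth_on S f \<Longrightarrow> smooth_on S g \<Longrightarrow> smooth_on S (\<lambda>x. f x *\<^sub>R g x)"
  by (simp add: smooth_on_def Ck_on_bilinear[OF bounded_bilinear_scaleR])

lemma smooth_on_inner [smooth_intros]:
  "open S \<Longrightarrow> smooth_on S f \<Longrightarrow> smooth_on S g \<Longrightarrow> smooth_on S (\<lambda>x. f x \<bullet> g x)"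
  by (simp add: smooth_on_def Ck_on_bilinear[OF bounded_bilinear_inner])

lemma smooth_on_minus [smooth_intros]:
  "open S \<Longrightarrow> smooth_on S f \<Longrightarrow> smooth_on S (\<lambda>x. - f x)"
  by (rule smooth_on_bounded_linear[OF bounded_linear_minus[OF bounded_linear_ident]])

lemma smooth_on_diff [smooth_intros]:
  assumes "open S" "smooth_on S f" "smooth_on S g" shows "smooth_on S (\<lambda>x. f x - g x)"
  using smooth_on_add[OF assms(1,2) smooth_on_minus[OF assms(1,3)]] by simp

lemma smooth_on_prod [smooth_intros]:
  fixes f :: "'i \<Rightarrow> 'e::euclidean_space \<Rightarrow> real"
  assumes "open S" "\<And>i. i \<in> I \<Longrightarrow> smooth_on S (f i)"
  shows "smooth_on S (\<lambda>x. \<Prod>i\<in>I. f i x)"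
  using assms(2)
proof (induction I rule: infinite_finite_induct)
  case (insert x F)
  then show ?case by (simp add: smooth_on_mult[OF assms(1)])
qed (simp_all add: smooth_on_const[OF assms(1)])

lemma smooth_on_power [smooth_intros]:
  fixes f :: "'e::euclidean_space \<Rightarrow> real"
  assumes "open S" "smooth_on S f" shows "smooth_on S (\<lambda>x. f x ^ n)"
  by (induction n) (simp_all add: smooth_on_const smooth_on_mult assms)

lemma smooth_on_fst: "open S \<Longrightarrow> smooth_on S fst" and smooth_on_snd: "open S \<Longrightarrow> smooth_on S snd"
  by (intro smooth_on_linear bounded_linear_fst bounded_linear_snd; assumption)+

lemma smooth_on_fst' [smooth_intros]: "open S \<Longrightarrow> smooth_on S f \<Longrightarrow> smooth_on S (\<lambda>x. fst (f x))"
  by (rule smooth_on_bounded_linear[OF bounded_linear_fst])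

lemma smooth_on_snd' [smooth_intros]: "open S \<Longrightarrow> smooth_on S f \<Longrightarrow> smooth_on S (\<lambda>x. snd (f x))"
  by (rule smooth_on_bounded_linear[OF bounded_linear_snd])

lemma smooth_on_ident [smooth_intros]: "open S \<Longrightarrow> smooth_on S (\<lambda>x. x)"
  by (rule smooth_on_linear[OF bounded_linear_ident])

lemma smooth_on_Pair [smooth_intros]:
  assumes "open S" "smooth_on S f" "smooth_on S g" shows "smooth_on S (\<lambda>x. (f x, g x))"
proof -
  have "smooth_on S (\<lambda>x. (f x, 0) + (0, g x))"
    by (intro smooth_on_add assms smooth_on_bounded_linear[where L = "\<lambda>y. (y, 0)"]
        smooth_on_bounded_linear[where L = "\<lambda>y. (0, y)"] bounded_linear_Pair
        bounded_linear_ident bounded_linear_zero)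
  then show ?thesis by simp
qed

lemma smooth_on_compose:
  fixes f :: "'e::euclidean_space \<Rightarrow> 'h::euclidean_space"
  assumes "open S" "open T" "smooth_on T g" "smooth_on S f" "\<And>x. x \<in> S \<Longrightarrow> f x \<in> T"
  shows "smooth_on S (\<lambda>x. g (f x))"
  using assms Ck_on_compose[OF assms(1) _ assms(2), of f _ g] by (auto simp: smooth_on_def image_subset_iff)

lemma linear_Basis_expansion:
  assumes "linear D" shows "D v = (\<Sum>b\<in>Basis. (v \<bullet> b) *\<^sub>R D (b::'e::euclidean_space))"
proof -
  interpret l: linear D by fact
  show ?thesis by (subst euclidean_representation[symmetric, of v]) (simp only: l.sum l.scale)
qed

lemma smooth_on_real_inverse: "smooth_on (- {0::real}) inverse"
proof -
  have "Ck_on k (- {0::real}) inverse" for k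
  proof (induction k)
    case 0
    then show ?case by (auto intro!: continuous_intros)
  next
    case (Suc k)
    show ?case
      by (intro Ck_on_SucI[where f' = "\<lambda>x v. (- v) * (inverse x * inverse x)"]
          Ck_on_bilinear[OF bounded_bilinear_mult] Suc Ck_on_const)
         (auto intro!: derivative_eq_intros)
  qed
  then show ?thesis by (simp add: smooth_on_def)
qed

lemma smooth_on_real_powr: "smooth_on {0<..} (\<lambda>x::real. x powr s)"
proof -
  have "Ck_on k {0<..} (\<lambda>x::real. x powr s)" for k
  proof (induction k arbitrary: s)
    case 0
    then show ?case by (auto intro!: continuous_intros)
  next
    case (Suc k)
    show ?case
      by (intro Ck_on_SucI[where f' = "\<lambda>x v. (v * s) * x powr (s - 1)"]
          Ck_on_bilinear[OF bounded_bilinear_mult] Suc Ck_on_const)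
         (auto intro!: derivative_eq_intros ext simp: powr_diff field_simps)
  qed
  then show ?thesis by (simp add: smooth_on_def)
qed

lemma smooth_on_inverse [smooth_intros]:
  fixes f :: "'e::euclidean_space \<Rightarrow> real"
  assumes "open S" "smooth_on S f" "\<And>x. x \<in> S \<Longrightarrow> f x \<noteq> 0" shows "smooth_on S (\<lambda>x. inverse (f x))"
  by (rule smooth_on_compose[OF assms(1) _ smooth_on_real_inverse assms(2)]) (use assms(3) in auto)

lemma smooth_on_divide [smooth_intros]:
  fixes f :: "'e::euclidean_space \<Rightarrow> real"
  assumes "open S" "smooth_on S f" "smooth_on S g" "\<And>x. x \<in> S \<Longrightarrow> g x \<noteq> 0"
  shows "smooth_on S (\<lambda>x. f x / g x)"
  unfolding divide_inverse by (intro smooth_intros assms)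

lemma smooth_on_powr [smooth_intros]:
  fixes f :: "'e::euclidean_space \<Rightarrow> real"
  assumes "open S" "smooth_on S f" "\<And>x. x \<in> S \<Longrightarrow> 0 < f x" shows "smooth_on S (\<lambda>x. f x powr s)"
  by (rule smooth_on_compose[OF assms(1) _ smooth_on_real_powr assms(2)]) (use assms(3) in auto)

lemma smooth_on_sqrt [smooth_intros]:
  fixes f :: "'e::euclidean_space \<Rightarrow> real"
  assumes "open S" "smooth_on S f" "\<And>x. x \<in> S \<Longrightarrow> 0 < f x" shows "smooth_on S (\<lambda>x. sqrt (f x))"
proof -
  have "smooth_on S (\<lambda>x. f x powr (1 / 2))" by (intro smooth_intros assms)
  then show ?thesis
    using smooth_on_cong[OF assms(1), of "\<lambda>x. sqrt (f x)" "\<lambda>x. f x powr (1 / 2)"]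
      assms(3) powr_half_sqrt by force
qed

lemma smooth_on_ln [smooth_intros]:
  fixes f :: "'e::euclidean_space \<Rightarrow> real"
  assumes "open S" "smooth_on S f" "\<And>x. x \<in> S \<Longrightarrow> 0 < f x" shows "smooth_on S (\<lambda>x. ln (f x))"
proof -
  have "Ck_on k {0<..} (ln :: real \<Rightarrow> real)" for k
  proof (cases k)
    case 0
    then show ?thesis by (auto intro!: continuous_intros)
  next
    case (Suc m)
    have "Ck_on m (- {0}) (inverse :: real \<Rightarrow> real)"
      using smooth_on_real_inverse by (simp add: smooth_on_def)
    then have "smooth_on {0<..} (inverse :: real \<Rightarrow> real)"
      using smooth_on_subset[OF smooth_on_real_inverse] by auto
    then have "Ck_on (Suc m) {0<..} (ln :: real \<Rightarrow> real)"
      by (intro Ck_on_SucI[where f' = "\<lambda>x v. v * inverse x"]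
          Ck_on_bilinear[OF bounded_bilinear_mult] Ck_on_const)
         (auto intro!: derivative_eq_intros ext simp: smooth_on_def divide_inverse)
    then show ?thesis using Suc by simp
  qed
  then show ?thesis
    by (intro smooth_on_compose[OF assms(1) _ _ assms(2), of "{0<..}" ln])
       (use assms(3) in \<open>auto simp: smooth_on_def\<close>)
qed

text \<open>Second derivatives are symmetric: both are values of the second difference quotient at
  nearby points.\<close>

lemma symmetric_second_derivative_real:
  fixes f :: "'e::euclidean_space \<Rightarrow> real"
  assumes S: "open S" "x \<in> S" and f: "smooth_on S f"
  shows "frechet_derivative (\<lambda>y. frechet_derivative f (at y) v) (at x) w
       = frechet_derivative (\<lambda>y. frechet_derivative f (at y) w) (at x) v"
proof -
  define a where "a v w y = frechet_derivative (\<lambda>y. frechet_derivative f (at y) v) (at y) w" for v w y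
  have line: "((\<lambda>t. F (y + t *\<^sub>R u)) has_real_derivative frechet_derivative F (at (y + t *\<^sub>R u)) u) (at t)"
    if F: "smooth_on S F" and "y + t *\<^sub>R u \<in> S" for F :: "'e \<Rightarrow> real" and y u t
  proof -
    have "(F has_derivative frechet_derivative F (at (y + t *\<^sub>R u))) (at (y + t *\<^sub>R u))"
      using smooth_on_has_derivative that by blast
    moreover have "((\<lambda>t. y + t *\<^sub>R u) has_derivative (\<lambda>h. h *\<^sub>R u)) (at t)"
      by (auto intro!: derivative_eq_intros)
    ultimately have h: "((\<lambda>t. F (y + t *\<^sub>R u)) has_derivative
        (\<lambda>h. frechet_derivative F (at (y + t *\<^sub>R u)) (h *\<^sub>R u))) (at t)"
      using has_derivative_compose by blast
    have "linear (frechet_derivative F (at (y + t *\<^sub>R u)))"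
      by (rule smooth_on_linear_derivative[OF that])
    then have "(\<lambda>h. frechet_derivative F (at (y + t *\<^sub>R u)) (h *\<^sub>R u))
        = (*) (frechet_derivative F (at (y + t *\<^sub>R u)) u)"
      by (auto simp: linear_scale mult.commute)
    with h show ?thesis by (simp add: has_field_derivative_def)
  qed
  have sq: "\<exists>y\<in>ball x r. f (x + h *\<^sub>R v + h *\<^sub>R w) - f (x + h *\<^sub>R v) - f (x + h *\<^sub>R w) + f x = h * (h * a v w y)"
    if r: "ball x r \<subseteq> S" and h: "0 < h" "h * (norm v + norm w) < r" for v w r h
  proof -
    have inb: "x + s *\<^sub>R v + t *\<^sub>R w \<in> ball x r" if "0 \<le> s" "s \<le> h" "0 \<le> t" "t \<le> h" for s t
    proof -
      have "norm (s *\<^sub>R v + t *\<^sub>R w) \<le> s * norm v + t * norm w"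
        using norm_triangle_ineq[of "s *\<^sub>R v" "t *\<^sub>R w"] that by simp
      also have "\<dots> \<le> h * norm v + h * norm w"
        using that by (intro add_mono mult_right_mono) auto
      also have "\<dots> < r" using h(2) by (simp add: distrib_left)
      finally have "norm (s *\<^sub>R v + t *\<^sub>R w) < r" .
      moreover have "dist x (x + s *\<^sub>R v + t *\<^sub>R w) = norm (s *\<^sub>R v + t *\<^sub>R w)"
        using dist_add_cancel[of x 0 "s *\<^sub>R v + t *\<^sub>R w"] by (simp add: add.assoc)
      ultimately show ?thesis by simp
    qed
    define \<phi> where "\<phi> s = f (x + h *\<^sub>R w + s *\<^sub>R v) - f (x + s *\<^sub>R v)" for s
    have "\<exists>z>0. z < h \<and> \<phi> h - \<phi> 0 = (h - 0) * (frechet_derivative f (at (x + h *\<^sub>R w + z *\<^sub>R v)) v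
        - frechet_derivative f (at (x + z *\<^sub>R v)) v)"
    proof (rule MVT2[OF h(1)])
      fix s assume s: "0 \<le> s" "s \<le> h"
      have "x + h *\<^sub>R w + s *\<^sub>R v \<in> S" "x + s *\<^sub>R v \<in> S"
        using inb[OF s, of h] inb[OF s, of 0] r h(1) by (auto simp: algebra_simps)
      then show "(\<phi> has_real_derivative frechet_derivative f (at (x + h *\<^sub>R w + s *\<^sub>R v)) v
        - frechet_derivative f (at (x + s *\<^sub>R v)) v) (at s)"
        unfolding \<phi>_def[abs_def] by (intro DERIV_diff line f)
    qed
    then obtain z where z: "0 < z" "z < h" and ph: "\<phi> h - \<phi> 0 = h * (frechet_derivative f (at (x + h *\<^sub>R w + z *\<^sub>R v)) v
        - frechet_derivative f (at (x + z *\<^sub>R v)) v)" by auto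
    define \<psi> where "\<psi> t = frechet_derivative f (at (x + z *\<^sub>R v + t *\<^sub>R w)) v" for t
    have "\<exists>t>0. t < h \<and> \<psi> h - \<psi> 0 = (h - 0) * a v w (x + z *\<^sub>R v + t *\<^sub>R w)"
    proof (rule MVT2[OF h(1)])
      fix t assume t: "0 \<le> t" "t \<le> h"
      have "x + z *\<^sub>R v + t *\<^sub>R w \<in> S" using inb[of z t] r z t by auto
      then show "(\<psi> has_real_derivative a v w (x + z *\<^sub>R v + t *\<^sub>R w)) (at t)"
        unfolding \<psi>_def[abs_def] a_def by (intro line smooth_intros f)
    qed
    then obtain t where t: "0 < t" "t < h" "\<psi> h - \<psi> 0 = h * a v w (x + z *\<^sub>R v + t *\<^sub>R w)" by auto
    have "\<phi> h - \<phi> 0 = h * (h * a v w (x + z *\<^sub>R v + t *\<^sub>R w))"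
      using ph t(3) by (simp add: \<psi>_def algebra_simps)
    then show ?thesis using inb[of z t] z t
      by (intro bexI[of _ "x + z *\<^sub>R v + t *\<^sub>R w"]) (auto simp: \<phi>_def algebra_simps)
  qed
  have cont: "continuous_on S (a v w)" for v w
    unfolding a_def[abs_def] by (intro smooth_on_imp_continuous_on smooth_intros f)
  have close: "\<exists>r>0. ball x r \<subseteq> S \<and> (\<forall>y\<in>ball x r. \<bar>a v w y - a v w x\<bar> < e)" if "0 < e" for v w e
  proof -
    have "isCont (a v w) x" using cont S continuous_on_eq_continuous_at by blast
    then obtain d where d: "d > 0" "\<forall>y. dist y x < d \<longrightarrow> dist (a v w y) (a v w x) < e"
      using \<open>0 < e\<close> unfolding continuous_at_eps_delta by blast
    obtain r where r: "r > 0" "ball x r \<subseteq> S" using S open_contains_ball by blast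
    show ?thesis
      by (rule exI[of _ "min d r"]) (use d r in \<open>auto simp: dist_real_def dist_commute\<close>)
  qed
  have "\<bar>a v w x - a w v x\<bar> < e" if e: "0 < e" for e
  proof -
    obtain r1 where r1: "r1 > 0" "ball x r1 \<subseteq> S" "\<forall>y\<in>ball x r1. \<bar>a v w y - a v w x\<bar> < e / 2"
      using close[OF half_gt_zero[OF e], of v w] by blast
    obtain r2 where r2: "r2 > 0" "ball x r2 \<subseteq> S" "\<forall>y\<in>ball x r2. \<bar>a w v y - a w v x\<bar> < e / 2"
      using close[OF half_gt_zero[OF e], of w v] by blast
    (* so small that the parallelogram spanned by h v and h w stays in both balls *)
    define h where "h = min r1 r2 / (2 * (norm v + norm w + 1))"
    have np: "0 < norm v + norm w + 1" by (simp add: add_nonneg_pos)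
    have h: "0 < h" using r1 r2 np by (simp add: h_def)
    have "h * (norm v + norm w) < h * (2 * (norm v + norm w + 1))"
      using h np by (intro mult_strict_left_mono) (auto simp: add_nonneg_pos add_strict_increasing)
    also have "\<dots> = min r1 r2" using np by (simp add: h_def)
    finally have hb: "h * (norm v + norm w) < r1" "h * (norm w + norm v) < r2" by (auto simp: add.commute)
    obtain y1 where y1: "y1 \<in> ball x r1" "f (x + h *\<^sub>R v + h *\<^sub>R w) - f (x + h *\<^sub>R v) - f (x + h *\<^sub>R w) + f x
        = h * (h * a v w y1)" using sq[OF r1(2) h hb(1)] by blast
    obtain y2 where y2: "y2 \<in> ball x r2" "f (x + h *\<^sub>R w + h *\<^sub>R v) - f (x + h *\<^sub>R w) - f (x + h *\<^sub>R v) + f x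
        = h * (h * a w v y2)" using sq[OF r2(2) h hb(2)] by blast
    have "h * (h * a v w y1) = h * (h * a w v y2)" using y1(2) y2(2) by (simp add: algebra_simps)
    then have "a v w y1 = a w v y2" using h by simp
    moreover have "\<bar>a v w y1 - a v w x\<bar> < e / 2" "\<bar>a w v y2 - a w v x\<bar> < e / 2"
      using r1(3) r2(3) y1(1) y2(1) by auto
    ultimately show ?thesis by linarith
  qed
  then have "a v w x = a w v x" by (meson less_irrefl not_less zero_less_abs_iff eq_iff_diff_eq_0)
  then show ?thesis by (simp add: a_def)
qed

lemma symmetric_second_derivative:
  fixes f :: "'e::euclidean_space \<Rightarrow> 'h::euclidean_space"
  assumes S: "open S" "x \<in> S" and f: "smooth_on S f"
  shows "frechet_derivative (\<lambda>y. frechet_derivative f (at y) v) (at x) w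
       = frechet_derivative (\<lambda>y. frechet_derivative f (at y) w) (at x) v"
proof (rule euclidean_eqI)
  fix b :: 'h assume "b \<in> Basis"
  have comp: "frechet_derivative (\<lambda>y. F y \<bullet> b) (at y) u = frechet_derivative F (at y) u \<bullet> b"
    if "smooth_on S F" "y \<in> S" for F :: "'e \<Rightarrow> 'h" and y u
    using frechet_derivative_at[OF has_derivative_inner_left[OF smooth_on_has_derivative[OF that]]]
    by metis
  have twice: "frechet_derivative (\<lambda>y. frechet_derivative f (at y) v) (at x) w \<bullet> b
     = frechet_derivative (\<lambda>y. frechet_derivative (\<lambda>z. f z \<bullet> b) (at y) v) (at x) w" for v w
  proof -
    have "frechet_derivative (\<lambda>y. frechet_derivative (\<lambda>z. f z \<bullet> b) (at y) v) (at x)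
       = frechet_derivative (\<lambda>y. frechet_derivative f (at y) v \<bullet> b) (at x)"
      by (rule frechet_derivative_cong_open(1)[OF S]) (simp add: comp f)
    then show ?thesis using comp[OF smooth_on_frechet_derivative[OF f] S(2)] by simp
  qed
  have "smooth_on S (\<lambda>z. f z \<bullet> b)" by (intro smooth_intros S f)
  from symmetric_second_derivative_real[OF S this]
  show "frechet_derivative (\<lambda>y. frechet_derivative f (at y) v) (at x) w \<bullet> b
      = frechet_derivative (\<lambda>y. frechet_derivative f (at y) w) (at x) v \<bullet> b"
    by (simp add: twice)
qed

section \<open>Nondegenerate symmetric bilinear forms\<close>

definition metric_form :: "'e::euclidean_space form2 \<Rightarrow> bool" where
  "metric_form B \<longleftrightarrow> bilinear B \<and> (\<forall>v w. B v w = B w v) \<and> (\<forall>v. (\<forall>w. B v w = 0) \<longrightarrow> v = 0)"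

lemma metric_formD:
  assumes "metric_form B"
  shows "linear (B v)" "linear (\<lambda>v. B v w)" "B v w = B w v" "(\<And>w. B v w = 0) \<Longrightarrow> v = 0"
  using assms by (auto simp: metric_form_def bilinear_def)

lemma sharp_eqI:
  assumes B: "metric_form B" and v: "\<And>w. B v w = \<xi> w"
  shows "sharp B \<xi> = v"
  unfolding sharp_def
proof (rule the_equality)
  fix u assume u: "\<forall>w. B u w = \<xi> w"
  interpret l: linear "\<lambda>v. B v w" for w by (rule metric_formD[OF B])
  have "B (u - v) w = 0" for w using u v by (simp add: l.diff)
  then show "u = v" using metric_formD(4)[OF B, of "u - v"] by simp
qed (use v in blast)

lemma sharp_works:
  assumes B: "metric_form B" and xi: "linear \<xi>"
  shows "B (sharp B \<xi>) w = \<xi> w"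
proof -
  define R where "R v = (\<Sum>b\<in>Basis. B v b *\<^sub>R b)" for v
  have Rin: "R v \<bullet> w = B v w" for v w
  proof -
    interpret l: linear "B v" by (rule metric_formD[OF B])
    have "B v w = (\<Sum>b\<in>Basis. (w \<bullet> b) *\<^sub>R B v b)"
      by (subst euclidean_representation[symmetric, of w]) (simp only: l.sum l.scale)
    then show ?thesis by (simp add: R_def inner_sum_left inner_commute[of w] mult.commute)
  qed
  have "linear R"
    unfolding R_def[abs_def]
    by (intro linearI) (simp_all add: linear_add[OF metric_formD(2)[OF B]]
        linear_scale[OF metric_formD(2)[OF B]] scaleR_left_distrib sum.distrib scaleR_sum_right)
  moreover have "inj R"
    using \<open>linear R\<close> metric_formD(4)[OF B] Rin
    by (metis inner_zero_left linear_injective_0)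
  ultimately have "surj R" by (rule linear_inj_imp_surj)
  then obtain v where v: "R v = (\<Sum>b\<in>Basis. \<xi> b *\<^sub>R b)" by (metis surjD)
  have "B v w = \<xi> w" for w
  proof -
    have "\<xi> w = (\<Sum>b\<in>Basis. (w \<bullet> b) *\<^sub>R \<xi> b)" using linear_Basis_expansion[OF xi] .
    then show ?thesis using Rin[of v w] v by (simp add: inner_sum_left inner_commute[of w] mult.commute)
  qed
  then show ?thesis using sharp_eqI[OF B] by metis
qed

lemma sharp_linear:
  assumes B: "metric_form B" and "linear \<xi>" "linear \<eta>"
  shows "sharp B (\<lambda>w. \<xi> w + \<eta> w) = sharp B \<xi> + sharp B \<eta>"
    and "sharp B (\<lambda>w. c * \<xi> w) = c *\<^sub>R sharp B \<xi>"
  using assms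
  by (auto intro!: sharp_eqI[OF B] simp: sharp_works[OF B] linear_add[OF metric_formD(2)[OF B]]
      linear_scale[OF metric_formD(2)[OF B]])

lemma metric_trace_add:
  assumes "metric_form B" "\<And>v. linear (C v)" "\<And>v. linear (D v)"
  shows "metric_trace B (\<lambda>v w. C v w + D v w) = metric_trace B C + metric_trace B D"
  by (simp add: metric_trace_def sharp_linear assms inner_add_left sum.distrib)

lemma metric_trace_scale:
  assumes "metric_form B" "\<And>v. linear (C v)"
  shows "metric_trace B (\<lambda>v w. c * C v w) = c * metric_trace B C"
  by (simp add: metric_trace_def sharp_linear(2)[OF assms assms(2)] sum_distrib_left)

lemma metric_trace_sum:
  assumes "metric_form B" "\<And>i v. i \<in> I \<Longrightarrow> linear (C i v)"
  shows "metric_trace B (\<lambda>v w. \<Sum>i\<in>I. C i v w) = (\<Sum>i\<in>I. metric_trace B (C i))"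
  using assms(2)
proof (induction I rule: infinite_finite_induct)
  case (insert i I)
  then show ?case
    by (simp add: metric_trace_add[OF assms(1), of "C i"] linear_compose_sum)
next
  have "sharp B (\<lambda>w. 0) = 0"
    by (rule sharp_eqI[OF assms(1)]) (simp add: linear_0[OF metric_formD(2)[OF assms(1)]])
  then show "metric_trace B (\<lambda>v w. \<Sum>i\<in>{}. C i v w) = (\<Sum>i\<in>{}. metric_trace B (C i))"
    "\<And>A. infinite A \<Longrightarrow> metric_trace B (\<lambda>v w. \<Sum>i\<in>A. C i v w) = (\<Sum>i\<in>A. metric_trace B (C i))"
    by (simp_all add: metric_trace_def)
qed


subsection \<open>The Gram determinant\<close>

text \<open>Indexed by the vectors of the basis, a bilinear form becomes a square matrix, and its Gram
  determinant becomes the determinant of this matrix.\<close>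

typedef (overloaded) ('e::euclidean_space) basis_index = "Basis :: 'e set"
  morphisms basis_vec basis_idx by (rule nonempty_Basis[THEN ex_in_conv[THEN iffD2]])

instance basis_index :: (euclidean_space) finite
proof
  have "finite (basis_vec ` (UNIV :: 'a basis_index set))"
    by (rule finite_subset[of _ Basis]) (auto intro: basis_vec)
  then show "finite (UNIV :: 'a basis_index set)"
    by (rule finite_imageD) (simp add: inj_def basis_vec_inject)
qed

lemma bij_basis_vec: "bij_betw basis_vec UNIV (Basis :: 'e::euclidean_space set)"
  by (intro bij_betwI[of _ _ _ basis_idx]) (auto simp: basis_vec basis_vec_inverse basis_idx_inverse)

lemma sum_basis_vec: "(\<Sum>i\<in>UNIV. f (basis_vec i)) = (\<Sum>b\<in>(Basis :: 'e::euclidean_space set). f b)"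
  by (rule sum.reindex_bij_betw[OF bij_basis_vec])

definition form_matrix :: "('e::euclidean_space \<Rightarrow> 'e \<Rightarrow> real) \<Rightarrow> real ^ 'e basis_index ^ 'e basis_index" where
  "form_matrix B = (\<chi> i j. B (basis_vec i) (basis_vec j))"

lemma gram_det_eq_det:
  fixes B :: "'e::euclidean_space form2"
  shows "gram_det B = det (form_matrix B)"
proof -
  let ?U = "UNIV :: 'e basis_index set"
  let ?f = "\<lambda>q. map_permutation ?U basis_vec q"
  have inj: "inj_on basis_vec ?U" by (rule bij_betw_imp_inj_on[OF bij_basis_vec])
  have app: "?f q (basis_vec i) = basis_vec (q i)" for q and i :: "'e basis_index"
    using inj by (simp add: map_permutation_def restrict_id_def)
  have "bij_betw ?f {q. q permutes ?U} {p. p permutes (Basis :: 'e set)}"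
  proof (rule bij_betw_byWitness[where f' = "map_permutation Basis basis_idx"])
    have ib: "bij_betw basis_idx (Basis :: 'e set) ?U"
      by (intro bij_betwI[of _ _ _ basis_vec]) (auto simp: basis_vec basis_vec_inverse basis_idx_inverse)
    show "\<forall>q\<in>{q. q permutes ?U}. map_permutation Basis basis_idx (?f q) = q"
      using map_permutation_compose_inv[OF bij_basis_vec _ basis_vec_inverse] by blast
    show "\<forall>p\<in>{p. p permutes Basis}. ?f (map_permutation Basis basis_idx p) = p"
      using map_permutation_compose_inv[OF ib _ basis_idx_inverse] by blast
    show "?f ` {q. q permutes ?U} \<subseteq> {p. p permutes Basis}"
      using map_permutation_permutes[OF bij_basis_vec] by auto
    show "map_permutation Basis basis_idx ` {p. p permutes Basis} \<subseteq> {q. q permutes ?U}"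
      using map_permutation_permutes[OF ib] by auto
  qed
  then have "gram_det B = (\<Sum>q | q permutes ?U. of_int (sign (?f q)) * (\<Prod>b\<in>Basis. B b (?f q b)))"
    unfolding gram_det_def by (rule sum.reindex_bij_betw[symmetric])
  also have "\<dots> = (\<Sum>q | q permutes ?U. of_int (sign q) * (\<Prod>i\<in>?U. B (basis_vec i) (basis_vec (q i))))"
  proof (rule sum.cong[OF refl])
    fix q assume "q \<in> {q. q permutes ?U}"
    then have "sign (?f q) = sign q" by (intro sign_map_permutation inj) auto
    moreover have "(\<Prod>b\<in>Basis. B b (?f q b)) = (\<Prod>i\<in>?U. B (basis_vec i) (?f q (basis_vec i)))"
      by (rule prod.reindex_bij_betw[OF bij_basis_vec, symmetric])
    ultimately show "of_int (sign (?f q)) * (\<Prod>b\<in>Basis. B b (?f q b))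
        = of_int (sign q) * (\<Prod>i\<in>?U. B (basis_vec i) (basis_vec (q i)))"
      by (simp add: app)
  qed
  finally show ?thesis by (simp add: det_def form_matrix_def)
qed

lemma linear_basis_vec_expand:
  assumes "linear L"
  shows "L v = (\<Sum>i\<in>UNIV. (v \<bullet> basis_vec i) *\<^sub>R L (basis_vec (i :: 'e::euclidean_space basis_index)))"
  using linear_Basis_expansion[OF assms, of v] sum_basis_vec[of "\<lambda>b. (v \<bullet> b) *\<^sub>R L b"] by simp

lemma gram_det_nonzero:
  fixes B :: "'e::euclidean_space form2"
  assumes B: "metric_form B" shows "gram_det B \<noteq> 0"
proof -
  have "x = 0" if x: "form_matrix B *v x = 0" for x
  proof -
    define v where "v = (\<Sum>j\<in>UNIV. x $ j *\<^sub>R basis_vec j)"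
    have "B w v = 0" for w
    proof -
      have "B (basis_vec i) v = 0" for i
      proof -
        have "B (basis_vec i) v = (\<Sum>j\<in>UNIV. x $ j * B (basis_vec i) (basis_vec j))"
          using metric_formD(1)[OF B] by (simp add: v_def linear_sum linear_scale)
        also have "\<dots> = (form_matrix B *v x) $ i"
          by (simp add: matrix_vector_mult_def form_matrix_def mult.commute)
        finally show ?thesis using x by simp
      qed
      then show ?thesis using linear_basis_vec_expand[OF metric_formD(2)[OF B], of w v] by simp
    qed
    then have v0: "v = 0" using metric_formD(3,4)[OF B] by metis
    have "x $ k = 0" for k
    proof -
      have "v \<bullet> basis_vec k = (\<Sum>j\<in>UNIV. x $ j * (basis_vec j \<bullet> basis_vec k))"
        by (simp add: v_def inner_sum_left)
      also have "\<dots> = (\<Sum>j\<in>UNIV. if j = k then x $ j else 0)"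
        by (intro sum.cong) (auto simp: inner_Basis basis_vec basis_vec_inject)
      finally show ?thesis using v0 by simp
    qed
    then show ?thesis by (simp add: vec_eq_iff)
  qed
  then have "invertible (form_matrix B)"
    using matrix_left_invertible_ker[of "form_matrix B"] invertible_left_inverse by blast
  then show ?thesis by (simp add: gram_det_eq_det invertible_det_nz)
qed

text \<open>Cramer's rule for the equation that defines \<^const>\<open>sharp\<close>. It shows that \<^const>\<open>sharp\<close>
  depends smoothly on the form, and it evaluates the determinants in Jacobi's formula.\<close>

lemma sharp_cramer:
  fixes B :: "'e::euclidean_space form2"
  assumes B: "metric_form B" and xi: "linear \<xi>"
  shows "det (\<chi> i j. if i = k then \<xi> (basis_vec j) else B (basis_vec i) (basis_vec j))
       = (sharp B \<xi> \<bullet> basis_vec k) * gram_det B"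
proof -
  let ?x = "\<chi> i. sharp B \<xi> \<bullet> basis_vec i"
  have "\<xi> w = (\<Sum>i\<in>UNIV. (sharp B \<xi> \<bullet> basis_vec i) * B (basis_vec i) w)" for w
    using linear_basis_vec_expand[OF metric_formD(2)[OF B], of "sharp B \<xi>" w]
    by (simp add: sharp_works[OF B xi])
  then have "(\<chi> i j. if i = k then \<xi> (basis_vec j) else B (basis_vec i) (basis_vec j))
      = (\<chi> i. if i = k then (\<Sum>i\<in>UNIV. ?x $ i *s row i (form_matrix B)) else row i (form_matrix B))"
    by (simp add: vec_eq_iff form_matrix_def row_def)
  then show ?thesis by (simp add: cramer_lemma_transpose gram_det_eq_det)
qed

lemma gram_det_pullback:
  fixes B :: "'e::euclidean_space form2" and A :: "'e \<Rightarrow> 'e"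
  assumes B: "bilinear B" and A: "linear A"
  shows "gram_det (\<lambda>v w. B (A v) (A w))
    = (det (\<chi> i j. A (basis_vec j) \<bullet> basis_vec i :: real ^ 'e basis_index ^ 'e basis_index))\<^sup>2 * gram_det B"
proof -
  let ?M = "\<chi> i j. A (basis_vec j) \<bullet> basis_vec i :: real ^ 'e basis_index ^ 'e basis_index"
  have lin: "linear (B v)" "linear (\<lambda>v. B v w)" for v w using B by (auto simp: bilinear_def)
  have "form_matrix (\<lambda>v w. B (A v) (A w)) = transpose ?M ** (form_matrix B ** ?M)"
  proof -
    have "B (A v) (A w) = (\<Sum>k\<in>UNIV. (A v \<bullet> basis_vec k) * (\<Sum>l\<in>UNIV. B (basis_vec k) (basis_vec l) * (A w \<bullet> basis_vec l)))"
      for v w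
      using linear_basis_vec_expand[OF lin(2), of "A v" "A w"]
        linear_basis_vec_expand[OF lin(1), of _ "A w"] by (simp add: mult.commute)
    then show ?thesis
      by (simp add: vec_eq_iff form_matrix_def transpose_def matrix_matrix_mult_def)
  qed
  then show ?thesis by (simp add: gram_det_eq_det det_mul power2_eq_square)
qed


subsection \<open>Smooth metrics\<close>

definition metric_on :: "'b::euclidean_space set \<Rightarrow> ('b \<Rightarrow> 'e::euclidean_space form2) \<Rightarrow> bool" where
  "metric_on S G \<longleftrightarrow> (\<forall>x\<in>S. metric_form (G x)) \<and> (\<forall>v w. smooth_on S (\<lambda>x. G x v w))"

lemma metric_onD:
  assumes "metric_on S G"
  shows "x \<in> S \<Longrightarrow> metric_form (G x)" "smooth_on S (\<lambda>x. G x v w)"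
  using assms by (auto simp: metric_on_def)

lemma smooth_on_gram_det [smooth_intros]:
  assumes "open S" "metric_on S G" shows "smooth_on S (\<lambda>x. gram_det (G x))"
  unfolding gram_det_def by (intro smooth_intros assms metric_onD(2)[OF assms(2)])

lemma smooth_on_sharp [smooth_intros]:
  fixes G :: "'b::euclidean_space \<Rightarrow> 'e::euclidean_space form2"
  assumes S: "open S" and G: "metric_on S G"
    and xi: "\<And>x. x \<in> S \<Longrightarrow> linear (\<xi> x)" "\<And>w. smooth_on S (\<lambda>x. \<xi> x w)"
  shows "smooth_on S (\<lambda>x. sharp (G x) (\<xi> x))"
proof -
  have comp: "smooth_on S (\<lambda>x. sharp (G x) (\<xi> x) \<bullet> basis_vec k)" for k :: "'e basis_index"
  proof -
    have "smooth_on S (\<lambda>x. det (\<chi> i j. if i = k then \<xi> x (basis_vec j) else G x (basis_vec i) (basis_vec j)) / gram_det (G x))"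
    proof (intro smooth_intros S G gram_det_nonzero metric_onD[OF G])
      show "smooth_on S (\<lambda>x. det (\<chi> i j. if i = k then \<xi> x (basis_vec j) else G x (basis_vec i) (basis_vec j)))"
        unfolding det_def
      proof (intro smooth_intros S)
        fix p i
        show "smooth_on S (\<lambda>x. (\<chi> i j. if i = k then \<xi> x (basis_vec j) else G x (basis_vec i) (basis_vec j)) $ i $ (p i))"
          using xi(2) metric_onD(2)[OF G] by (cases "i = k") simp_all
      qed
    qed
    then show ?thesis
      by (subst smooth_on_cong[OF S, of _ "\<lambda>x. det (\<chi> i j. if i = k then \<xi> x (basis_vec j) else G x (basis_vec i) (basis_vec j)) / gram_det (G x)"])
         (simp_all add: sharp_cramer[OF metric_onD(1)[OF G] xi(1)] gram_det_nonzero[OF metric_onD(1)[OF G]])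
  qed
  have "smooth_on S (\<lambda>x. \<Sum>k\<in>UNIV. (sharp (G x) (\<xi> x) \<bullet> basis_vec k) *\<^sub>R (basis_vec k :: 'e))"
    by (intro smooth_intros comp S)
  moreover have "(\<Sum>k\<in>UNIV. (v \<bullet> basis_vec k) *\<^sub>R (basis_vec k :: 'e)) = v" for v
    using sum_basis_vec[of "\<lambda>b. (v \<bullet> b) *\<^sub>R b"] euclidean_representation[of v] by simp
  ultimately show ?thesis by simp
qed

lemma linear_derivative_of_linear_family:
  fixes F :: "'b::euclidean_space \<Rightarrow> 'e::euclidean_space \<Rightarrow> 'c::real_normed_vector"
  assumes S: "open S" "x \<in> S" and lin: "\<And>y. y \<in> S \<Longrightarrow> linear (F y)"
    and sm: "\<And>w. smooth_on S (\<lambda>y. F y w)"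
  shows "linear (\<lambda>w. frechet_derivative (\<lambda>y. F y w) (at x) h)"
proof (rule linearI)
  have d: "((\<lambda>y. F y w) has_derivative frechet_derivative (\<lambda>y. F y w) (at x)) (at x)" for w
    using smooth_on_has_derivative[OF sm S(2)] .
  fix v w c
  have "frechet_derivative (\<lambda>y. F y (v + w)) (at x) = frechet_derivative (\<lambda>y. F y v + F y w) (at x)"
    by (rule frechet_derivative_cong_open(1)[OF S]) (simp add: linear_add lin)
  then show "frechet_derivative (\<lambda>y. F y (v + w)) (at x) h =
      frechet_derivative (\<lambda>y. F y v) (at x) h + frechet_derivative (\<lambda>y. F y w) (at x) h"
    using frechet_derivative_at[OF has_derivative_add[OF d d]] by metis
  have "frechet_derivative (\<lambda>y. F y (c *\<^sub>R v)) (at x) = frechet_derivative (\<lambda>y. c *\<^sub>R F y v) (at x)"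
    by (rule frechet_derivative_cong_open(1)[OF S]) (simp add: linear_scale lin)
  then show "frechet_derivative (\<lambda>y. F y (c *\<^sub>R v)) (at x) h = c *\<^sub>R frechet_derivative (\<lambda>y. F y v) (at x) h"
    using frechet_derivative_at[OF has_derivative_scaleR_right[OF d]] by metis
qed

abbreviation metric_deriv ::
  "('b::euclidean_space \<Rightarrow> 'e::euclidean_space form2) \<Rightarrow> 'b \<Rightarrow> 'b \<Rightarrow> 'e form2" where
  "metric_deriv G x h \<equiv> (\<lambda>v w. frechet_derivative (\<lambda>y. G y v w) (at x) h)"

lemma linear_metric_deriv:
  assumes "open S" "x \<in> S" "metric_on S G"
  shows "linear (metric_deriv G x h v)" "linear (\<lambda>v. metric_deriv G x h v w)"
    "linear (\<lambda>h. metric_deriv G x h v w)"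
  by (rule linear_derivative_of_linear_family[OF assms(1,2)];
      simp add: metric_onD[OF assms(3)] metric_formD[OF metric_onD(1)[OF assms(3)]])+
     (rule smooth_on_linear_derivative[OF metric_onD(2)[OF assms(3)] assms(2)])

lemma metric_trace_deriv_expand:
  assumes "open S" "x \<in> S" "metric_on S G"
  shows "metric_trace (G x) (metric_deriv G x h)
    = (\<Sum>b\<in>Basis. (h \<bullet> b) * metric_trace (G x) (metric_deriv G x b))"
proof -
  have "metric_deriv G x h = (\<lambda>v w. \<Sum>b\<in>Basis. (h \<bullet> b) * metric_deriv G x b v w)"
    by (intro ext) (rule linear_Basis_expansion[OF linear_metric_deriv(3)[OF assms],
          unfolded real_scaleR_def])
  then have "metric_trace (G x) (metric_deriv G x h)
      = metric_trace (G x) (\<lambda>v w. \<Sum>b\<in>Basis. (h \<bullet> b) * metric_deriv G x b v w)" by (rule arg_cong)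
  also have "\<dots> = (\<Sum>b\<in>Basis. metric_trace (G x) (\<lambda>v w. (h \<bullet> b) * metric_deriv G x b v w))"
    using linear_compose_scale_right[OF linear_metric_deriv(1)[OF assms]]
    by (intro metric_trace_sum metric_onD(1)[OF assms(3,2)]) simp
  finally show ?thesis
    by (simp only: metric_trace_scale[OF metric_onD(1)[OF assms(3,2)] linear_metric_deriv(1)[OF assms]])
qed

text \<open>Jacobi's formula: replacing a row of the Gram matrix by its derivative multiplies the
  determinant by a component of \<^const>\<open>sharp\<close>, by Cramer's rule.\<close>

lemma gram_det_has_derivative:
  fixes G :: "'b::euclidean_space \<Rightarrow> 'e::euclidean_space form2"
  assumes S: "open S" "x \<in> S" and G: "metric_on S G"
  shows "((\<lambda>y. gram_det (G y)) has_derivative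
      (\<lambda>h. gram_det (G x) * metric_trace (G x) (metric_deriv G x h))) (at x)"
proof -
  let ?U = "UNIV :: 'e basis_index set"
  let ?D = "metric_deriv G x"
  have d: "((\<lambda>y. G y v w) has_derivative (\<lambda>h. ?D h v w)) (at x)" for v w
    using smooth_on_has_derivative[OF metric_onD(2)[OF G] S(2)] .
  have "((\<lambda>y. det (form_matrix (G y))) has_derivative
    (\<lambda>h. \<Sum>p | p permutes ?U. of_int (sign p) * (\<Sum>k\<in>?U. ?D h (basis_vec k) (basis_vec (p k)) *
         (\<Prod>i\<in>?U - {k}. G x (basis_vec i) (basis_vec (p i)))))) (at x)"
    unfolding det_def form_matrix_def
    by (auto intro!: has_derivative_sum has_derivative_mult_right has_derivative_prod d)
  moreover have "(\<Sum>p | p permutes ?U. of_int (sign p) * (\<Sum>k\<in>?U. ?D h (basis_vec k) (basis_vec (p k)) *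
         (\<Prod>i\<in>?U - {k}. G x (basis_vec i) (basis_vec (p i)))))
      = gram_det (G x) * metric_trace (G x) (?D h)" for h
  proof -
    have "(\<Sum>p | p permutes ?U. of_int (sign p) * (\<Sum>k\<in>?U. ?D h (basis_vec k) (basis_vec (p k)) *
         (\<Prod>i\<in>?U - {k}. G x (basis_vec i) (basis_vec (p i)))))
      = (\<Sum>k\<in>?U. det (\<chi> i j. if i = k then ?D h (basis_vec k) (basis_vec j) else G x (basis_vec i) (basis_vec j)))"
      unfolding det_def sum_distrib_left
    proof (subst sum.swap, intro sum.cong refl arg_cong2[where f = "(*)"])
      fix k p
      show "?D h (basis_vec k) (basis_vec (p k)) * (\<Prod>i\<in>?U - {k}. G x (basis_vec i) (basis_vec (p i)))
        = (\<Prod>i\<in>?U. (\<chi> i j. if i = k then ?D h (basis_vec k) (basis_vec j)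
             else G x (basis_vec i) (basis_vec j)) $ i $ p i)"
        by (subst (2) prod.remove[of _ k]) auto
    qed
    also have "\<dots> = (\<Sum>k\<in>?U. (sharp (G x) (?D h (basis_vec k)) \<bullet> basis_vec k) * gram_det (G x))"
      by (simp add: sharp_cramer[OF metric_onD(1)[OF G S(2)] linear_metric_deriv(1)[OF S G]])
    also have "\<dots> = gram_det (G x) * metric_trace (G x) (?D h)"
      using sum_basis_vec[of "\<lambda>b. (sharp (G x) (?D h b) \<bullet> b)"]
      by (simp add: metric_trace_def sum_distrib_right[symmetric])
    finally show ?thesis .
  qed
  ultimately show ?thesis by (simp add: gram_det_eq_det)
qed

lemma vol_density_pos: "metric_form B \<Longrightarrow> 0 < vol_density B"
  using gram_det_nonzero by (simp add: vol_density_def)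

lemma vol_density_has_derivative:
  assumes S: "open S" "x \<in> S" and G: "metric_on S G"
  shows "((\<lambda>y. vol_density (G y)) has_derivative
      (\<lambda>h. vol_density (G x) * metric_trace (G x) (metric_deriv G x h) / 2)) (at x)"
proof -
  let ?g = "gram_det (G x)"
  have nz: "?g \<noteq> 0" using gram_det_nonzero[OF metric_onD(1)[OF G S(2)]] .
  have "((\<lambda>z. sqrt \<bar>z\<bar>) has_real_derivative sqrt \<bar>?g\<bar> / (2 * ?g)) (at ?g)"
  proof (cases "0 < ?g")
    case True
    have "(sqrt has_real_derivative sqrt ?g / (2 * ?g)) (at ?g)"
      using True by (auto intro!: derivative_eq_intros simp: field_simps)
    then have "(sqrt has_real_derivative sqrt \<bar>?g\<bar> / (2 * ?g)) (at ?g)" using True by simp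
    then show ?thesis
      by (rule has_field_derivative_transform_within_open[OF _ open_greaterThan[of 0]]) (use True in auto)
  next
    case False
    then have "?g < 0" using nz by simp
    then have "((\<lambda>z. sqrt (- z)) has_real_derivative sqrt (- ?g) / (2 * ?g)) (at ?g)"
      by (auto intro!: derivative_eq_intros simp: field_simps)
    then have "((\<lambda>z. sqrt (- z)) has_real_derivative sqrt \<bar>?g\<bar> / (2 * ?g)) (at ?g)"
      using \<open>?g < 0\<close> by simp
    then show ?thesis
      by (rule has_field_derivative_transform_within_open[OF _ open_lessThan[of 0]])
         (use \<open>?g < 0\<close> in auto)
  qed
  from DERIV_compose_FDERIV[OF this gram_det_has_derivative[OF S G]]
  show ?thesis using nz by (simp add: vol_density_def mult.commute)
qed

lemma smooth_on_vol_density [smooth_intros]: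
  assumes S: "open S" and G: "metric_on S G"
  shows "smooth_on S (\<lambda>x. vol_density (G x))"
proof -
  have pos: "0 < gram_det (G x) * gram_det (G x)" if "x \<in> S" for x
    using gram_det_nonzero[OF metric_onD(1)[OF G that]] not_real_square_gt_zero by blast
  have "smooth_on S (\<lambda>x. sqrt (sqrt (gram_det (G x) * gram_det (G x))))"
    by (intro smooth_intros S G real_sqrt_gt_zero pos)
  then show ?thesis by (simp add: vol_density_def)
qed

text \<open>The Laplacian as the divergence of the gradient \<open>X\<close>, where the derivative of the volume
  density appears as the trace of the derivative of the metric along \<open>X\<close>.\<close>

lemma coord_laplacian_divergence:
  fixes G :: "'e::euclidean_space \<Rightarrow> 'e form2"
  assumes S: "open S" "x \<in> S" and G: "metric_on S G" and u: "smooth_on S u"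
  defines "X \<equiv> \<lambda>y. sharp (G y) (frechet_derivative u (at y))"
  shows "coord_laplacian G u x =
    (\<Sum>b\<in>Basis. frechet_derivative X (at x) b \<bullet> b) + metric_trace (G x) (metric_deriv G x (X x)) / 2"
proof -
  let ?v = "vol_density (G x)"
  have X: "smooth_on S X" unfolding X_def
    by (intro smooth_intros S G u smooth_on_linear_derivative[OF u])
  have v0: "?v \<noteq> 0" using vol_density_pos[OF metric_onD(1)[OF G S(2)]] by simp
  have "frechet_derivative (\<lambda>y. vol_density (G y) * (X y \<bullet> b)) (at x) b
    = ?v * (frechet_derivative X (at x) b \<bullet> b + (X x \<bullet> b) * metric_trace (G x) (metric_deriv G x b) / 2)" for b
  proof -
    note dX = smooth_on_has_derivative[OF X S(2)]
    have "((\<lambda>y. vol_density (G y) * (X y \<bullet> b)) has_derivative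
       (\<lambda>h. ?v * (frechet_derivative X (at x) h \<bullet> b) + ?v * metric_trace (G x) (metric_deriv G x h) / 2 * (X x \<bullet> b))) (at x)"
      by (intro has_derivative_mult vol_density_has_derivative[OF S G] has_derivative_inner_left dX)
    from frechet_derivative_at[OF this] show ?thesis
      by (simp add: fun_eq_iff algebra_simps)
  qed
  then have "coord_laplacian G u x =
     (\<Sum>b\<in>Basis. frechet_derivative X (at x) b \<bullet> b + (X x \<bullet> b) * metric_trace (G x) (metric_deriv G x b) / 2)"
    using v0 by (simp add: coord_laplacian_def codiff_def X_def sum_distrib_left[symmetric])
  then show ?thesis
    by (simp add: sum.distrib metric_trace_deriv_expand[OF S G, of "X x"] sum_divide_distrib)
qed

section \<open>Invariance of the Laplacian under changes of coordinates\<close>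

lemma linear_family_has_derivative:
  fixes F :: "'b::euclidean_space \<Rightarrow> 'e::euclidean_space \<Rightarrow> 'c::real_normed_vector"
  assumes S: "open S" "x \<in> S" and lin: "\<And>y. y \<in> S \<Longrightarrow> linear (F y)"
    and sm: "\<And>w. smooth_on S (\<lambda>y. F y w)" and V: "(V has_derivative V') (at x)"
  shows "((\<lambda>y. F y (V y)) has_derivative
     (\<lambda>h. frechet_derivative (\<lambda>y. F y (V x)) (at x) h + F x (V' h))) (at x)"
proof -
  let ?D = "\<lambda>h w. frechet_derivative (\<lambda>y. F y w) (at x) h"
  have d: "((\<lambda>y. F y w) has_derivative (\<lambda>h. ?D h w)) (at x)" for w
    using smooth_on_has_derivative[OF sm S(2)] .
  have "((\<lambda>y. \<Sum>b\<in>Basis. (V y \<bullet> b) *\<^sub>R F y b) has_derivative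
     (\<lambda>h. \<Sum>b\<in>Basis. (V x \<bullet> b) *\<^sub>R ?D h b + (V' h \<bullet> b) *\<^sub>R F x b)) (at x)"
    by (intro has_derivative_sum has_derivative_scaleR has_derivative_inner_left V d)
  moreover have "(\<Sum>b\<in>Basis. (V x \<bullet> b) *\<^sub>R ?D h b + (V' h \<bullet> b) *\<^sub>R F x b) = ?D h (V x) + F x (V' h)" for h
    using linear_Basis_expansion[OF linear_derivative_of_linear_family[OF S lin sm], of "V x" h]
      linear_Basis_expansion[OF lin[OF S(2)], of "V' h"] by (simp add: sum.distrib)
  ultimately have "((\<lambda>y. \<Sum>b\<in>Basis. (V y \<bullet> b) *\<^sub>R F y b) has_derivative
     (\<lambda>h. ?D h (V x) + F x (V' h))) (at x)" by simp
  then show ?thesis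
    by (rule has_derivative_transform_within_open[OF _ S])
       (rule linear_Basis_expansion[OF lin, symmetric])
qed

lemma trace_commute:
  fixes P Q :: "'e::euclidean_space \<Rightarrow> 'e"
  assumes "linear P" "linear Q"
  shows "(\<Sum>b\<in>Basis. P (Q b) \<bullet> b) = (\<Sum>b\<in>Basis. Q (P b) \<bullet> b)"
proof -
  have "P (Q b) \<bullet> b = (\<Sum>c\<in>Basis. (Q b \<bullet> c) * (P c \<bullet> b))" for b
    by (subst linear_Basis_expansion[OF assms(1)]) (simp add: inner_sum_left)
  moreover have "Q (P b) \<bullet> b = (\<Sum>c\<in>Basis. (P b \<bullet> c) * (Q c \<bullet> b))" for b
    by (subst linear_Basis_expansion[OF assms(2)]) (simp add: inner_sum_left)
  ultimately show ?thesis by (simp, subst sum.swap) (simp add: mult.commute)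
qed

lemma metric_trace_transpose:
  assumes B: "metric_form B" and C: "bilinear C"
  shows "metric_trace B (\<lambda>v w. C w v) = metric_trace B C"
proof -
  have lin: "linear (C v)" "linear (\<lambda>v. C v w)" for v w using C by (auto simp: bilinear_def)
  define e where "e b = sharp B (\<lambda>w. b \<bullet> w)" for b
  have e: "B v (e b) = v \<bullet> b" for v b
    using sharp_works[OF B bounded_linear.linear[OF bounded_linear_inner_right], of b v]
    by (simp add: e_def metric_formD(3)[OF B, of v] inner_commute)
  have tr: "metric_trace B D = (\<Sum>b\<in>Basis. D b (e b))" if "\<And>v. linear (D v)" for D
    unfolding metric_trace_def by (intro sum.cong refl) (simp add: e[symmetric] sharp_works[OF B that])
  have sym: "e b \<bullet> c = e c \<bullet> b" for b c
    using e[of "e b" c] e[of "e c" b] metric_formD(3)[OF B, of "e b"] by simp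
  have "(\<Sum>b\<in>Basis. C (e b) b) = (\<Sum>b\<in>Basis. \<Sum>c\<in>Basis. (e b \<bullet> c) * C c b)"
    by (intro sum.cong refl, subst linear_Basis_expansion[OF lin(2)]) simp
  also have "\<dots> = (\<Sum>c\<in>Basis. \<Sum>b\<in>Basis. (e c \<bullet> b) * C c b)"
    by (subst sum.swap) (simp add: sym)
  also have "\<dots> = (\<Sum>c\<in>Basis. C c (e c))"
    by (intro sum.cong refl, subst (2) linear_Basis_expansion[OF lin(1)]) simp
  finally show ?thesis using tr[OF lin(1)] tr[of "\<lambda>v w. C w v", OF lin(2)] by simp
qed

lemma metric_form_pullback:
  assumes B: "metric_form B" and A: "linear A" "surj A" "inj A"
  shows "metric_form (\<lambda>v w. B (A v) (A w))"
  unfolding metric_form_def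
proof (intro conjI allI impI)
  show "bilinear (\<lambda>v w. B (A v) (A w))"
    using metric_formD(1,2)[OF B] A(1) unfolding bilinear_def
    by (auto intro: linear_compose[unfolded o_def])
  show "B (A v) (A w) = B (A w) (A v)" for v w by (rule metric_formD(3)[OF B])
  fix v assume "\<forall>w. B (A v) (A w) = 0"
  then have "A v = 0" using metric_formD(4)[OF B] by (metis A(2) surjD)
  then show "v = 0" using A(1,3) linear_injective_0 by blast
qed

lemma sharp_pullback:
  assumes B: "metric_form B" and A: "linear A" "surj A" "inj A" and xi: "linear \<xi>"
  shows "A (sharp (\<lambda>v w. B (A v) (A w)) (\<lambda>w. \<xi> (A w))) = sharp B \<xi>"
proof -
  obtain v where v: "A v = sharp B \<xi>" using A(2) by (metis surjD)
  have "sharp (\<lambda>v w. B (A v) (A w)) (\<lambda>w. \<xi> (A w)) = v"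
    by (rule sharp_eqI[OF metric_form_pullback[OF B A]]) (simp add: v sharp_works[OF B xi])
  then show ?thesis using v by simp
qed

lemma metric_trace_pullback:
  fixes A :: "'e::euclidean_space \<Rightarrow> 'e"
  assumes B: "metric_form B" and A: "linear A" "surj A" "inj A" and C: "bilinear C"
  shows "metric_trace (\<lambda>v w. B (A v) (A w)) (\<lambda>v w. C (A v) (A w)) = metric_trace B C"
proof -
  obtain I where I: "linear I" "I \<circ> A = id" using linear_injective_left_inverse[OF A(1,3)] by blast
  have IA: "I (A v) = v" for v using I(2) by (metis comp_apply id_apply)
  have AI: "A (I v) = v" for v by (metis A(2) IA surjD)
  have lin: "linear (C v)" "linear (\<lambda>v. C v w)" for v w using C by (auto simp: bilinear_def)
  define L where "L v = sharp B (C v)" for v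
  have L: "linear L"
  proof (rule linearI)
    show "L (v + w) = L v + L w" for v w
    proof -
      have "C (v + w) = (\<lambda>z. C v z + C w z)" by (intro ext linear_add[OF lin(2)])
      then show ?thesis by (simp add: L_def sharp_linear(1)[OF B lin(1) lin(1)])
    qed
    show "L (c *\<^sub>R v) = c *\<^sub>R L v" for c v
    proof -
      have "C (c *\<^sub>R v) = (\<lambda>z. c * C v z)"
        by (intro ext) (simp add: linear_scale[OF lin(2)])
      then show ?thesis by (simp add: L_def sharp_linear(2)[OF B lin(1) lin(1)])
    qed
  qed
  have "sharp (\<lambda>v w. B (A v) (A w)) (\<lambda>w. C (A v) (A w)) = I (L (A v))" for v
    using sharp_pullback[OF B A lin(1)[of "A v"]] IA L_def by metis
  then have "metric_trace (\<lambda>v w. B (A v) (A w)) (\<lambda>v w. C (A v) (A w)) = (\<Sum>b\<in>Basis. I (L (A b)) \<bullet> b)"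
    by (simp add: metric_trace_def)
  also have "\<dots> = (\<Sum>b\<in>Basis. L (A (I b)) \<bullet> b)"
    using trace_commute[OF I(1) linear_compose[OF A(1) L]] by (simp add: IA)
  finally show ?thesis by (simp add: AI L_def metric_trace_def)
qed

text \<open>Why the two terms of \<open>coord_laplacian_divergence\<close> transform into each other: for the
  differential \<open>A\<close> of the change of coordinates and the gradient \<open>X\<close>, the divergence changes by
  the trace of \<open>A\<^sup>-\<^sup>1 \<partial>\<^sub>X A\<close>, since second derivatives are symmetric, and the trace of the
  derivative of the metric changes by twice that trace, with the opposite sign.\<close>

lemma coord_laplacian_change_of_coordinates:
  fixes \<Phi> :: "'e::euclidean_space \<Rightarrow> 'e" and G G' :: "'e \<Rightarrow> 'e form2"
  assumes S: "open S" "x \<in> S" and S': "open S'" "\<And>y. y \<in> S \<Longrightarrow> \<Phi> y \<in> S'"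
    and Phi: "smooth_on S \<Phi>" "\<And>y. y \<in> S \<Longrightarrow> inj (frechet_derivative \<Phi> (at y))"
    and G: "metric_on S G" and G': "metric_on S' G'"
    and pull: "\<And>y v w. y \<in> S \<Longrightarrow>
      G y v w = G' (\<Phi> y) (frechet_derivative \<Phi> (at y) v) (frechet_derivative \<Phi> (at y) w)"
    and u: "smooth_on S' u"
  shows "coord_laplacian G (\<lambda>y. u (\<Phi> y)) x = coord_laplacian G' u (\<Phi> x)"
proof -
  define A where "A y = frechet_derivative \<Phi> (at y)" for y
  define X where "X y = sharp (G y) (frechet_derivative (\<lambda>y. u (\<Phi> y)) (at y))" for y
  define X' where "X' z = sharp (G' z) (frechet_derivative u (at z))" for z
  have uP: "smooth_on S (\<lambda>y. u (\<Phi> y))" by (rule smooth_on_compose[OF S(1) S'(1) u Phi(1) S'(2)])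
  have lA: "linear (A y)" if "y \<in> S" for y
    unfolding A_def using smooth_on_linear_derivative[OF Phi(1) that] .
  have iA: "inj (A y)" if "y \<in> S" for y unfolding A_def using Phi(2)[OF that] .
  have sA: "surj (A y)" if "y \<in> S" for y using linear_inj_imp_surj[OF lA iA] that by blast
  have smA: "smooth_on S (\<lambda>y. A y v)" for v unfolding A_def by (intro smooth_intros Phi)
  have dPhi: "(\<Phi> has_derivative A y) (at y)" if "y \<in> S" for y
    unfolding A_def using smooth_on_has_derivative[OF Phi(1) that] .
  have Gp: "G y = (\<lambda>v w. G' (\<Phi> y) (A y v) (A y w))" if "y \<in> S" for y
    using pull[OF that] by (simp add: A_def fun_eq_iff)
  have smX: "smooth_on S X" unfolding X_def[abs_def]
    by (intro smooth_intros S G uP smooth_on_linear_derivative[OF uP])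
  have smX': "smooth_on S' X'" unfolding X'_def[abs_def]
    by (intro smooth_intros S' G' u smooth_on_linear_derivative[OF u])
  have AX: "A y (X y) = X' (\<Phi> y)" if "y \<in> S" for y
  proof -
    have "frechet_derivative (\<lambda>y. u (\<Phi> y)) (at y) = (\<lambda>v. frechet_derivative u (at (\<Phi> y)) (A y v))"
      using frechet_derivative_at[OF has_derivative_compose[OF dPhi[OF that]
            smooth_on_has_derivative[OF u S'(2)[OF that]]]] by simp
    then show ?thesis
      using sharp_pullback[OF metric_onD(1)[OF G' S'(2)[OF that]] lA[OF that] sA[OF that] iA[OF that]
          smooth_on_linear_derivative[OF u S'(2)[OF that]]]
      by (simp add: X_def X'_def Gp[OF that])
  qed
  define a where "a = A x"
  define H where "H h v = frechet_derivative (\<lambda>y. A y v) (at x) h" for h v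
  define DX where "DX = frechet_derivative X (at x)"
  define DX' where "DX' = frechet_derivative X' (at (\<Phi> x))"
  note x' = S'(2)[OF S(2)] and B' = metric_onD(1)[OF G' S'(2)[OF S(2)]]
  have a: "linear a" "inj a" "surj a" unfolding a_def using lA iA sA S(2) by auto
  obtain I where I: "linear I" "I \<circ> a = id" using linear_injective_left_inverse[OF a(1,2)] by blast
  have Ia: "I (a v) = v" for v using I(2) by (metis comp_apply id_apply)
  have aI: "a (I v) = v" for v by (metis a(3) Ia surjD)
  have Hsym: "H h v = H v h" for h v
    unfolding H_def A_def by (rule symmetric_second_derivative[OF S Phi(1)])
  have lH: "linear (H h)" for h
    unfolding H_def by (rule linear_derivative_of_linear_family[OF S lA smA])
  have dA: "((\<lambda>y. A y v) has_derivative (\<lambda>h. H h v)) (at x)" for v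
    unfolding H_def by (rule smooth_on_has_derivative[OF smA S(2)])
  have lDX': "linear DX'" unfolding DX'_def by (rule smooth_on_linear_derivative[OF smX' x'])

  (* differentiate A X = X' o \<Phi> *)
  have DX: "DX h = I (DX' (a h)) - I (H (X x) h)" for h
  proof -
    have "((\<lambda>y. A y (X y)) has_derivative (\<lambda>h. H h (X x) + a (DX h))) (at x)"
      unfolding H_def a_def DX_def
      by (rule linear_family_has_derivative[OF S lA smA smooth_on_has_derivative[OF smX S(2)]])
    moreover have "((\<lambda>y. A y (X y)) has_derivative (\<lambda>h. DX' (a h))) (at x)"
      using has_derivative_transform_within_open[OF has_derivative_compose[OF dPhi[OF S(2)]
            smooth_on_has_derivative[OF smX' x']] S, of "\<lambda>y. A y (X y)"] AX
      by (simp add: a_def DX'_def)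
    ultimately have "H h (X x) + a (DX h) = DX' (a h)"
      using has_derivative_unique by metis
    then have "a (DX h) = DX' (a h) - H (X x) h" using Hsym[of h "X x"] by (simp add: algebra_simps)
    then show ?thesis by (metis Ia linear_diff[OF I(1)])
  qed
  define \<tau> where "\<tau> = (\<Sum>b\<in>Basis. I (H (X x) b) \<bullet> b)"
  have div: "(\<Sum>b\<in>Basis. DX b \<bullet> b) = (\<Sum>b\<in>Basis. DX' b \<bullet> b) - \<tau>"
    using trace_commute[OF I(1) linear_compose[OF a(1) lDX']]
    by (simp add: DX inner_diff_left sum_subtractf \<tau>_def aI)

  (* differentiate the pulled back metric by the product rule *)
  have GD: "metric_deriv G x h v w =
    metric_deriv G' (\<Phi> x) (a h) (a v) (a w) + G' (\<Phi> x) (H h v) (a w) + G' (\<Phi> x) (a v) (H h w)" for h v w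
  proof -
    have smG': "smooth_on S (\<lambda>y. G' (\<Phi> y) z k)" for z k
      by (rule smooth_on_compose[OF S(1) S'(1) metric_onD(2)[OF G'] Phi(1) S'(2)])
    have lG': "linear (G' (\<Phi> y) z)" "linear (\<lambda>z. G' (\<Phi> y) z k)" if "y \<in> S" for y z k
      by (rule metric_formD[OF metric_onD(1)[OF G' S'(2)[OF that]]])+
    have smF: "smooth_on S (\<lambda>y. G' (\<Phi> y) (A y v) z)" for z
    proof -
      have "smooth_on S (\<lambda>y. \<Sum>b\<in>Basis. (A y v \<bullet> b) *\<^sub>R G' (\<Phi> y) b z)"
        by (intro smooth_intros S smA smG')
      then show ?thesis
        by (subst smooth_on_cong[OF S(1) linear_Basis_expansion[OF lG'(2)]])
    qed
    have 1: "((\<lambda>y. G' (\<Phi> y) (A y v) (A y w)) has_derivative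
       (\<lambda>h. frechet_derivative (\<lambda>y. G' (\<Phi> y) (A y v) (a w)) (at x) h + G' (\<Phi> x) (a v) (H h w))) (at x)"
      unfolding a_def by (rule linear_family_has_derivative[OF S lG'(1) smF dA])
    have 2: "((\<lambda>y. G' (\<Phi> y) (A y v) (a w)) has_derivative
       (\<lambda>h. frechet_derivative (\<lambda>y. G' (\<Phi> y) (a v) (a w)) (at x) h + G' (\<Phi> x) (H h v) (a w))) (at x)"
      unfolding a_def by (rule linear_family_has_derivative[OF S lG'(2) smG' dA])
    have 3: "frechet_derivative (\<lambda>y. G' (\<Phi> y) (a v) (a w)) (at x) = (\<lambda>h. metric_deriv G' (\<Phi> x) (a h) (a v) (a w))"
      unfolding a_def using frechet_derivative_at[OF has_derivative_compose[OF dPhi[OF S(2)]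
            smooth_on_has_derivative[OF metric_onD(2)[OF G'] x']]] by simp
    have "frechet_derivative (\<lambda>y. G y v w) (at x) = frechet_derivative (\<lambda>y. G' (\<Phi> y) (A y v) (A y w)) (at x)"
      by (rule frechet_derivative_cong_open(1)[OF S]) (simp add: Gp)
    then show ?thesis
      by (simp only: frechet_derivative_at[OF 1, symmetric] frechet_derivative_at[OF 2, symmetric] 3)
  qed
  have Gx: "G x = (\<lambda>v w. G' (\<Phi> x) (a v) (a w))" using Gp[OF S(2)] by (simp add: a_def)
  have Bx: "metric_form (G x)" by (rule metric_onD(1)[OF G S(2)])
  have trH: "metric_trace (G x) (\<lambda>v w. G' (\<Phi> x) (H h v) (a w)) = (\<Sum>b\<in>Basis. I (H h b) \<bullet> b)" for h
    unfolding metric_trace_def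
    by (intro sum.cong refl arg_cong2[where f = inner] sharp_eqI[OF Bx]) (simp add: Gx aI)
  have bH: "bilinear (\<lambda>v w. G' (\<Phi> x) (H h v) (a w))" for h
    using metric_formD(1,2)[OF B'] lH a(1) unfolding bilinear_def
    by (auto intro: linear_compose[unfolded o_def])
  have bD: "bilinear (metric_deriv G' (\<Phi> x) h)" for h
    unfolding bilinear_def using linear_metric_deriv(1,2)[OF S'(1) x' G'] by blast
  have lin1: "linear (\<lambda>w. metric_deriv G' (\<Phi> x) h (a v) (a w))" for h v
    using linear_compose[OF a(1) linear_metric_deriv(1)[OF S'(1) x' G']] by (simp add: o_def)
  have tr: "metric_trace (G x) (metric_deriv G x (X x))
      = metric_trace (G' (\<Phi> x)) (metric_deriv G' (\<Phi> x) (X' (\<Phi> x))) + 2 * \<tau>"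
  proof -
    have "metric_trace (G x) (metric_deriv G x (X x)) =
       metric_trace (G x) (\<lambda>v w. metric_deriv G' (\<Phi> x) (a (X x)) (a v) (a w))
      + metric_trace (G x) (\<lambda>v w. G' (\<Phi> x) (H (X x) v) (a w))
      + metric_trace (G x) (\<lambda>v w. G' (\<Phi> x) (a v) (H (X x) w))"
      unfolding GD using bH[unfolded bilinear_def] lin1
        linear_compose[OF lH metric_formD(1)[OF B'], unfolded o_def]
      by (simp add: metric_trace_add[OF Bx] linear_compose_add)
    moreover have "(\<lambda>v w. G' (\<Phi> x) (a v) (H (X x) w)) = (\<lambda>v w. G' (\<Phi> x) (H (X x) w) (a v))"
      using metric_formD(3)[OF B'] by (simp add: fun_eq_iff)
    moreover have "metric_trace (G x) (\<lambda>v w. metric_deriv G' (\<Phi> x) (a (X x)) (a v) (a w))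
      = metric_trace (G' (\<Phi> x)) (metric_deriv G' (\<Phi> x) (X' (\<Phi> x)))"
      using metric_trace_pullback[OF B' a(1,3,2) bD] AX[OF S(2)] by (simp add: Gx a_def)
    ultimately show ?thesis
      using metric_trace_transpose[OF Bx bH[of "X x"]] by (simp add: trH \<tau>_def)
  qed
  show ?thesis
    using coord_laplacian_divergence[OF S G uP] coord_laplacian_divergence[OF S'(1) x' G' u] div tr
    by (simp add: X_def[symmetric] X'_def[symmetric] DX_def DX'_def add_divide_distrib)
qed

section \<open>The ambient Laplacian in a chart\<close>

text \<open>The ambient metric in a chart, with \<open>z = (x, \<rho>)\<close>, for the slice metrics \<open>H (x, \<rho>)\<close>.\<close>

definition cone_form ::
  "('e::euclidean_space \<times> real \<Rightarrow> 'e form2) \<Rightarrow> real \<times> 'e \<times> real \<Rightarrow> (real \<times> 'e \<times> real) form2" where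
  "cone_form H = (\<lambda>(t, z) (a, v, \<alpha>) (b, w, \<beta>).
     t * (a * \<beta> + \<alpha> * b) + 2 * snd z * a * b + t\<^sup>2 * H z v w)"

lemma ambient_metric_eq_cone_form:
  "ambient_metric \<gamma> i = cone_form (\<lambda>(x, \<rho>). \<gamma> \<rho> i x)"
  by (auto simp: ambient_metric_def cone_form_def fun_eq_iff)

lemma metric_form_cone_form:
  assumes H: "metric_form (H z)" and t: "t > 0"
  shows "metric_form (cone_form H (t, z))"
proof -
  note lin = metric_formD[OF H]
  show ?thesis
    unfolding metric_form_def
  proof (intro conjI allI impI)
    show "bilinear (cone_form H (t, z))"
      unfolding bilinear_def
      by (auto intro!: linearI simp: cone_form_def split_beta algebra_simps
          linear_add[OF lin(1)] linear_add[OF lin(2)] linear_scale[OF lin(1)] linear_scale[OF lin(2)])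
    show "cone_form H (t, z) v w = cone_form H (t, z) w v" for v w
      by (auto simp: cone_form_def split_beta algebra_simps lin(3))
    fix X assume X: "\<forall>Y. cone_form H (t, z) X Y = 0"
    obtain a v \<alpha> where Xe: "X = (a, v, \<alpha>)" by (cases X) auto
    have "t * a = 0"
      using X[rule_format, of "(0, 0, 1)"] linear_0[OF lin(1)] by (simp add: cone_form_def Xe)
    then have a: "a = 0" using t by simp
    have "t * \<alpha> = 0"
      using X[rule_format, of "(1, 0, 0)"] linear_0[OF lin(1)] by (simp add: cone_form_def Xe a)
    then have \<alpha>: "\<alpha> = 0" using t by simp
    have "H z v w = 0" for w
      using X[rule_format, of "(0, w, 0)"] t by (simp add: cone_form_def Xe a \<alpha>)
    then show "X = 0" using lin(4) by (simp add: Xe a \<alpha> zero_prod_def)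
  qed
qed

lemma open_cone: "open W \<Longrightarrow> open ({0::real<..} \<times> W)"
  by (intro open_Times) auto

lemma linear_slots:
  "linear L \<Longrightarrow> linear (\<lambda>w. L (w, 0))" "linear K \<Longrightarrow> linear (\<lambda>w. K (0, w, 0))"
proof -
  have "linear (\<lambda>w. (w, 0))" "linear (\<lambda>w. (0, w, 0))" by (auto intro!: linearI)
  from this[THEN linear_compose]
  show "linear L \<Longrightarrow> linear (\<lambda>w. L (w, 0))" "linear K \<Longrightarrow> linear (\<lambda>w. K (0, w, 0))"
    by (simp_all add: o_def)
qed

lemma metric_on_cone_form:
  fixes H :: "'e::euclidean_space \<times> real \<Rightarrow> 'e form2"
  assumes W: "open W" and H: "metric_on W H"
  shows "metric_on ({0<..} \<times> W) (cone_form H)"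
  unfolding metric_on_def
proof (intro conjI ballI allI)
  fix p :: "real \<times> 'e \<times> real" assume "p \<in> {0<..} \<times> W"
  then show "metric_form (cone_form H p)"
    using metric_form_cone_form[where H = H and z = "snd p" and t = "fst p"] metric_onD(1)[OF H] by auto
next
  fix X Y :: "real \<times> 'e \<times> real"
  note o = open_cone[OF W]
  have "smooth_on ({0::real<..} \<times> W) (\<lambda>p. H (snd p) (fst (snd X)) (fst (snd Y)))"
    by (rule smooth_on_compose[OF o W metric_onD(2)[OF H] smooth_on_snd[OF o]]) auto
  then show "smooth_on ({0<..} \<times> W) (\<lambda>p. cone_form H p X Y)"
    unfolding cone_form_def split_beta by (intro smooth_intros o)
qed

lemma sharp_cone_form:
  assumes H: "metric_form (H z)" and t: "t > 0" and xi: "linear \<xi>"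
  shows "sharp (cone_form H (t, z)) \<xi> =
    (\<xi> (0, 0, 1) / t, (1 / t\<^sup>2) *\<^sub>R sharp (H z) (\<lambda>w. \<xi> (0, w, 0)),
     \<xi> (1, 0, 0) / t - 2 * snd z * \<xi> (0, 0, 1) / t\<^sup>2)"
proof (rule sharp_eqI[OF metric_form_cone_form[where H = H and t = t and z = z, OF H t]])
  fix Y :: "real \<times> 'a \<times> real"
  obtain b w \<beta> where Y: "Y = (b, w, \<beta>)" by (cases Y) auto
  note lx = linear_slots(2)[OF xi]
  have "\<xi> Y = \<xi> (b *\<^sub>R (1, 0, 0) + (0, w, 0) + \<beta> *\<^sub>R (0, 0, 1))" by (simp add: Y)
  also have "\<dots> = b * \<xi> (1, 0, 0) + \<xi> (0, w, 0) + \<beta> * \<xi> (0, 0, 1)"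
    by (simp only: linear_add[OF xi] linear_scale[OF xi] real_scaleR_def)
  finally have e: "\<xi> Y = b * \<xi> (1, 0, 0) + \<xi> (0, w, 0) + \<beta> * \<xi> (0, 0, 1)" .
  show "cone_form H (t, z) (\<xi> (0, 0, 1) / t, (1 / t\<^sup>2) *\<^sub>R sharp (H z) (\<lambda>w. \<xi> (0, w, 0)),
     \<xi> (1, 0, 0) / t - 2 * snd z * \<xi> (0, 0, 1) / t\<^sup>2) Y = \<xi> Y"
    unfolding e using t
    by (simp add: cone_form_def Y linear_scale[OF metric_formD(2)[OF H]] sharp_works[OF H lx])
       (simp add: field_simps power2_eq_square)
qed

lemma metric_trace_lincomb:
  assumes B: "metric_form B" and "\<And>v. linear (C v)" "\<And>v. linear (D v)"
  shows "metric_trace B (\<lambda>v w. c * C v w + d * D v w) = c * metric_trace B C + d * metric_trace B D"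
  using linear_compose_scale_right[OF assms(2), of c] linear_compose_scale_right[OF assms(3), of d]
  by (simp add: metric_trace_add[OF B] metric_trace_scale[OF B assms(2)] metric_trace_scale[OF B assms(3)])

lemma sum_Basis_prod:
  fixes f :: "'a::euclidean_space \<times> 'b::euclidean_space \<Rightarrow> 'c::comm_monoid_add"
  shows "(\<Sum>b\<in>Basis. f b) = (\<Sum>b\<in>Basis. f (b, 0)) + (\<Sum>b\<in>Basis. f (0, b))"
proof -
  have "inj_on (\<lambda>u. (u::'a, 0::'b)) Basis"
    "inj_on (\<lambda>u. (0::'a, u::'b)) Basis"
    by (auto intro!: inj_onI Pair_inject)
  then show ?thesis
    unfolding Basis_prod_def by (subst sum.union_disjoint) (auto simp: sum.reindex)
qed

lemma metric_deriv_cone_form: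
  assumes W: "open W" "z \<in> W" and H: "metric_on W H"
  shows "metric_deriv (cone_form H) (t, z) (\<tau>, k) X Y =
     \<tau> * (fst X * snd (snd Y) + snd (snd X) * fst Y) + 2 * snd k * fst X * fst Y
     + 2 * t * \<tau> * H z (fst (snd X)) (fst (snd Y)) + t\<^sup>2 * metric_deriv H z k (fst (snd X)) (fst (snd Y))"
proof -
  obtain a v \<alpha> b w \<beta> where XY: "X = (a, v, \<alpha>)" "Y = (b, w, \<beta>)" by (cases X; cases Y) auto
  have d: "((\<lambda>p. H (snd p) v w) has_derivative (\<lambda>h. metric_deriv H z (snd h) v w)) (at (t, z))"
    using has_derivative_compose[of snd snd "(t, z)" UNIV "\<lambda>z. H z v w"]
      smooth_on_has_derivative[OF metric_onD(2)[OF H] W(2)]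
    by (simp add: bounded_linear_imp_has_derivative bounded_linear_snd)
  have "((\<lambda>p. cone_form H p (a, v, \<alpha>) (b, w, \<beta>)) has_derivative
     (\<lambda>h. fst h * (a * \<beta> + \<alpha> * b) + 2 * snd (snd h) * a * b
       + (t\<^sup>2 * metric_deriv H z (snd h) v w + 2 * t * fst h * H z v w))) (at (t, z))"
    unfolding cone_form_def split_beta
    by (auto intro!: derivative_eq_intros d ext simp: algebra_simps)
  from frechet_derivative_at[OF this, symmetric] show ?thesis by (simp add: XY)
qed

lemma metric_trace_deriv_cone_form:
  fixes H :: "'e::euclidean_space \<times> real \<Rightarrow> 'e form2"
  assumes W: "open W" "z \<in> W" and H: "metric_on W H" and t: "t > 0"
  shows "metric_trace (cone_form H (t, z)) (metric_deriv (cone_form H) (t, z) (\<tau>, k)) =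
     (2 + 2 * real DIM('e)) * \<tau> / t + metric_trace (H z) (metric_deriv H z k)"
proof -
  have B: "metric_form (H z)" using metric_onD(1)[OF H W(2)] .
  note o = open_cone[OF W(1)]
  have tz: "(t, z) \<in> {0<..} \<times> W" using t W by auto
  have l: "linear (metric_deriv (cone_form H) (t, z) (\<tau>, k) v)" for v
    by (rule linear_metric_deriv(1)[OF o tz metric_on_cone_form[OF W(1) H]])
  have l2: "linear (H z v)" for v using metric_formD(1)[OF B] .
  have l3: "linear (metric_deriv H z k v)" for v by (rule linear_metric_deriv(1)[OF W H])
  have c: "sharp (H z) (\<lambda>w. 2 * t * \<tau> * H z v w + t\<^sup>2 * metric_deriv H z k v w)
    = (2 * t * \<tau>) *\<^sub>R v + t\<^sup>2 *\<^sub>R sharp (H z) (metric_deriv H z k v)" for v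
  proof -
    have "sharp (H z) (H z v) = v" by (rule sharp_eqI[OF B]) simp
    then show ?thesis
      using sharp_linear(1)[OF B linear_compose_scale_right[OF l2, of "2 * t * \<tau>" v]
         linear_compose_scale_right[OF l3, of "t\<^sup>2" v]]
      by (simp add: sharp_linear(2)[OF B l2 l2] sharp_linear(2)[OF B l3 l3])
  qed
  have z0: "H z 0 v = 0" "H z v 0 = 0" "metric_deriv H z k 0 v = 0" "metric_deriv H z k v 0 = 0" for v
    using linear_0[OF l2] linear_0[OF l3] linear_0[OF metric_formD(2)[OF B]]
      linear_0[OF linear_metric_deriv(2)[OF W H]] by auto
  have "metric_trace (cone_form H (t, z)) (metric_deriv (cone_form H) (t, z) (\<tau>, k)) =
    \<tau> / t + ((\<Sum>b\<in>Basis. (1 / t\<^sup>2) * (2 * t * \<tau> * (b \<bullet> b) + t\<^sup>2 * (sharp (H z) (metric_deriv H z k b) \<bullet> (b :: 'e)))) + \<tau> / t)"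
    unfolding metric_trace_def sharp_cone_form[where H = H and t = t and z = z, OF B t l] sum_Basis_prod
    unfolding metric_deriv_cone_form[OF W H]
    by (simp add: z0 c inner_add_left)
  also have "(\<Sum>b\<in>Basis. (1 / t\<^sup>2) * (2 * t * \<tau> * (b \<bullet> b) + t\<^sup>2 * (sharp (H z) (metric_deriv H z k b) \<bullet> (b :: 'e))))
     = (\<Sum>b\<in>(Basis :: 'e set). 2 * \<tau> / t + sharp (H z) (metric_deriv H z k b) \<bullet> b)"
    using t by (intro sum.cong refl) (simp add: field_simps power2_eq_square)
  also have "\<dots> = 2 * real DIM('e) * \<tau> / t + metric_trace (H z) (metric_deriv H z k)"
    by (simp add: sum.distrib metric_trace_def)
  finally show ?thesis using t by (simp add: field_simps)
qed

text \<open>For a family \<open>H (x, \<rho>)\<close> of metrics in \<open>x\<close>: \<open>lap\<close> is the Laplacian of the slices, in the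
  form of \<open>coord_laplacian_divergence\<close>, and \<open>log_vol_deriv\<close> is \<open>\<partial>\<^sub>\<rho>\<close> of the logarithm of the volume density,
  by Jacobi's formula.\<close>

definition grad :: "('e::euclidean_space \<times> real \<Rightarrow> 'e form2) \<Rightarrow> ('e \<times> real \<Rightarrow> real) \<Rightarrow> 'e \<times> real \<Rightarrow> 'e" where
  "grad H U z = sharp (H z) (\<lambda>w. frechet_derivative U (at z) (w, 0))"

definition lap :: "('e::euclidean_space \<times> real \<Rightarrow> 'e form2) \<Rightarrow> ('e \<times> real \<Rightarrow> real) \<Rightarrow> 'e \<times> real \<Rightarrow> real" where
  "lap H U z = (\<Sum>b\<in>Basis. frechet_derivative (grad H U) (at z) (b, 0) \<bullet> b)
     + metric_trace (H z) (metric_deriv H z (grad H U z, 0)) / 2"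

definition log_vol_deriv :: "('e::euclidean_space \<times> real \<Rightarrow> 'e form2) \<Rightarrow> 'e \<times> real \<Rightarrow> real" where
  "log_vol_deriv H z = metric_trace (H z) (metric_deriv H z (0, 1)) / 2"

abbreviation d\<rho> :: "('e::euclidean_space \<times> real \<Rightarrow> 'f::real_normed_vector) \<Rightarrow> 'e \<times> real \<Rightarrow> 'f" where
  "d\<rho> U \<equiv> (\<lambda>z. frechet_derivative U (at z) (0, 1))"

lemma slice_derivative:
  assumes S: "smooth_on S F" "(t, z) \<in> S"
  shows "((\<lambda>s. F (s, z)) has_derivative (\<lambda>h. frechet_derivative F (at (t, z)) (h, 0))) (at t)"
    and "((\<lambda>y. F (t, y)) has_derivative (\<lambda>h. frechet_derivative F (at (t, z)) (0, h))) (at z)"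
proof -
  note F = smooth_on_has_derivative[OF S]
  show "((\<lambda>s. F (s, z)) has_derivative (\<lambda>h. frechet_derivative F (at (t, z)) (h, 0))) (at t)"
    by (rule has_derivative_compose[of "\<lambda>s. (s, z)" "\<lambda>h. (h, 0)", OF _ F])
       (auto intro!: derivative_eq_intros)
  show "((\<lambda>y. F (t, y)) has_derivative (\<lambda>h. frechet_derivative F (at (t, z)) (0, h))) (at z)"
    by (rule has_derivative_compose[of "\<lambda>y. (t, y)" "\<lambda>h. (0, h)", OF _ F])
       (auto intro!: derivative_eq_intros)
qed

lemma smooth_on_grad:
  assumes W: "open W" and H: "metric_on W H" and U: "smooth_on W U"
  shows "smooth_on W (grad H U)"
  unfolding grad_def[abs_def]
proof (intro smooth_intros W H U)
  fix z assume "z \<in> W"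
  then show "linear (\<lambda>w. frechet_derivative U (at z) (w, 0))"
    by (rule linear_slots(1)[OF smooth_on_linear_derivative[OF U]])
qed

text \<open>The gradient of \<open>\<phi>(t) U\<close> in the ambient metric has the components \<open>\<phi> U' / t\<close>,
  \<open>\<phi> t\<^sup>-\<^sup>2 grad U\<close> and \<open>\<phi>' U / t - 2 \<rho> \<phi> U' / t\<^sup>2\<close> with \<open>U' = \<partial>\<^sub>\<rho> U\<close>. The formula adds its
  divergence and half the trace of the derivative of the metric along it, where the
  \<open>t\<close>-component contributes \<open>(n + 1) / t\<close> times itself.\<close>

lemma cone_laplacian_product:
  fixes H :: "'e::euclidean_space \<times> real \<Rightarrow> 'e form2"
  assumes W: "open W" "z \<in> W" and H: "metric_on W H" and U: "smooth_on W U"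
    and \<phi>: "smooth_on {0<..} \<phi>" "\<And>s. s > 0 \<Longrightarrow> (\<phi> has_real_derivative \<phi>' s) (at s)" and t: "t > 0"
  shows "coord_laplacian (cone_form H) (\<lambda>(t, z). \<phi> t * U z) (t, z) =
    \<phi> t / t\<^sup>2 * (lap H U z - 2 * snd z * d\<rho> (d\<rho> U) z + (real DIM('e) - 2) * d\<rho> U z
        - 2 * snd z * log_vol_deriv H z * d\<rho> U z)
    + \<phi>' t / t * (2 * d\<rho> U z + log_vol_deriv H z * U z)"
proof -
  let ?S = "{0<..} \<times> W" and ?f = "\<lambda>(t, z). \<phi> t * U z"
  let ?G = "cone_form H"
  note o = open_cone[OF W(1)]
  have tz: "(t, z) \<in> ?S" using t W by auto
  have G: "metric_on ?S ?G" by (rule metric_on_cone_form[OF W(1) H])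
  have f: "smooth_on ?S ?f"
    unfolding split_beta
    by (intro smooth_on_mult o smooth_on_compose[OF o _ \<phi>(1) smooth_on_fst[OF o]]
        smooth_on_compose[OF o W(1) U smooth_on_snd[OF o]]) auto
  define X where "X = (\<lambda>y. sharp (?G y) (frechet_derivative ?f (at y)))"
  have df: "frechet_derivative ?f (at (s, y)) = (\<lambda>h. \<phi> s * frechet_derivative U (at y) (snd h) + \<phi>' s * fst h * U y)"
    if "s > 0" "y \<in> W" for s y
  proof -
    have 1: "((\<lambda>p. U (snd p)) has_derivative (\<lambda>h. frechet_derivative U (at y) (snd h))) (at (s, y))"
      using has_derivative_compose[of snd snd "(s, y)" UNIV U] smooth_on_has_derivative[OF U that(2)]
      by (simp add: bounded_linear_imp_has_derivative bounded_linear_snd)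
    have 2: "((\<lambda>p. \<phi> (fst p)) has_derivative (\<lambda>h. fst h * \<phi>' s)) (at (s, y))"
      by (rule DERIV_compose_FDERIV) (use \<phi>(2)[OF that(1)] in \<open>auto intro: bounded_linear_imp_has_derivative bounded_linear_fst\<close>)
    show ?thesis
      using frechet_derivative_at[OF has_derivative_mult[OF 2 1], symmetric]
      by (simp add: case_prod_unfold mult.commute)
  qed
  have Xe: "X (s, y) = (\<phi> s * d\<rho> U y / s, (\<phi> s / s\<^sup>2) *\<^sub>R grad H U y,
      \<phi>' s * U y / s - 2 * snd y * (\<phi> s * d\<rho> U y) / s\<^sup>2)" if "s > 0" "y \<in> W" for s y
  proof -
    have By: "metric_form (H y)" using metric_onD(1)[OF H that(2)] .
    have ly: "linear (frechet_derivative U (at y))" by (rule smooth_on_linear_derivative[OF U that(2)])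
    note l = linear_slots(1)[OF ly]
    have "(s, y) \<in> ?S" using that by auto
    from sharp_cone_form[where H = H and t = s and z = y, OF By that(1) smooth_on_linear_derivative[OF f this]]
    show ?thesis
      using linear_0[OF ly]
      by (simp add: X_def df[OF that] sharp_linear(2)[OF By l l] grad_def zero_prod_def)
  qed
  have sX: "smooth_on ?S X" unfolding X_def
    by (intro smooth_intros o G f smooth_on_linear_derivative[OF f])
  have sY: "smooth_on W (grad H U)" by (rule smooth_on_grad[OF W(1) H U])
  let ?DX = "frechet_derivative X (at (t, z))"
  have D1: "fst (?DX (1, 0)) = d\<rho> U z * (\<phi>' t / t - \<phi> t / t\<^sup>2)"
  proof -
    have "((\<lambda>s. fst (X (s, z))) has_derivative (\<lambda>h. fst (?DX (h, 0)))) (at t)"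
      by (rule has_derivative_fst[OF slice_derivative(1)[OF sX tz]])
    then have "((\<lambda>s. \<phi> s * d\<rho> U z / s) has_derivative (\<lambda>h. fst (?DX (h, 0)))) (at t)"
      by (rule has_derivative_transform_within_open[of _ _ _ _ "{0<..}"]) (use t W Xe in auto)
    moreover have "((\<lambda>s. \<phi> s * d\<rho> U z / s) has_derivative (\<lambda>h. h * (d\<rho> U z * (\<phi>' t / t - \<phi> t / t\<^sup>2)))) (at t)"
      using t by (auto intro!: derivative_eq_intros \<phi>(2)[OF t, THEN has_field_derivative_imp_has_derivative]
         ext simp: field_simps power2_eq_square)
    ultimately have "(\<lambda>h. fst (?DX (h, 0))) = (\<lambda>h. h * (d\<rho> U z * (\<phi>' t / t - \<phi> t / t\<^sup>2)))"
      by (rule has_derivative_unique)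
    from fun_cong[OF this, of 1] show ?thesis by (simp add: zero_prod_def)
  qed
  have sl: "((\<lambda>y. snd (X (t, y))) has_derivative (\<lambda>h. snd (?DX (0, h)))) (at z)"
    by (rule has_derivative_snd[OF slice_derivative(2)[OF sX tz]])
  have D2: "fst (snd (?DX (0, h))) = (\<phi> t / t\<^sup>2) *\<^sub>R frechet_derivative (grad H U) (at z) h" for h
  proof -
    have "((\<lambda>y. (\<phi> t / t\<^sup>2) *\<^sub>R grad H U y) has_derivative (\<lambda>h. fst (snd (?DX (0, h))))) (at z)"
      by (rule has_derivative_transform_within_open[OF has_derivative_fst[OF sl] W]) (use t Xe in auto)
    moreover have "((\<lambda>y. (\<phi> t / t\<^sup>2) *\<^sub>R grad H U y) has_derivative (\<lambda>h. (\<phi> t / t\<^sup>2) *\<^sub>R frechet_derivative (grad H U) (at z) h)) (at z)"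
      by (intro has_derivative_scaleR_right smooth_on_has_derivative[OF sY W(2)])
    ultimately show ?thesis using has_derivative_unique by metis
  qed
  have D3: "snd (snd (?DX (0, (0, 1)))) = \<phi>' t * d\<rho> U z / t - 2 * \<phi> t * d\<rho> U z / t\<^sup>2
      - 2 * snd z * \<phi> t * d\<rho> (d\<rho> U) z / t\<^sup>2"
  proof -
    have "((\<lambda>y. \<phi>' t * U y / t - 2 * snd y * (\<phi> t * d\<rho> U y) / t\<^sup>2) has_derivative (\<lambda>h. snd (snd (?DX (0, h))))) (at z)"
      by (rule has_derivative_transform_within_open[OF has_derivative_snd[OF sl] W]) (use t Xe in auto)
    moreover have "((\<lambda>y. \<phi>' t * U y / t - 2 * snd y * (\<phi> t * d\<rho> U y) / t\<^sup>2) has_derivative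
       (\<lambda>h. \<phi>' t * frechet_derivative U (at z) h / t
          - 2 * (snd z * (\<phi> t * frechet_derivative (d\<rho> U) (at z) h) + snd h * (\<phi> t * d\<rho> U z)) / t\<^sup>2)) (at z)"
      using t by (auto intro!: derivative_eq_intros smooth_on_has_derivative[OF U W(2)]
          smooth_on_has_derivative[OF smooth_on_frechet_derivative[OF U] W(2)] ext simp: field_simps)
    ultimately have "(\<lambda>h. snd (snd (?DX (0, h)))) = (\<lambda>h. \<phi>' t * frechet_derivative U (at z) h / t
          - 2 * (snd z * (\<phi> t * frechet_derivative (d\<rho> U) (at z) h) + snd h * (\<phi> t * d\<rho> U z)) / t\<^sup>2)"
      by (rule has_derivative_unique)
    from fun_cong[OF this, of "(0, 1)"] show ?thesis
      by (simp add: algebra_simps add_divide_distrib)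
  qed
  have div: "(\<Sum>b\<in>Basis. ?DX b \<bullet> b) = d\<rho> U z * (\<phi>' t / t - \<phi> t / t\<^sup>2)
     + \<phi> t / t\<^sup>2 * (\<Sum>b\<in>Basis. frechet_derivative (grad H U) (at z) (b, 0) \<bullet> b)
     + (\<phi>' t * d\<rho> U z / t - 2 * \<phi> t * d\<rho> U z / t\<^sup>2 - 2 * snd z * \<phi> t * d\<rho> (d\<rho> U) z / t\<^sup>2)"
    using D1 D3 by (simp add: sum_Basis_prod inner_prod_def D2 sum_distrib_left zero_prod_def)
  let ?a = "\<phi> t / t\<^sup>2" and ?r = "\<phi>' t * U z / t - 2 * snd z * (\<phi> t * d\<rho> U z) / t\<^sup>2"
  have split: "metric_deriv H z (?a *\<^sub>R grad H U z, ?r)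
     = (\<lambda>v w. ?a * metric_deriv H z (grad H U z, 0) v w + ?r * metric_deriv H z (0, 1) v w)"
  proof (intro ext)
    fix v w
    note l = linear_metric_deriv(3)[OF W H, of v w]
    have "(?a *\<^sub>R grad H U z, ?r) = ?a *\<^sub>R (grad H U z, 0) + ?r *\<^sub>R (0, 1)" by simp
    then show "metric_deriv H z (?a *\<^sub>R grad H U z, ?r) v w
       = ?a * metric_deriv H z (grad H U z, 0) v w + ?r * metric_deriv H z (0, 1) v w"
      by (simp only: linear_add[OF l] linear_scale[OF l] real_scaleR_def)
  qed
  note B = metric_onD(1)[OF H W(2)] and lD = linear_metric_deriv(1)[OF W H]
  have tr: "metric_trace (H z) (metric_deriv H z (?a *\<^sub>R grad H U z, ?r))
    = ?a * metric_trace (H z) (metric_deriv H z (grad H U z, 0)) + ?r * (2 * log_vol_deriv H z)"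
    unfolding split metric_trace_lincomb[OF B lD lD] log_vol_deriv_def by simp
  have "coord_laplacian ?G ?f (t, z) = (\<Sum>b\<in>Basis. ?DX b \<bullet> b)
      + metric_trace (?G (t, z)) (metric_deriv ?G (t, z) (X (t, z))) / 2"
    unfolding X_def by (rule coord_laplacian_divergence[OF o tz G f])
  then have e: "coord_laplacian ?G ?f (t, z) = (\<Sum>b\<in>Basis. ?DX b \<bullet> b)
      + ((2 + 2 * real DIM('e)) * (\<phi> t * d\<rho> U z / t) / t
         + metric_trace (H z) (metric_deriv H z (?a *\<^sub>R grad H U z, ?r))) / 2"
    by (simp only: Xe[OF t W(2)] metric_trace_deriv_cone_form[OF W H t])
  show ?thesis
    unfolding e div tr lap_def using t by (simp add: field_simps power2_eq_square)
qed

section \<open>Sums over compositions\<close>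

text \<open>The index set of the sum in the theorem.\<close>

definition splittings :: "nat \<Rightarrow> (nat list \<times> nat) set" where
  "splittings s = {(I, a). 1 \<le> a \<and> (\<exists>k. I \<in> compositions k \<and> k + a = s)}"

lemma compositions_0 [simp]: "compositions 0 = {[]}"
proof -
  have "I = []" if "\<forall>j\<in>set I. 1 \<le> j" "sum_list I = 0" for I :: "nat list"
    using that by (cases I) auto
  then show ?thesis by (auto simp: compositions_def)
qed

lemma composition_pos: "I \<in> compositions s \<Longrightarrow> I \<noteq> [] \<Longrightarrow> 0 < s"
  by (cases I) (auto simp: compositions_def)

lemma splittings_unfold:
  assumes "1 \<le> s"
  shows "splittings s = insert ([], s) (\<Union>i\<in>{1..<s}. (\<lambda>(I, a). (i # I, a)) ` splittings (s - i))"
proof (intro equalityI subsetI)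
  fix x assume "x \<in> splittings s"
  then obtain I a where x: "x = (I, a)" "1 \<le> a" "\<forall>j\<in>set I. 1 \<le> j" "sum_list I + a = s"
    by (auto simp: splittings_def compositions_def)
  show "x \<in> insert ([], s) (\<Union>i\<in>{1..<s}. (\<lambda>(I, a). (i # I, a)) ` splittings (s - i))"
  proof (cases I)
    case Nil
    then show ?thesis using x by simp
  next
    case (Cons i I')
    then have "(I', a) \<in> splittings (s - i)" "i \<in> {1..<s}"
      using x by (auto simp: splittings_def compositions_def)
    then show ?thesis using x Cons by (auto intro!: bexI[of _ i] image_eqI[of _ _ "(I', a)"])
  qed
next
  fix x assume "x \<in> insert ([], s) (\<Union>i\<in>{1..<s}. (\<lambda>(I, a). (i # I, a)) ` splittings (s - i))"
  then show "x \<in> splittings s"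
    using assms by (auto simp: splittings_def compositions_def)
qed

lemma finite_splittings: "finite (splittings s)"
proof (rule finite_subset)
  show "splittings s \<subseteq> (\<Union>k\<le>s. compositions k) \<times> {..s}"
    by (force simp: splittings_def)
  show "finite ((\<Union>k\<le>s. compositions k) \<times> {..s})" by (simp add: finite_compositions)
qed

text \<open>Split off the first entry of the composition.\<close>

lemma sum_splittings_rec:
  fixes g :: "nat list \<Rightarrow> nat \<Rightarrow> 'v::comm_monoid_add"
  assumes "1 \<le> s"
  shows "(\<Sum>(I, a)\<in>splittings s. g I a)
    = g [] s + (\<Sum>i=1..<s. \<Sum>(I, a)\<in>splittings (s - i). g (i # I) a)"
proof -
  let ?f = "\<lambda>i. \<lambda>(I :: nat list, a :: nat). (i # I, a)"
  have inj: "inj_on (?f i) A" for i :: nat and A by (auto intro!: inj_onI)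
  have "(\<Sum>(I, a)\<in>splittings s. g I a)
     = g [] s + (\<Sum>(I, a)\<in>(\<Union>i\<in>{1..<s}. ?f i ` splittings (s - i)). g I a)"
    unfolding splittings_unfold[OF assms] by (subst sum.insert) (auto simp: finite_splittings)
  also have "(\<Sum>(I, a)\<in>(\<Union>i\<in>{1..<s}. ?f i ` splittings (s - i)). g I a)
     = (\<Sum>i=1..<s. \<Sum>(I, a)\<in>?f i ` splittings (s - i). g I a)"
    by (subst sum.UNION_disjoint) (auto simp: finite_splittings)
  also have "\<dots> = (\<Sum>i=1..<s. \<Sum>(I, a)\<in>splittings (s - i). g (i # I) a)"
    by (rule sum.cong[OF refl], subst sum.reindex[OF inj]) (simp add: case_prod_unfold)
  finally show ?thesis .
qed

lemma sum_compositions_append: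
  fixes g :: "nat list \<Rightarrow> nat list \<Rightarrow> 'v::comm_monoid_add"
  shows "(\<Sum>i=1..<s. \<Sum>K\<in>compositions i. \<Sum>L\<in>compositions (s - i). g K L)
    = (\<Sum>K\<in>compositions s. \<Sum>j=1..<length K. g (take j K) (drop j K))"
proof -
  have "(\<Sum>i=1..<s. \<Sum>K\<in>compositions i. \<Sum>L\<in>compositions (s - i). g K L)
    = (\<Sum>(i, K, L)\<in>(SIGMA i:{1..<s}. compositions i \<times> compositions (s - i)). g K L)"
    by (simp add: sum.Sigma sum.cartesian_product finite_compositions)
  also have "\<dots> = (\<Sum>(K, j)\<in>(SIGMA K:compositions s. {1..<length K}). g (take j K) (drop j K))"
  proof (rule sum.reindex_bij_witness[where
        i = "\<lambda>(K, j). (sum_list (take j K), take j K, drop j K)" and j = "\<lambda>(i, K, L). (K @ L, length K)"])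
    fix x assume "x \<in> (SIGMA K:compositions s. {1..<length K})"
    then obtain K j where x: "x = (K, j)" "K \<in> compositions s" "1 \<le> j" "j < length K" by auto
    have e: "sum_list (take j K) + sum_list (drop j K) = s"
      using x(2) by (metis (mono_tags, lifting) append_take_drop_id compositions_def mem_Collect_eq sum_list_append)
    have c: "take j K \<in> compositions (sum_list (take j K))" "drop j K \<in> compositions (sum_list (drop j K))"
      using x(2) by (auto simp: compositions_def dest: in_set_takeD in_set_dropD)
    have "0 < sum_list (take j K)" "0 < sum_list (drop j K)"
      using composition_pos[OF c(1)] composition_pos[OF c(2)] x by (cases K; auto)+
    then show "(case x of (K, j) \<Rightarrow> (sum_list (take j K), take j K, drop j K))
        \<in> (SIGMA i:{1..<s}. compositions i \<times> compositions (s - i))"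
      using e c x by (auto simp: diff_add_inverse[symmetric])
  qed (auto simp: compositions_def Suc_le_eq)
  also have "\<dots> = (\<Sum>K\<in>compositions s. \<Sum>j=1..<length K. g (take j K) (drop j K))"
    by (simp add: sum.Sigma finite_compositions)
  finally show ?thesis .
qed


subsection \<open>Product formulas for the coefficients\<close>

text \<open>\<open>nu N I\<close> is the product of \<open>1/(i-1)!\<^sup>2\<close> over the entries and of \<open>1/(s (N - s))\<close> over the
  sums \<open>s\<close> of the proper nonempty suffixes.\<close>

fun nu :: "nat \<Rightarrow> nat list \<Rightarrow> real" where
  "nu N [] = 1"
| "nu N (i # I) = nu N I / (fact (i - 1))\<^sup>2
     / (if I = [] then 1 else real (sum_list I) * (real N - real (sum_list I)))"

text \<open>\<^const>\<open>n_coeff\<close> with all prefix sums shifted by \<open>p\<close>; the shift makes an induction over the list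
  possible.\<close>

fun n_rec :: "nat \<Rightarrow> nat list \<Rightarrow> real" where
  "n_rec p [] = 1"
| "n_rec p (i # I) = real ((p + i - 1) choose (i - 1)) * real ((i + sum_list I - 1) choose (i - 1)) * n_rec (p + i) I"

lemma sum_nth_suffix:
  "(\<Sum>k\<in>{j..<length (I :: nat list)}. I ! k) = sum_list (drop j I)"
proof -
  have "sum_list (drop j I) = (\<Sum>k\<in>{0..<length I - j}. I ! (j + k))"
    by (simp add: sum_list_sum_nth)
  also have "\<dots> = (\<Sum>k\<in>{j..<length I}. I ! k)"
    by (rule sum.reindex_bij_witness[where i = "\<lambda>k. k - j" and j = "\<lambda>k. j + k"]) auto
  finally show ?thesis by simp
qed

lemma n_rec_eq_prod:
  "n_rec p I = (\<Prod>j<length I. real ((p + (\<Sum>k\<le>j. I ! k) - 1) choose (I ! j - 1))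
     * real ((sum_list (drop j I) - 1) choose (I ! j - 1)))"
proof (induction I arbitrary: p)
  case (Cons i I)
  show ?case
    unfolding length_Cons prod.lessThan_Suc_shift
    by (simp add: Cons.IH[of "p + i"] sum.atMost_Suc_shift add.assoc del: sum.atMost_Suc)
qed simp

text \<open>Both binomial coefficients of an entry are quotients of factorials of consecutive partial sums,
  from the left and from the right, so the product telescopes up to one factor for each partial
  sum.\<close>

lemma n_rec_eq_nu:
  assumes "\<forall>j\<in>set I. 1 \<le> j" "I \<noteq> []"
  shows "n_rec p I = nu (p + sum_list I) I * fact (p + sum_list I - 1) * fact (sum_list I - 1) / fact p"
  using assms
proof (induction I arbitrary: p)
  case (Cons i I)
  have i: "1 \<le> i" using Cons.prems by simp
  have ch: "real ((q + i - 1) choose (i - 1)) = fact (q + i - 1) / (fact (i - 1) * fact q)" for q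
    using i by (subst binomial_fact) auto
  show ?case
  proof (cases "I = []")
    case True
    then show ?thesis using i by (simp add: ch power2_eq_square del: One_nat_def)
  next
    case False
    define s where "s = sum_list I"
    have s: "1 \<le> s" using False Cons.prems by (cases I) (auto simp: s_def)
    have IH: "n_rec (p + i) I = nu (p + i + s) I * fact (p + i + s - 1) * fact (s - 1) / fact (p + i)"
      using Cons False by (simp add: s_def add.assoc)
    have f: "fact (p + i) = real (p + i) * fact (p + i - 1)" "fact s = real s * fact (s - 1)"
      using i s by (simp_all add: fact_reduce)
    have "n_rec p (i # I) = fact (p + i - 1) / (fact (i - 1) * fact p) * (fact (s + i - 1) / (fact (i - 1) * fact s))
       * (nu (p + i + s) I * fact (p + i + s - 1) * fact (s - 1) / fact (p + i))"
      using ch[of s] by (simp only: n_rec.simps IH s_def[symmetric] ch[of p] add.commute[of i s])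
    also have "\<dots> = nu (p + (i + s)) I / (fact (i - 1))\<^sup>2 / (real s * real (p + i)) * fact (p + (i + s) - 1)
        * fact (i + s - 1) / fact p"
    proof -
      have "A / (a * P) * (B / (a * (t * S))) * (n * C * S / (q * A)) = n / a\<^sup>2 / (t * q) * C * B / P"
        if "A \<noteq> 0" "S \<noteq> 0" for A a P B t S n C q :: real
        using that by (simp add: power2_eq_square mult.assoc mult.commute mult.left_commute)
      from this[of "fact (p + i - 1)" "fact (s - 1)"] show ?thesis
        unfolding f by (simp only: add.assoc add.commute[of i s] fact_nonzero not_False_eq_True simp_thms)
    qed
    finally show ?thesis using False by (simp add: s_def[symmetric])
  qed
qed simp

lemma n_coeff_eq_nu:
  assumes "I \<in> compositions N" "1 \<le> N"
  shows "n_coeff I = (fact (N - 1))\<^sup>2 * nu N I"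
proof -
  have "n_coeff I = n_rec 0 I"
    unfolding n_coeff_def n_rec_eq_prod sum_nth_suffix by simp
  also have "\<dots> = (fact (N - 1))\<^sup>2 * nu N I"
    using assms n_rec_eq_nu[of I 0] by (cases "I = []") (auto simp: compositions_def power2_eq_square)
  finally show ?thesis .
qed

text \<open>Up to the factor \<open>- N! (N - 1)!\<close>, the coefficient \<open>m\<^sub>I\<close> is a product of weights of the
  entries and weights of the pairs of neighbours.\<close>

definition entry_weight :: "nat list \<Rightarrow> real" where
  "entry_weight I = prod_list (map (\<lambda>i. - 1 / (fact i * fact (i - 1))) I)"

fun link_weight :: "nat list \<Rightarrow> real" where
  "link_weight (i # j # I) = link_weight (j # I) / (real i + real j)"
| "link_weight I = 1"

lemma m_coeff_eq_weights:
  "m_coeff I = - fact (sum_list I) * fact (sum_list I - 1) * entry_weight I * link_weight I"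
proof -
  have "entry_weight I = (- 1) ^ length I * (\<Prod>j<length I. 1 / (fact (I ! j) * fact (I ! j - 1)))"
  proof (induction I)
    case (Cons i I)
    then show ?case
      unfolding length_Cons prod.lessThan_Suc_shift by (simp add: entry_weight_def)
  qed (simp add: entry_weight_def)
  moreover have "link_weight I = (\<Prod>j<length I - 1. 1 / (real (I ! j) + real (I ! (j + 1))))"
  proof (induction I rule: link_weight.induct)
    case (1 i j I)
    then show ?case
      by (simp add: prod.lessThan_Suc_shift del: prod.lessThan_Suc)
  qed auto
  ultimately show ?thesis by (simp add: m_coeff_def)
qed

lemma link_weight_append:
  assumes "K \<noteq> []" "L \<noteq> []"
  shows "link_weight (K @ L) = link_weight K * link_weight L / (real (last K) + real (hd L))"
  using assms
proof (induction K rule: link_weight.induct)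
  case (1 i j I)
  then show ?case by simp
next
  case ("2_2" i)
  then show ?case by (cases L) auto
qed auto

lemma entry_weight_append: "entry_weight (K @ L) = entry_weight K * entry_weight L"
  by (simp add: entry_weight_def)

text \<open>The telescoping sum behind the inversion of Juhl's formula: with prefix sums \<open>y\<^sub>j\<close>, the
  summands are \<open>y\<^sub>j (y\<^sub>j\<^sub>+\<^sub>1 - y\<^sub>j\<^sub>-\<^sub>1)\<close>.\<close>

lemma sum_prefix_telescope:
  fixes K :: "nat list"
  assumes "K \<noteq> []"
  shows "(\<Sum>j=1..<length K. real (sum_list (take j K)) * (real (last (take j K)) + real (hd (drop j K))))
     = real (sum_list K) * (real (sum_list K) - real (last K))"
proof -
  define y where "y j = real (sum_list (take j K))" for j
  have yS: "y (Suc j) = y j + real (K ! j)" if "j < length K" for j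
    using that by (simp add: y_def take_Suc_conv_app_nth)
  have "(\<Sum>j=1..<m. real (sum_list (take j K)) * (real (last (take j K)) + real (hd (drop j K))))
      = y m * y (m - 1)" if "1 \<le> m" "m \<le> length K" for m
    using that
  proof (induction m rule: dec_induct)
    case base
    then show ?case by (simp add: y_def)
  next
    case (step m)
    have "last (take m K) = K ! (m - 1)" using step assms by (simp add: last_conv_nth)
    moreover have "hd (drop m K) = K ! m" using step by (simp add: hd_drop_conv_nth)
    moreover have "y (m + 1) = y m + real (K ! m)" "y m = y (m - 1) + real (K ! (m - 1))"
      using yS[of m] yS[of "m - 1"] step by auto
    ultimately show ?case using step by (simp add: y_def[symmetric] algebra_simps)
  qed
  from this[of "length K"] assms
  have "(\<Sum>j=1..<length K. real (sum_list (take j K)) * (real (last (take j K)) + real (hd (drop j K))))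
     = y (length K) * y (length K - 1)" by (simp add: Suc_le_eq)
  moreover have "y (length K) = y (length K - 1) + real (last K)"
    using yS[of "length K - 1"] assms by (simp add: last_conv_nth)
  ultimately show ?thesis by (simp add: y_def)
qed

section \<open>Juhl's formulas for formal families of operators\<close>

definition linear_within :: "'v::real_vector set \<Rightarrow> ('v \<Rightarrow> 'v) \<Rightarrow> bool" where
  "linear_within E T \<longleftrightarrow> (\<forall>u\<in>E. T u \<in> E) \<and> (\<forall>u\<in>E. \<forall>v\<in>E. T (u + v) = T u + T v) \<and>
     (\<forall>u\<in>E. \<forall>c. T (c *\<^sub>R u) = c *\<^sub>R T u)"

lemma linear_withinD:
  assumes "linear_within E T" "u \<in> E"
  shows "T u \<in> E" "v \<in> E \<Longrightarrow> T (u + v) = T u + T v" "T (c *\<^sub>R u) = c *\<^sub>R T u"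
  using assms by (auto simp: linear_within_def)

context
  fixes E :: "'v::real_vector set"
  assumes E: "subspace E"
begin

lemma linear_within_0: "linear_within E T \<Longrightarrow> T 0 = 0"
  using linear_withinD(3)[of E T 0 0] subspace_0[OF E] by simp

lemma linear_within_sum:
  assumes "linear_within E T" "\<And>i. i \<in> I \<Longrightarrow> f i \<in> E"
  shows "T (\<Sum>i\<in>I. f i) = (\<Sum>i\<in>I. T (f i))"
  using assms(2)
proof (induction I rule: infinite_finite_induct)
  case (insert i I)
  then show ?case
    by (simp add: linear_withinD[OF assms(1)] subspace_sum[OF E])
qed (simp_all add: linear_within_0[OF assms(1)])

lemma linear_within_op_comp:
  assumes "\<And>j. j \<in> set I \<Longrightarrow> linear_within E (P j)"
  shows "linear_within E (op_comp P I)"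
  using assms
proof (induction I)
  case (Cons j I)
  then have "linear_within E (op_comp P I)" "linear_within E (P j)" by auto
  then show ?case by (auto simp: linear_within_def op_comp_def)
qed (auto simp: linear_within_def op_comp_def)

lemma linear_within_lincomb:
  assumes "\<And>i. i \<in> I \<Longrightarrow> linear_within E (T i)"
  shows "linear_within E (\<lambda>u. \<Sum>i\<in>I. c i *\<^sub>R T i u)"
  using assms
  by (auto simp: linear_within_def scaleR_right_distrib sum.distrib scaleR_sum_right mult.commute
      intro!: subspace_sum[OF E] subspace_scale[OF E])

end

lemma op_comp_Cons: "op_comp P (i # I) u = P i (op_comp P I u)"
  by (simp add: op_comp_def)

lemma op_comp_append: "op_comp P (I @ J) u = op_comp P I (op_comp P J u)"
  by (simp add: op_comp_def)


subsection \<open>Inversion\<close>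

text \<open>The sum in Juhl's formulas for operators \<open>T\<close> and arguments \<open>y\<close>, without the factor
  \<open>(N - 1)!\<^sup>2\<close>; for \<open>s < N\<close> it is the partial sum that arises in the recursion.\<close>

definition juhl_sum :: "nat \<Rightarrow> (nat \<Rightarrow> 'v \<Rightarrow> 'v) \<Rightarrow> nat \<Rightarrow> (nat \<Rightarrow> 'v) \<Rightarrow> 'v::real_vector" where
  "juhl_sum N T s y = (\<Sum>(I, a)\<in>splittings s. nu N (I @ [a]) *\<^sub>R op_comp T I (y a))"

lemma sum_list_splitting: "(I, a) \<in> splittings s \<Longrightarrow> sum_list I + a = s"
  by (auto simp: splittings_def compositions_def)

lemma splittings_le:
  assumes "(I, a) \<in> splittings s"
  shows "1 \<le> a" "a \<le> s" "j \<in> set I \<Longrightarrow> 1 \<le> j" "j \<in> set I \<Longrightarrow> j < s"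
  using assms member_le_sum_list[of j I] by (fastforce simp: splittings_def compositions_def)+

lemma juhl_sum_rec:
  assumes E: "subspace E" and s: "1 \<le> s" and T: "\<And>j. 1 \<le> j \<Longrightarrow> linear_within E (T j)"
    and y: "\<And>a. y a \<in> E"
  shows "juhl_sum N T s y = (1 / (fact (s - 1))\<^sup>2) *\<^sub>R y s
    + (\<Sum>i=1..<s. (1 / (fact (i - 1))\<^sup>2 / (real (s - i) * (real N - real (s - i)))) *\<^sub>R T i (juhl_sum N T (s - i) y))"
proof -
  have "(\<Sum>(I, a)\<in>splittings (s - i). nu N ((i # I) @ [a]) *\<^sub>R op_comp T (i # I) (y a))
     = (1 / (fact (i - 1))\<^sup>2 / (real (s - i) * (real N - real (s - i)))) *\<^sub>R T i (juhl_sum N T (s - i) y)"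
    if i: "i \<in> {1..<s}" for i
  proof -
    let ?c = "1 / (fact (i - 1))\<^sup>2 / (real (s - i) * (real N - real (s - i)))"
    have oE: "op_comp T I (y a) \<in> E" if "(I, a) \<in> splittings (s - i)" for I a
      by (rule linear_withinD(1)[OF linear_within_op_comp[where P = T, OF E T] y]) (use splittings_le[OF that] in auto)
    have "?c *\<^sub>R T i (juhl_sum N T (s - i) y)
       = (\<Sum>x\<in>splittings (s - i). ?c *\<^sub>R T i (nu N (fst x @ [snd x]) *\<^sub>R op_comp T (fst x) (y (snd x))))"
      unfolding juhl_sum_def case_prod_unfold using i oE
      by (subst linear_within_sum[OF E T]) (auto simp: scaleR_sum_right intro!: subspace_scale[OF E])
    also have "\<dots> = (\<Sum>x\<in>splittings (s - i). nu N ((i # fst x) @ [snd x]) *\<^sub>R op_comp T (i # fst x) (y (snd x)))"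
    proof (rule sum.cong[OF refl])
      fix x assume x: "x \<in> splittings (s - i)"
      have "sum_list (fst x) + snd x = s - i" using sum_list_splitting[of "fst x" "snd x"] x by simp
      then have sl: "sum_list (fst x @ [snd x]) = s - i" by simp
      have "T i (nu N (fst x @ [snd x]) *\<^sub>R op_comp T (fst x) (y (snd x)))
        = nu N (fst x @ [snd x]) *\<^sub>R T i (op_comp T (fst x) (y (snd x)))"
        using i oE[of "fst x" "snd x"] x by (intro linear_withinD(3)[OF T]) auto
      then show "?c *\<^sub>R T i (nu N (fst x @ [snd x]) *\<^sub>R op_comp T (fst x) (y (snd x)))
        = nu N ((i # fst x) @ [snd x]) *\<^sub>R op_comp T (i # fst x) (y (snd x))"
        using sl by (simp add: op_comp_Cons del: sum_list_append)
    qed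
    finally show ?thesis by (simp add: case_prod_unfold)
  qed
  then show ?thesis
    unfolding juhl_sum_def by (subst sum_splittings_rec[OF s]) (simp add: op_comp_def)
qed

text \<open>\<open>m_sum P\<close> are the operators that Juhl's formula for \<open>\<M>\<^sub>2\<^sub>N\<close> builds from \<open>P\<^sub>2, P\<^sub>4, \<dots>\<close>\<close>

definition m_sum :: "(nat \<Rightarrow> 'v \<Rightarrow> 'v) \<Rightarrow> nat \<Rightarrow> 'v \<Rightarrow> 'v::real_vector" where
  "m_sum P N u = (\<Sum>I\<in>compositions N. m_coeff I *\<^sub>R op_comp P I u)"

text \<open>The coefficient of \<open>P\<^sub>2\<^sub>K\<close> that remains in a partial sum of Juhl's formula for \<open>P\<^sub>2\<^sub>N\<close> when the
  operators \<open>\<M>\<close> in it are expanded. Lists with one entry are separate since the general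
  formula reads \<open>0 / 0\<close> for the list \<open>(N)\<close>.\<close>

definition closed_coeff :: "nat \<Rightarrow> nat list \<Rightarrow> real" where
  "closed_coeff N K = - entry_weight K * link_weight K *
     (if length K = 1 then real (sum_list K)
      else real (sum_list K) * (real N - real (sum_list K)) / (real N - real (last K)))"

lemma linear_within_m_sum:
  assumes "subspace E" "\<And>j. 1 \<le> j \<Longrightarrow> linear_within E (P j)"
  shows "linear_within E (m_sum P N)"
  unfolding m_sum_def[abs_def]
  by (intro linear_within_lincomb linear_within_op_comp assms) (auto simp: compositions_def)

lemma last_le_sum_list: "K \<noteq> [] \<Longrightarrow> last K \<le> sum_list (K :: nat list)"
  by (simp add: member_le_sum_list)

lemma last_less_sum_list:
  assumes "K \<in> compositions s" "length K > 1" shows "last K < s"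
proof -
  have "butlast K \<noteq> []" using assms(2) by (cases K rule: rev_cases) auto
  moreover have "\<forall>j\<in>set (butlast K). 1 \<le> j"
    using assms by (auto simp: compositions_def dest: in_set_butlastD)
  ultimately have "0 < sum_list (butlast K)" by (cases "butlast K") auto
  moreover have "sum_list K = sum_list (butlast K) + last K"
    using assms(2) by (cases K rule: rev_cases) auto
  ultimately show ?thesis using assms(1) by (simp add: compositions_def)
qed

text \<open>A composition \<open>K\<close> arises from a first block, which an operator \<open>\<M>\<close> contributes, and a rest.
  The quotient of the link weights of both parts by the link weight of \<open>K\<close> is the sum of the two
  entries at the cut, so the sum over all cuts is the telescoping sum above.\<close>

lemma closed_coeff_split_sum:
  assumes K: "K \<in> compositions s" "1 \<le> s" "s \<le> N"
  shows "m_coeff K / (fact (s - 1))\<^sup>2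
     + (\<Sum>j=1..<length K. m_coeff (take j K) * closed_coeff N (drop j K)
          / (fact (sum_list (take j K) - 1))\<^sup>2
          / (real (sum_list (drop j K)) * (real N - real (sum_list (drop j K)))))
     = closed_coeff N K"
proof -
  have Ks: "sum_list K = s" "\<forall>j\<in>set K. 1 \<le> j" "K \<noteq> []" using K by (auto simp: compositions_def)
  have mc: "m_coeff L / (fact (sum_list L - 1))\<^sup>2 = - real (sum_list L) * entry_weight L * link_weight L"
    if "1 \<le> sum_list L" for L
  proof -
    have "fact (sum_list L) = real (sum_list L) * fact (sum_list L - 1)"
      using that by (simp add: fact_reduce)
    then show ?thesis unfolding m_coeff_eq_weights by (simp add: power2_eq_square)
  qed
  have summand: "m_coeff (take j K) * closed_coeff N (drop j K) / (fact (sum_list (take j K) - 1))\<^sup>2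
          / (real (sum_list (drop j K)) * (real N - real (sum_list (drop j K))))
    = entry_weight K * link_weight K / (real N - real (last K)) *
        (real (sum_list (take j K)) * (real (last (take j K)) + real (hd (drop j K))))"
    if j: "j \<in> {1..<length K}" for j
  proof -
    let ?L = "take j K" and ?R = "drop j K"
    have ne: "?L \<noteq> []" "?R \<noteq> []" using j Ks by auto
    have KLR: "K = ?L @ ?R" by simp
    have sp: "sum_list ?L + sum_list ?R = s" using Ks(1) by (metis append_take_drop_id sum_list_append)
    have cL: "?L \<in> compositions (sum_list ?L)" "?R \<in> compositions (sum_list ?R)"
      using Ks(2) by (auto simp: compositions_def dest: in_set_takeD in_set_dropD)
    have p: "1 \<le> sum_list ?L" "1 \<le> sum_list ?R"
      using composition_pos[OF cL(1) ne(1)] composition_pos[OF cL(2) ne(2)] by auto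
    have lR: "last ?R = last K" using j by simp
    moreover have "last ?R \<le> sum_list ?R" by (rule last_le_sum_list[OF ne(2)])
    ultimately have lt: "sum_list ?R < N" "last K < N" using sp p K(3) by auto
    have cc: "closed_coeff N ?R / (real (sum_list ?R) * (real N - real (sum_list ?R)))
       = - entry_weight ?R * link_weight ?R / (real N - real (last K))"
    proof (cases "length ?R = 1")
      case True
      moreover have "sum_list L = last L" if "length L = 1" for L :: "nat list"
        using that by (cases L) auto
      ultimately have "sum_list ?R = last ?R" by blast
      then show ?thesis using True p lt lR by (simp add: closed_coeff_def)
    next
      case False
      define S where "S = sum_list ?R"
      have "S \<noteq> 0" "S < N" using p(2) lt(1) unfolding S_def[symmetric] by auto
      then show ?thesis using False lt lR unfolding closed_coeff_def S_def[symmetric] by simp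
    qed
    have hl: "real (last ?L) + real (hd ?R) \<noteq> 0"
    proof -
      have "last ?L \<in> set K" using ne(1) by (meson in_set_takeD last_in_set)
      then show ?thesis using Ks(2) by fastforce
    qed
    have "m_coeff ?L * closed_coeff N ?R / (fact (sum_list ?L - 1))\<^sup>2
          / (real (sum_list ?R) * (real N - real (sum_list ?R)))
      = m_coeff ?L / (fact (sum_list ?L - 1))\<^sup>2 * (closed_coeff N ?R / (real (sum_list ?R) * (real N - real (sum_list ?R))))"
      by simp
    also have "\<dots> = real (sum_list ?L) * (entry_weight ?L * entry_weight ?R) * (link_weight ?L * link_weight ?R)
         / (real N - real (last K))"
      unfolding mc[OF p(1)] cc by simp
    also have "entry_weight ?L * entry_weight ?R = entry_weight K"
      using entry_weight_append[of ?L ?R] by simp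
    also have "link_weight ?L * link_weight ?R = link_weight K * (real (last ?L) + real (hd ?R))"
      using link_weight_append[OF ne] hl by simp
    finally show ?thesis by simp
  qed
  have "(\<Sum>j=1..<length K. m_coeff (take j K) * closed_coeff N (drop j K)
          / (fact (sum_list (take j K) - 1))\<^sup>2
          / (real (sum_list (drop j K)) * (real N - real (sum_list (drop j K)))))
     = entry_weight K * link_weight K / (real N - real (last K)) * (real s * (real s - real (last K)))"
    by (rule trans[OF sum.cong[OF refl summand]])
       (simp_all only: sum_distrib_left[symmetric] sum_prefix_telescope[OF Ks(3)] Ks(1))
  moreover have "m_coeff K / (fact (s - 1))\<^sup>2 = - real s * entry_weight K * link_weight K"
    using mc[of K] K Ks by simp
  moreover have "- real s * entry_weight K * link_weight K
     + entry_weight K * link_weight K / (real N - real (last K)) * (real s * (real s - real (last K)))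
     = closed_coeff N K"
  proof (cases "length K = 1")
    case True
    then have "last K = s" using Ks by (cases K) auto
    then show ?thesis using True Ks by (simp add: closed_coeff_def)
  next
    case False
    then have "length K > 1" using Ks(3) by (cases K) auto
    then have "last K < N" using last_less_sum_list[OF K(1)] K(3) by auto
    then show ?thesis using False Ks by (simp add: closed_coeff_def field_simps)
  qed
  ultimately show ?thesis by simp
qed

lemma juhl_sum_m_sum:
  assumes E: "subspace E" and P: "\<And>j. 1 \<le> j \<Longrightarrow> linear_within E (P j)" and u: "u \<in> E"
    and s: "1 \<le> s" "s \<le> N"
  shows "juhl_sum N (m_sum P) s (\<lambda>a. m_sum P a u) = (\<Sum>K\<in>compositions s. closed_coeff N K *\<^sub>R op_comp P K u)"
  using s
proof (induction s rule: less_induct)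
  case (less s)
  let ?h = "\<lambda>s. juhl_sum N (m_sum P) s (\<lambda>a. m_sum P a u)"
  note lm = linear_within_m_sum[where P = P, OF E P]
  have oE: "op_comp P K v \<in> E" if "K \<in> compositions i" "v \<in> E" for K i v
    by (rule linear_withinD(1)[OF linear_within_op_comp[where P = P, OF E P] that(2)]) (use that(1) in \<open>auto simp: compositions_def\<close>)
  have lo: "linear_within E (op_comp P K)" if "K \<in> compositions i" for K i
    by (rule linear_within_op_comp[where P = P, OF E P]) (use that in \<open>auto simp: compositions_def\<close>)
  let ?d = "\<lambda>i. 1 / (fact (i - 1))\<^sup>2 / (real (s - i) * (real N - real (s - i)))"
  let ?g = "\<lambda>K L. (m_coeff K * closed_coeff N L / (fact (sum_list K - 1))\<^sup>2
          / (real (sum_list L) * (real N - real (sum_list L)))) *\<^sub>R op_comp P (K @ L) u"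
  have step: "?d i *\<^sub>R m_sum P i (?h (s - i))
     = (\<Sum>K\<in>compositions i. \<Sum>L\<in>compositions (s - i). ?g K L)" if i: "i \<in> {1..<s}" for i
  proof -
    have IH: "?h (s - i) = (\<Sum>L\<in>compositions (s - i). closed_coeff N L *\<^sub>R op_comp P L u)"
      using i less.prems by (intro less.IH) auto
    have "?d i *\<^sub>R m_sum P i (?h (s - i))
      = (\<Sum>K\<in>compositions i. ?d i *\<^sub>R m_coeff K *\<^sub>R op_comp P K (?h (s - i)))"
      by (simp add: m_sum_def scaleR_sum_right)
    also have "\<dots> = (\<Sum>K\<in>compositions i. \<Sum>L\<in>compositions (s - i). ?g K L)"
    proof (rule sum.cong[OF refl])
      fix K assume K: "K \<in> compositions i"
      have "op_comp P K (?h (s - i))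
        = (\<Sum>L\<in>compositions (s - i). op_comp P K (closed_coeff N L *\<^sub>R op_comp P L u))"
        unfolding IH by (rule linear_within_sum[OF E lo[OF K]]) (use oE u E in \<open>auto intro: subspace_scale\<close>)
      also have "\<dots> = (\<Sum>L\<in>compositions (s - i). closed_coeff N L *\<^sub>R op_comp P (K @ L) u)"
        by (rule sum.cong[OF refl])
           (simp add: linear_withinD(3)[OF lo[OF K] oE[OF _ u]] op_comp_append)
      finally show "?d i *\<^sub>R m_coeff K *\<^sub>R op_comp P K (?h (s - i)) = (\<Sum>L\<in>compositions (s - i). ?g K L)"
        using K by (auto simp: scaleR_sum_right compositions_def intro!: sum.cong)
    qed
    finally show ?thesis .
  qed
  have "?h s = (1 / (fact (s - 1))\<^sup>2) *\<^sub>R m_sum P s u + (\<Sum>i=1..<s. ?d i *\<^sub>R m_sum P i (?h (s - i)))"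
    by (rule juhl_sum_rec[OF E less.prems(1) lm]) (use linear_withinD(1)[OF lm u] in auto)
  also have "(\<Sum>i=1..<s. ?d i *\<^sub>R m_sum P i (?h (s - i))) = (\<Sum>K\<in>compositions s. \<Sum>j=1..<length K. ?g (take j K) (drop j K))"
    by (rule trans[OF sum.cong[OF refl step] sum_compositions_append])
  also have "(1 / (fact (s - 1))\<^sup>2) *\<^sub>R m_sum P s u + \<dots>
     = (\<Sum>K\<in>compositions s. (m_coeff K / (fact (s - 1))\<^sup>2) *\<^sub>R op_comp P K u
         + (\<Sum>j=1..<length K. ?g (take j K) (drop j K)))"
    by (simp add: m_sum_def scaleR_sum_right sum.distrib)
  also have "\<dots> = (\<Sum>K\<in>compositions s. closed_coeff N K *\<^sub>R op_comp P K u)"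
    by (rule sum.cong[OF refl])
       (simp add: closed_coeff_split_sum[OF _ less.prems, symmetric] scaleR_left_distrib scaleR_sum_left
          del: One_nat_def)
  finally show ?case .
qed

text \<open>At \<open>s = N\<close> only the composition \<open>(N)\<close> survives, because of the factor \<open>N - s\<close>.\<close>

lemma juhl_inversion:
  assumes E: "subspace E" and P: "\<And>j. 1 \<le> j \<Longrightarrow> linear_within E (P j)" and u: "u \<in> E" and N: "1 \<le> N"
  shows "(fact (N - 1))\<^sup>2 *\<^sub>R juhl_sum N (m_sum P) N (\<lambda>a. m_sum P a u) = P N u"
proof -
  have c0: "closed_coeff N K = 0" if "K \<in> compositions N - {[N]}" for K
  proof -
    have "length K \<noteq> 1" using that by (cases K) (auto simp: compositions_def)
    then show ?thesis using that by (simp add: closed_coeff_def compositions_def)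
  qed
  have mem: "[N] \<in> compositions N" using N by (simp add: compositions_def)
  have "juhl_sum N (m_sum P) N (\<lambda>a. m_sum P a u) = (\<Sum>K\<in>compositions N. closed_coeff N K *\<^sub>R op_comp P K u)"
    by (rule juhl_sum_m_sum[where P = P, OF E _ u N order_refl]) (rule P)
  also have "\<dots> = closed_coeff N [N] *\<^sub>R op_comp P [N] u"
    by (subst sum.remove[OF finite_compositions mem]) (simp_all add: c0)
  also have "closed_coeff N [N] = 1 / (fact (N - 1))\<^sup>2"
  proof -
    have "fact N = real N * fact (N - 1)" using N by (simp add: fact_reduce)
    then show ?thesis using N by (simp add: closed_coeff_def entry_weight_def power2_eq_square)
  qed
  finally show ?thesis by (simp add: op_comp_def)
qed

text \<open>Juhl's formula for \<open>P\<^sub>2\<^sub>N\<close> is triangular in the operators \<open>\<M>\<close>, so it has only one solution.\<close>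

lemma juhl_inversion_unique:
  assumes E: "subspace E" and P: "\<And>j. 1 \<le> j \<Longrightarrow> linear_within E (P j)"
    and T: "\<And>N u. 1 \<le> N \<Longrightarrow> u \<in> E \<Longrightarrow> P N u = (fact (N - 1))\<^sup>2 *\<^sub>R juhl_sum N T N (\<lambda>a. T a u)"
    and u: "u \<in> E" and N: "1 \<le> N"
  shows "T N u = m_sum P N u"
  using N u
proof (induction N arbitrary: u rule: less_induct)
  case (less N)
  have comp: "op_comp T I v = op_comp (m_sum P) I v \<and> op_comp (m_sum P) I v \<in> E"
    if "\<forall>j\<in>set I. 1 \<le> j \<and> j < N" "v \<in> E" for I v
    using that
  proof (induction I)
    case (Cons i I)
    then show ?case
      using less.IH[of i "op_comp (m_sum P) I v"] linear_withinD(1)[OF linear_within_m_sum[where P = P, OF E P]]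
      by (simp add: op_comp_Cons)
  qed (simp add: op_comp_def)
  (* all terms but the one for the empty list contain only operators of lower order *)
  have low: "(nu N (I @ [a])) *\<^sub>R op_comp T I (T a u) = (nu N (I @ [a])) *\<^sub>R op_comp (m_sum P) I (m_sum P a u)"
    if "(I, a) \<in> splittings N - {([], N)}" for I a
  proof -
    have I: "I \<noteq> []" "1 \<le> a" "\<forall>j\<in>set I. 1 \<le> j \<and> j < N" "sum_list I + a = N"
      using that splittings_le[of I a N] by (auto simp: splittings_def compositions_def)
    then have "a < N" by (cases I) auto
    have "m_sum P a u \<in> E" using linear_withinD(1)[OF linear_within_m_sum[where P = P, OF E P] less.prems(2)] .
    then show ?thesis using comp[OF I(3)] less.IH[OF \<open>a < N\<close> I(2) less.prems(2)] by simp
  qed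
  have mem: "([], N) \<in> splittings N" using less.prems by (simp add: splittings_def)
  have "juhl_sum N T N (\<lambda>a. T a u) = juhl_sum N (m_sum P) N (\<lambda>a. m_sum P a u)"
    using T[OF less.prems] juhl_inversion[where P = P, OF E P less.prems(2,1)] by simp
  moreover have "(\<Sum>x\<in>splittings N - {([], N)}. case x of (I, a) \<Rightarrow> nu N (I @ [a]) *\<^sub>R op_comp T I (T a u))
     = (\<Sum>x\<in>splittings N - {([], N)}. case x of (I, a) \<Rightarrow> nu N (I @ [a]) *\<^sub>R op_comp (m_sum P) I (m_sum P a u))"
    by (intro sum.cong refl) (metis (no_types, lifting) low case_prod_conv surj_pair)
  ultimately show ?case
    unfolding juhl_sum_def sum.remove[OF finite_splittings mem] by (simp add: op_comp_def)
qed

subsection \<open>The operators \<open>-2\<rho>\<partial>\<^sub>\<rho>\<^sup>2 + 2c\<partial>\<^sub>\<rho> + M(\<rho>)\<close> on formal power series\<close>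

text \<open>The factor of the coefficient \<open>V (Suc k)\<close> is the contribution \<open>-2 k (k + 1) + 2 c (k + 1)\<close> of the
  derivatives. In \<open>dops M c j\<close> the parameters are \<open>c, c - 2, c - 4, \<dots>\<close>, in the order of
  application.\<close>

definition dop :: "(nat \<Rightarrow> 'v \<Rightarrow> 'v) \<Rightarrow> real \<Rightarrow> (nat \<Rightarrow> 'v) \<Rightarrow> nat \<Rightarrow> 'v::real_vector" where
  "dop M c V k = (2 * real (Suc k) * (c - real k)) *\<^sub>R V (Suc k) + (\<Sum>i\<le>k. M i (V (k - i)))"

primrec dops :: "(nat \<Rightarrow> 'v \<Rightarrow> 'v) \<Rightarrow> real \<Rightarrow> nat \<Rightarrow> (nat \<Rightarrow> 'v) \<Rightarrow> nat \<Rightarrow> 'v::real_vector" where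
  "dops M c 0 V = V"
| "dops M c (Suc j) V = dop M (c - 2 * real j) (dops M c j V)"

abbreviation rho_times :: "(nat \<Rightarrow> 'v::zero) \<Rightarrow> nat \<Rightarrow> 'v" where
  "rho_times R \<equiv> case_nat 0 R"

lemma dops_front: "dops M c (Suc j) V = dops M (c - 2) j (dop M c V)"
  by (induction j) (auto simp: algebra_simps)

context
  fixes E :: "'v::real_vector set" and M :: "nat \<Rightarrow> 'v \<Rightarrow> 'v"
  assumes E: "subspace E" and M: "\<And>i. linear_within E (M i)"
begin

lemma dop_in:
  assumes "\<And>k. V k \<in> E" shows "dop M c V k \<in> E"
  unfolding dop_def
  by (intro subspace_add[OF E] subspace_scale[OF E] subspace_sum[OF E] linear_withinD(1)[OF M] assms)

lemma dops_in:
  assumes "\<And>k. V k \<in> E" shows "dops M c j V k \<in> E"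
proof (induction j arbitrary: k)
  case (Suc j)
  then show ?case by (simp add: dop_in)
qed (simp add: assms)

lemma dop_add:
  assumes "\<And>k. V k \<in> E" "\<And>k. W k \<in> E"
  shows "dop M c (\<lambda>k. V k + W k) = (\<lambda>k. dop M c V k + dop M c W k)"
  by (rule ext) (simp add: dop_def linear_withinD(2)[OF M assms] sum.distrib scaleR_right_distrib)

lemma dop_scale:
  assumes "\<And>k. V k \<in> E"
  shows "dop M c (\<lambda>k. a *\<^sub>R V k) = (\<lambda>k. a *\<^sub>R dop M c V k)"
  by (rule ext) (simp add: dop_def linear_withinD(3)[OF M assms] scaleR_sum_right scaleR_right_distrib mult.commute)

lemma dops_add:
  assumes "\<And>k. V k \<in> E" "\<And>k. W k \<in> E"
  shows "dops M c j (\<lambda>k. V k + W k) = (\<lambda>k. dops M c j V k + dops M c j W k)"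
  by (induction j) (simp_all add: dop_add dops_in assms)

lemma dops_scale:
  assumes "\<And>k. V k \<in> E"
  shows "dops M c j (\<lambda>k. a *\<^sub>R V k) = (\<lambda>k. a *\<^sub>R dops M c j V k)"
  by (induction j) (simp_all add: dop_scale dops_in assms)

lemma dops_zero: "dops M c j (\<lambda>k. 0) = (\<lambda>k. 0)"
  using dops_scale[of "\<lambda>k. 0" c j 0] subspace_0[OF E] by simp

text \<open>Multiplication by \<open>\<rho>\<close> lowers the parameter by 2, up to a multiple of the identity.\<close>

lemma dop_rho_times:
  assumes "\<And>k. R k \<in> E"
  shows "dop M c (rho_times R) = (\<lambda>k. rho_times (dop M (c - 2) R) k + (2 * c) *\<^sub>R R k)"
proof
  fix k
  have M0: "M i 0 = 0" for i by (rule linear_within_0[OF E M])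
  show "dop M c (rho_times R) k = rho_times (dop M (c - 2) R) k + (2 * c) *\<^sub>R R k"
  proof (cases k)
    case 0
    then show ?thesis by (simp add: dop_def M0)
  next
    case (Suc m)
    have "(\<Sum>i\<le>Suc m. M i (rho_times R (Suc m - i))) = (\<Sum>i\<le>m. M i (R (m - i)))"
      by (simp add: M0 Suc_diff_le)
    moreover have "2 * real (Suc (Suc m)) * (c - real (Suc m)) = 2 * real (Suc m) * (c - 2 - real m) + 2 * c"
      by (simp add: algebra_simps)
    ultimately show ?thesis
      by (simp only: Suc dop_def nat.case scaleR_left_distrib) (simp only: add.assoc add.commute add.left_commute)
  qed
qed

lemma dops_rho_times:
  assumes R: "\<And>k. R k \<in> E"
  shows "dops M c j (rho_times R) =
    (\<lambda>k. rho_times (dops M (c - 2) j R) k + (\<Sum>i<j. 2 * (c - 2 * real i)) *\<^sub>R dops M (c - 2) (j - 1) R k)"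
proof (induction j)
  case (Suc j)
  let ?K = "\<Sum>i<j. 2 * (c - 2 * real i)"
  have in1: "rho_times (dops M (c - 2) j R) k \<in> E" for k
    using dops_in[OF R] subspace_0[OF E] by (cases k) auto
  have in2: "?K *\<^sub>R dops M (c - 2) (j - 1) R k \<in> E" for k
    by (intro subspace_scale[OF E] dops_in R)
  have K: "dop M (c - 2 * real j) (\<lambda>k. ?K *\<^sub>R dops M (c - 2) (j - 1) R k) = (\<lambda>k. ?K *\<^sub>R dops M (c - 2) j R k)"
  proof (cases j)
    case 0
    then show ?thesis by (simp add: dop_def linear_within_0[OF E M] fun_eq_iff)
  next
    case (Suc m)
    then have "c - 2 * real j = c - 2 - 2 * real m" by simp
    then have "dops M (c - 2) j R = dop M (c - 2 * real j) (dops M (c - 2) (j - 1) R)"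
      by (simp only: Suc diff_Suc_1 dops.simps)
    then show ?thesis by (simp only: dop_scale[OF dops_in[OF R]])
  qed
  have c: "c - 2 * real j - 2 = c - 2 - 2 * real j" by simp
  show ?case
    unfolding dops.simps Suc.IH dop_add[OF in1 in2] K dop_rho_times[OF dops_in[OF R]] c
      sum.lessThan_Suc diff_Suc_1 scaleR_left_distrib
    by (simp only: add.assoc add.commute add.left_commute)
qed (unfold dops.simps, simp)

text \<open>The parameters \<open>N - 1, N - 3, \<dots>, 1 - N\<close> sum to zero, so the product of the \<open>N\<close>
  operators commutes with multiplication by \<open>\<rho>\<close> up to a shift of the parameters, and its value
  at \<open>\<rho> = 0\<close> depends on the value at \<open>\<rho> = 0\<close> only.\<close>

lemma dops_depends_on_0:
  assumes V: "\<And>k. V k \<in> E" and W: "\<And>k. W k \<in> E" and eq: "V 0 = W 0"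
  shows "dops M (real N - 1) N V 0 = dops M (real N - 1) N W 0"
proof -
  (* V - W is divisible by \<rho> *)
  define R where "R k = V (Suc k) - W (Suc k)" for k
  have R: "R k \<in> E" for k unfolding R_def by (intro subspace_diff[OF E] V W)
  have Vd: "V = (\<lambda>k. W k + rho_times R k)"
    using eq by (auto simp: fun_eq_iff R_def split: nat.split)
  have inR: "rho_times R k \<in> E" for k using R subspace_0[OF E] by (cases k) auto
  have "(\<Sum>i<n. 2 * (c - 2 * real i)) = 2 * real n * (c - (real n - 1))" for c and n :: nat
    by (induction n) (auto simp: algebra_simps)
  from this[of "real N - 1" N] have s0: "(\<Sum>i<N. 2 * (real N - 1 - 2 * real i)) = 0" by simp
  show ?thesis
    by (subst Vd) (simp only: dops_add[OF W inR] dops_rho_times[OF R] s0, simp)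
qed

text \<open>Each factor lowers the order of vanishing at \<open>\<rho> = 0\<close> by exactly one, and only the derivatives
  contribute to the leading coefficient.\<close>

lemma dops_leading:
  assumes f: "\<And>k. f k \<in> E" "\<And>k. k < m \<Longrightarrow> f k = 0" and "j \<le> m"
  shows "(\<forall>k<m - j. dops M c j f k = 0) \<and>
    dops M c j f (m - j) = (\<Prod>i<j. 2 * real (m - i) * (c - real i - real m + 1)) *\<^sub>R f m"
  using assms(3)
proof (induction j)
  case (Suc j)
  then have IH: "\<And>k. k < m - j \<Longrightarrow> dops M c j f k = 0"
    "dops M c j f (m - j) = (\<Prod>i<j. 2 * real (m - i) * (c - real i - real m + 1)) *\<^sub>R f m" by auto
  have low: "(\<Sum>i\<le>k. M i (dops M c j f (k - i))) = 0" if "k \<le> m - Suc j" for k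
    using that Suc.prems by (intro sum.neutral) (auto simp: IH(1) linear_within_0[OF E M])
  have mj: "Suc (m - Suc j) = m - j" using Suc.prems by simp
  have rj: "real (m - Suc j) = real m - real j - 1" using Suc.prems by simp
  show ?case
    using low IH(1) Suc.prems unfolding dops.simps dop_def mj
    by (auto simp: IH(2) rj algebra_simps)
qed (use f in auto)

text \<open>The expansion \<open>F\<close> below solves the equation with parameter \<open>N - 1\<close> and right-hand side \<open>f\<close>
  up to order \<open>N - 2\<close> in \<open>\<rho>\<close>. Its coefficients are the partial sums in Juhl's formulas, and the
  coefficient of \<open>\<rho>\<^sup>N\<^sup>-\<^sup>1\<close>, at which the recursion is obstructed, carries the full sum.\<close>

lemma formal_juhl:
  assumes f: "\<And>k. f k \<in> E" and u: "u \<in> E" and V: "\<And>k. V k \<in> E" "V 0 = u" and N: "1 \<le> N"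
  defines "T \<equiv> \<lambda>j v. ((fact (j - 1))\<^sup>2 * (- 2) ^ (j - 1)) *\<^sub>R M (j - 1) v"
    and "y \<equiv> \<lambda>a. ((fact (a - 1))\<^sup>2 * (- 2) ^ (a - 1)) *\<^sub>R (M (a - 1) u - f (a - 1))"
  shows "dops M (real N - 3) (N - 1) f 0 = dops M (real N - 1) N V 0 - (fact (N - 1))\<^sup>2 *\<^sub>R juhl_sum N T N y"
proof -
  let ?h = "\<lambda>s. juhl_sum N T s y"
  have lT: "linear_within E (T j)" for j
    unfolding T_def linear_within_def using linear_withinD[OF M]
    by (auto simp: scaleR_right_distrib mult.commute intro!: subspace_scale[OF E])
  have yE: "y a \<in> E" for a
    unfolding y_def by (intro subspace_scale[OF E] subspace_diff[OF E] linear_withinD(1)[OF M u] f)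
  have hE: "?h s \<in> E" for s
    unfolding juhl_sum_def case_prod_unfold
    by (intro subspace_sum[OF E] subspace_scale[OF E] linear_withinD(1)[OF linear_within_op_comp[OF E lT]] yE)
  define F where "F s = (if s = 0 then u else (inverse ((- 2) ^ s) / (real s * (real N - real s))) *\<^sub>R ?h s)" for s
  have FE: "F s \<in> E" for s unfolding F_def using u hE by (auto intro: subspace_scale[OF E])
  (* up to normalization, the recursion for juhl_sum is the one for the coefficients of F *)
  have rec: "(\<Sum>i\<le>k. M i (F (k - i))) = inverse ((- 2) ^ k) *\<^sub>R ?h (Suc k) + f k" for k
  proof -
    have "(\<Sum>i\<le>k. M i (F (k - i))) = (\<Sum>i<k. M i (F (k - i))) + M k u"
      by (simp add: lessThan_Suc_atMost[symmetric] F_def)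
    also have "(\<Sum>i<k. M i (F (k - i))) = (\<Sum>i=1..<Suc k. M (i - 1) (F (Suc k - i)))"
      by (rule sum.reindex_bij_witness[where i = "\<lambda>i. i - 1" and j = Suc]) auto
    also have "\<dots> = (\<Sum>i=1..<Suc k. inverse ((- 2) ^ k) *\<^sub>R (1 / (fact (i - 1))\<^sup>2 / (real (Suc k - i) * (real N - real (Suc k - i))))
         *\<^sub>R T i (?h (Suc k - i)))"
    proof (rule sum.cong[OF refl])
      fix i assume i: "i \<in> {1..<Suc k}"
      have pw: "inverse ((- 2) ^ k) * (- 2) ^ (i - 1) = inverse ((- 2 :: real) ^ (Suc k - i))"
      proof -
        have "k = (i - 1) + (Suc k - i)" using i by simp
        then have "(- 2 :: real) ^ k = (- 2) ^ (i - 1) * (- 2) ^ (Suc k - i)" by (metis power_add)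
        then show ?thesis by simp
      qed
      have "M (i - 1) (F (Suc k - i)) = (inverse ((- 2) ^ (Suc k - i)) / (real (Suc k - i) * (real N - real (Suc k - i)))) *\<^sub>R
          M (i - 1) (?h (Suc k - i))"
        using i by (simp add: F_def linear_withinD(3)[OF M hE] del: of_nat_Suc)
      then show "M (i - 1) (F (Suc k - i)) = inverse ((- 2) ^ k) *\<^sub>R (1 / (fact (i - 1))\<^sup>2 / (real (Suc k - i) * (real N - real (Suc k - i))))
         *\<^sub>R T i (?h (Suc k - i))"
        unfolding pw[symmetric] T_def scaleR_scaleR by simp
    qed
    also have "M k u = inverse ((- 2) ^ k) *\<^sub>R (1 / (fact k)\<^sup>2) *\<^sub>R y (Suc k) + f k"
      by (simp add: y_def)
    finally show ?thesis
      using juhl_sum_rec[OF E _ lT yE, of "Suc k" N] by (simp add: scaleR_right_distrib scaleR_sum_right algebra_simps)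
  qed
  (* the defect of F, which starts with the power N - 1 of \<rho> *)
  define g where "g k = f k - dop M (real N - 1) F k" for k
  have gE: "g k \<in> E" for k unfolding g_def by (intro subspace_diff[OF E] f dop_in FE)
  have g0: "g k = 0" if "k < N - 1" for k
  proof -
    have "2 * real (Suc k) * (real N - 1 - real k) * (inverse ((- 2) ^ Suc k) / (real (Suc k) * (real N - real (Suc k))))
      = - inverse ((- 2) ^ k)"
    proof -
      have "2 * a * b * (inverse ((- 2) * p) / (a * b)) = - inverse p" if "a \<noteq> 0" "b \<noteq> 0" for a b p :: real
        using that by simp
      from this[of "real (Suc k)" "real N - 1 - real k" "(- 2) ^ k"] that
      show ?thesis by (simp add: algebra_simps)
    qed
    then show ?thesis
      unfolding g_def dop_def rec by (simp add: F_def del: of_nat_Suc power_Suc)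
  qed
  have gN: "g (N - 1) = - inverse ((- 2) ^ (N - 1)) *\<^sub>R ?h N"
    unfolding g_def dop_def rec using N by simp
  have "dops M (real N - 3) (N - 1) g 0 = ((- 2) ^ (N - 1) * (fact (N - 1))\<^sup>2) *\<^sub>R g (N - 1)"
  proof -
    have "(\<Prod>i<n. 2 * real (n - i) * (real n - 2 - real i - real n + 1)) = (- 2) ^ n * (fact n)\<^sup>2" for n
    proof -
      have "(\<Prod>i<n. real (n - i)) = fact n"
        unfolding fact_prod_rev by (simp add: atLeast0LessThan)
      moreover have "(\<Prod>i<n. real (Suc i)) = fact n"
        unfolding fact_prod_Suc by (simp add: atLeast0LessThan)
      moreover have "(\<Prod>i<n. 2 * real (n - i) * (real n - 2 - real i - real n + 1))
        = (\<Prod>i<n. (- 2) * real (n - i) * real (Suc i))"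
        by (rule prod.cong) (auto simp: algebra_simps)
      moreover have "\<dots> = (- 2) ^ n * (\<Prod>i<n. real (n - i)) * (\<Prod>i<n. real (Suc i))"
        by (simp only: prod.distrib prod_constant card_lessThan)
      ultimately show ?thesis by (simp only: power2_eq_square mult.assoc)
    qed
    from this[of "N - 1"] show ?thesis
      using dops_leading[where f = g and m = "N - 1" and j = "N - 1" and c = "real N - 3", OF gE g0] N
      by (simp add: of_nat_diff)
  qed
  also have "\<dots> = - (fact (N - 1))\<^sup>2 *\<^sub>R ?h N" unfolding gN by simp
  finally have Tg: "dops M (real N - 3) (N - 1) g 0 = - (fact (N - 1))\<^sup>2 *\<^sub>R ?h N" .
  have fg: "f = (\<lambda>k. dop M (real N - 1) F k + g k)" by (simp add: g_def)
  have "dops M (real N - 3) (N - 1) f 0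
      = dops M (real N - 3) (N - 1) (dop M (real N - 1) F) 0 + dops M (real N - 3) (N - 1) g 0"
    by (subst fg) (simp only: dops_add[OF dop_in[OF FE] gE])
  also have "dops M (real N - 3) (N - 1) (dop M (real N - 1) F) 0 = dops M (real N - 1) N F 0"
    using dops_front[of M "real N - 1" "N - 1" F] N by (simp add: algebra_simps)
  also have "\<dots> = dops M (real N - 1) N V 0"
    by (rule dops_depends_on_0[OF FE V(1)]) (simp add: F_def V(2))
  finally show ?thesis unfolding Tg by simp
qed

end

section \<open>Taylor expansion in the parameter of the metric family\<close>

instantiation "fun" :: (type, real_vector) real_vector
begin

definition scaleR_fun :: "real \<Rightarrow> ('a \<Rightarrow> 'b) \<Rightarrow> 'a \<Rightarrow> 'b" where
  "scaleR_fun c f = (\<lambda>x. c *\<^sub>R f x)"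

instance
  by standard (simp_all add: scaleR_fun_def fun_eq_iff scaleR_add_right scaleR_add_left)

end

lemma scaleR_fun_apply [simp]: "(c *\<^sub>R f) x = c *\<^sub>R f x"
  by (simp add: scaleR_fun_def)

lemma sum_fun_apply: "(\<Sum>i\<in>I. f i) x = (\<Sum>i\<in>I. f i x)"
  by (induction I rule: infinite_finite_induct) auto

lemma smooth_on_metric_trace_deriv:
  assumes "open S" "metric_on S G"
  shows "smooth_on S (\<lambda>x. metric_trace (G x) (metric_deriv G x h))"
  unfolding metric_trace_def
  by (intro smooth_intros assms metric_onD(2)[OF assms(2)] linear_metric_deriv(1)[OF assms(1) _ assms(2)])

locale chart_family =
  fixes \<Omega> :: "'e::euclidean_space set" and J :: "real set" and H :: "'e \<times> real \<Rightarrow> 'e form2"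
  assumes Omega: "open \<Omega>" and J: "open J" "0 \<in> J" and H: "metric_on (\<Omega> \<times> J) H"
begin

abbreviation W :: "('e \<times> real) set" where "W \<equiv> \<Omega> \<times> J"

lemma open_W: "open W" by (intro open_Times Omega J)

lemmas smooth_W = smooth_intros open_W

text \<open>Functions on \<open>\<Omega>\<close> are extended by zero. In this way the smooth ones form a subspace \<open>E\<close> of the
  vector space of all functions, and equality on \<open>\<Omega>\<close> becomes equality.\<close>

definition restr :: "('e \<Rightarrow> real) \<Rightarrow> 'e \<Rightarrow> real" where
  "restr u = (\<lambda>x. if x \<in> \<Omega> then u x else 0)"

definition E :: "('e \<Rightarrow> real) set" where
  "E = {u. smooth_on \<Omega> u \<and> (\<forall>x. x \<notin> \<Omega> \<longrightarrow> u x = 0)}"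

lemma restr_in_E: "smooth_on \<Omega> u \<Longrightarrow> restr u \<in> E"
  using smooth_on_cong[OF Omega, of "restr u" u] by (auto simp: E_def restr_def)

lemma subspace_E: "subspace E"
  unfolding subspace_def E_def
proof (intro conjI ballI allI CollectI; (elim CollectE conjE)?)
  show "smooth_on \<Omega> 0" unfolding zero_fun_def by (intro smooth_intros Omega)
  fix u v :: "'e \<Rightarrow> real" and c
  assume "smooth_on \<Omega> u"
  then show "smooth_on \<Omega> (c *\<^sub>R u)" unfolding scaleR_fun_def by (intro smooth_intros Omega)
  assume "smooth_on \<Omega> v"
  with \<open>smooth_on \<Omega> u\<close> show "smooth_on \<Omega> (u + v)" unfolding plus_fun_def by (intro smooth_intros Omega)
qed auto

lemma smooth_funpow_d\<rho>: "smooth_on W U \<Longrightarrow> smooth_on W ((d\<rho> ^^ k) U)"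
  by (induction k) (auto intro: smooth_intros)

lemma funpow_d\<rho>_cong:
  assumes "\<And>z. z \<in> W \<Longrightarrow> U z = V z" "z \<in> W"
  shows "(d\<rho> ^^ k) U z = (d\<rho> ^^ k) V z"
  using assms(2)
proof (induction k arbitrary: z)
  case (Suc k)
  then show ?case using frechet_derivative_cong_open(1)[OF open_W Suc.prems Suc.IH] by simp
qed (use assms in auto)

text \<open>Taylor coefficients at \<open>\<rho> = 0\<close>.\<close>

definition tay :: "nat \<Rightarrow> ('e \<times> real \<Rightarrow> real) \<Rightarrow> 'e \<Rightarrow> real" where
  "tay k U = restr (\<lambda>x. (d\<rho> ^^ k) U (x, 0) / fact k)"

lemma smooth_slice0: "smooth_on W F \<Longrightarrow> smooth_on \<Omega> (\<lambda>x. F (x, 0))"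
  by (rule smooth_on_compose[OF Omega open_W, where f = "\<lambda>x. (x, 0)"])
     (use J in \<open>auto intro!: smooth_on_Pair smooth_on_ident smooth_on_const Omega\<close>)

lemma tay_in_E: "smooth_on W U \<Longrightarrow> tay k U \<in> E"
  unfolding tay_def
  by (rule restr_in_E, rule smooth_slice0[where F = "\<lambda>z. (d\<rho> ^^ k) U z / fact k"])
     (auto intro!: smooth_on_divide open_W smooth_on_const smooth_funpow_d\<rho>)

lemma tay_cong: "(\<And>z. z \<in> W \<Longrightarrow> U z = V z) \<Longrightarrow> tay k U = tay k V"
  unfolding tay_def restr_def using funpow_d\<rho>_cong[of U V] J(2) by auto

lemma tay_d\<rho>: "tay k (d\<rho> U) = real (Suc k) *\<^sub>R tay (Suc k) U"
proof -
  have "(d\<rho> ^^ Suc k) U = (d\<rho> ^^ k) (d\<rho> U)" by (simp only: funpow_Suc_right o_apply)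
  then show ?thesis
    by (auto simp: tay_def restr_def fun_eq_iff field_simps simp del: of_nat_Suc funpow.simps)
qed

lemma tay_add:
  assumes "smooth_on W U" "smooth_on W V"
  shows "tay k (\<lambda>z. U z + V z) = tay k U + tay k V"
proof -
  have "(d\<rho> ^^ k) (\<lambda>z. U z + V z) z = (d\<rho> ^^ k) U z + (d\<rho> ^^ k) V z" if "z \<in> W" for z
    using that
  proof (induction k arbitrary: z)
    case (Suc k)
    have "d\<rho> ((d\<rho> ^^ k) (\<lambda>z. U z + V z)) z = d\<rho> (\<lambda>z. (d\<rho> ^^ k) U z + (d\<rho> ^^ k) V z) z"
      by (rule fun_cong[OF frechet_derivative_cong_open(1)[OF open_W Suc.prems Suc.IH]])
    then show ?case
      using frechet_derivative_at[OF has_derivative_add[OF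
          smooth_on_has_derivative[OF smooth_funpow_d\<rho>[OF assms(1)] Suc.prems]
          smooth_on_has_derivative[OF smooth_funpow_d\<rho>[OF assms(2)] Suc.prems]], symmetric] by simp
  qed simp
  then show ?thesis using J(2) by (auto simp: tay_def restr_def fun_eq_iff add_divide_distrib)
qed

text \<open>The Leibniz rule, by induction on \<open>k\<close> from \<open>(k + 1) (a U)\<^bsub>k+1\<^esub> = (a U' + a' U)\<^sub>k\<close>.\<close>

lemma tay_mult:
  assumes "smooth_on W a" "smooth_on W U"
  shows "tay k (\<lambda>z. a z * U z) x = (\<Sum>i\<le>k. tay i a x * tay (k - i) U x)"
  using assms
proof (induction k arbitrary: a U)
  case 0
  then show ?case by (simp add: tay_def restr_def)
next
  case (Suc k)
  let ?a = "\<lambda>i. tay i a x" and ?U = "\<lambda>i. tay i U x"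
  note sm = Suc.prems
  have "tay k (d\<rho> (\<lambda>z. a z * U z)) = tay k (\<lambda>z. a z * d\<rho> U z + d\<rho> a z * U z)"
    by (rule tay_cong) (simp add: frechet_derivative_at[OF has_derivative_mult[OF
        smooth_on_has_derivative[OF sm(1)] smooth_on_has_derivative[OF sm(2)]], symmetric])
  also have "\<dots> = tay k (\<lambda>z. a z * d\<rho> U z) + tay k (\<lambda>z. d\<rho> a z * U z)"
    by (rule tay_add) (intro smooth_W sm)+
  finally have "real (Suc k) * tay (Suc k) (\<lambda>z. a z * U z) x
     = tay k (\<lambda>z. a z * d\<rho> U z) x + tay k (\<lambda>z. d\<rho> a z * U z) x"
    by (simp add: tay_d\<rho> fun_eq_iff)
  also have "tay k (\<lambda>z. a z * d\<rho> U z) x = (\<Sum>i\<le>k. ?a i * tay (k - i) (d\<rho> U) x)"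
    by (rule Suc.IH) (intro smooth_W sm)+
  also have "\<dots> = (\<Sum>i\<le>k. real (Suc k - i) * (?a i * ?U (Suc k - i)))"
    by (rule sum.cong) (auto simp: tay_d\<rho> Suc_diff_le)
  also have "\<dots> = (\<Sum>i\<le>Suc k. real (Suc k - i) * (?a i * ?U (Suc k - i)))" by simp
  also have "tay k (\<lambda>z. d\<rho> a z * U z) x = (\<Sum>i\<le>k. tay i (d\<rho> a) x * ?U (k - i))"
    by (rule Suc.IH) (intro smooth_W sm)+
  also have "\<dots> = (\<Sum>i\<le>k. real (Suc i) * (?a (Suc i) * ?U (Suc k - Suc i)))"
    by (simp add: tay_d\<rho> mult.assoc)
  also have "\<dots> = (\<Sum>i\<le>Suc k. real i * (?a i * ?U (Suc k - i)))"
    by (subst sum.atMost_Suc_shift) simp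
  also have "(\<Sum>i\<le>Suc k. real (Suc k - i) * (?a i * ?U (Suc k - i))) + \<dots>
      = (\<Sum>i\<le>Suc k. real (Suc k) * (?a i * ?U (Suc k - i)))"
    unfolding sum.distrib[symmetric] by (rule sum.cong) (auto simp: of_nat_diff algebra_simps)
  finally have "real (Suc k) * tay (Suc k) (\<lambda>z. a z * U z) x = real (Suc k) * (\<Sum>i\<le>Suc k. ?a i * ?U (Suc k - i))"
    by (simp only: sum_distrib_left)
  then show ?case by (simp only: mult_cancel_left of_nat_eq_0_iff nat.distinct simp_thms)
qed

text \<open>\<open>rho_op T C\<close>: the operator \<open>T\<close> on smooth functions of \<open>(x, \<rho>)\<close> has the expansion
  \<open>\<Sum> \<rho>\<^sup>i C i\<close> with operators \<open>C i\<close> on smooth functions of \<open>x\<close>.\<close>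

definition rho_op ::
  "(('e \<times> real \<Rightarrow> real) \<Rightarrow> 'e \<times> real \<Rightarrow> real) \<Rightarrow> (nat \<Rightarrow> ('e \<Rightarrow> real) \<Rightarrow> 'e \<Rightarrow> real) \<Rightarrow> bool" where
  "rho_op T C \<longleftrightarrow> (\<forall>i. linear_within E (C i)) \<and>
     (\<forall>U. smooth_on W U \<longrightarrow> smooth_on W (T U) \<and>
        (\<forall>k. tay k (T U) = (\<Sum>i\<le>k. C i (tay (k - i) U))))"

lemma rho_opD:
  assumes "rho_op T C"
  shows "linear_within E (C i)" "smooth_on W U \<Longrightarrow> smooth_on W (T U)"
    "smooth_on W U \<Longrightarrow> tay k (T U) = (\<Sum>i\<le>k. C i (tay (k - i) U))"
  using assms by (auto simp: rho_op_def)

lemma rho_op_cong: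
  assumes "rho_op T C" "\<And>U z. smooth_on W U \<Longrightarrow> z \<in> W \<Longrightarrow> T' U z = T U z"
  shows "rho_op T' C"
  unfolding rho_op_def using assms(1) smooth_on_cong[OF open_W assms(2)] tay_cong[OF assms(2)]
  by (simp add: rho_op_def)

lemma rho_op_mult:
  assumes "smooth_on W a"
  shows "rho_op (\<lambda>U z. a z * U z) (\<lambda>i u x. tay i a x * u x)"
  unfolding rho_op_def
proof (intro conjI allI impI)
  fix i
  show "linear_within E (\<lambda>u x. tay i a x * u x)"
    unfolding linear_within_def
  proof (intro conjI ballI allI)
    fix u assume "u \<in> E"
    then show "(\<lambda>x. tay i a x * u x) \<in> E"
      using tay_in_E[OF assms] by (auto simp: E_def intro!: smooth_intros Omega)
  qed (auto simp: fun_eq_iff algebra_simps)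
qed (auto simp: fun_eq_iff sum_fun_apply tay_mult assms intro!: smooth_W)

lemma slice_frechet_derivative:
  assumes "smooth_on W F" "x \<in> \<Omega>"
  shows "frechet_derivative (\<lambda>x. F (x, 0)) (at x) v = frechet_derivative F (at (x, 0)) (v, 0)"
  using fun_cong[OF frechet_derivative_at[OF slice_derivative(1)[OF assms(1), of x 0]], of v] assms J by simp

text \<open>Derivatives in the directions of \<open>x\<close> commute with \<open>\<partial>\<^sub>\<rho>\<close>, so their expansion has a constant term
  only.\<close>

lemma rho_op_derivative:
  "rho_op (\<lambda>U z. frechet_derivative U (at z) (v, 0))
     (\<lambda>i u. if i = 0 then restr (\<lambda>x. frechet_derivative u (at x) v) else 0)"
  unfolding rho_op_def
proof (intro conjI allI impI)
  fix i
  show "linear_within E (\<lambda>u. if i = 0 then restr (\<lambda>x. frechet_derivative u (at x) v) else 0)"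
    unfolding linear_within_def
  proof (intro conjI ballI allI)
    fix u c assume u: "u \<in> E"
    then have su: "smooth_on \<Omega> u" by (simp add: E_def)
    show "(if i = 0 then restr (\<lambda>x. frechet_derivative u (at x) v) else 0) \<in> E"
      using subspace_0[OF subspace_E] by (auto intro!: restr_in_E smooth_intros su)
    have "frechet_derivative (c *\<^sub>R u) (at x) v = c * frechet_derivative u (at x) v" if "x \<in> \<Omega>" for x
      using frechet_derivative_at[OF has_derivative_scaleR_right[OF smooth_on_has_derivative[OF su that]], symmetric]
      by (simp add: scaleR_fun_def)
    then show "(if i = 0 then restr (\<lambda>x. frechet_derivative (c *\<^sub>R u) (at x) v) else 0)
      = c *\<^sub>R (if i = 0 then restr (\<lambda>x. frechet_derivative u (at x) v) else 0)"
      by (auto simp: restr_def fun_eq_iff)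
    fix u' assume "u' \<in> E"
    then have su': "smooth_on \<Omega> u'" by (simp add: E_def)
    have "frechet_derivative (u + u') (at x) v = frechet_derivative u (at x) v + frechet_derivative u' (at x) v"
      if "x \<in> \<Omega>" for x
      using frechet_derivative_at[OF has_derivative_add[OF smooth_on_has_derivative[OF su that]
           smooth_on_has_derivative[OF su' that]], symmetric]
      by (simp add: plus_fun_def)
    then show "(if i = 0 then restr (\<lambda>x. frechet_derivative (u + u') (at x) v) else 0)
      = (if i = 0 then restr (\<lambda>x. frechet_derivative u (at x) v) else 0)
       + (if i = 0 then restr (\<lambda>x. frechet_derivative u' (at x) v) else 0)"
      by (auto simp: restr_def fun_eq_iff)
  qed
next
  fix U :: "'e \<times> real \<Rightarrow> real" and k
  assume U: "smooth_on W U"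
  show "smooth_on W (\<lambda>z. frechet_derivative U (at z) (v, 0))" by (intro smooth_W U)
  have com: "(d\<rho> ^^ k) (\<lambda>z. frechet_derivative U (at z) (v, 0)) z
      = frechet_derivative ((d\<rho> ^^ k) U) (at z) (v, 0)" if "z \<in> W" for z
    using that
  proof (induction k arbitrary: z)
    case (Suc k)
    have "d\<rho> ((d\<rho> ^^ k) (\<lambda>z. frechet_derivative U (at z) (v, 0))) z
      = d\<rho> (\<lambda>z. frechet_derivative ((d\<rho> ^^ k) U) (at z) (v, 0)) z"
      by (rule fun_cong[OF frechet_derivative_cong_open(1)[OF open_W Suc.prems Suc.IH]])
    then show ?case
      using symmetric_second_derivative[OF open_W Suc.prems smooth_funpow_d\<rho>[OF U, of k],
          where v = "(v, 0)" and w = "(0, 1)"] by simp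
  qed simp
  have *: "frechet_derivative (tay k U) (at x) v = frechet_derivative ((d\<rho> ^^ k) U) (at (x, 0)) (v, 0) / fact k"
    if x: "x \<in> \<Omega>" for x
  proof -
    have "frechet_derivative (tay k U) (at x) = frechet_derivative (\<lambda>x. (d\<rho> ^^ k) U (x, 0) / fact k) (at x)"
      by (rule frechet_derivative_cong_open(1)[OF Omega x]) (simp add: tay_def restr_def)
    moreover have "smooth_on W (\<lambda>z. (d\<rho> ^^ k) U z / fact k)" by (intro smooth_W smooth_funpow_d\<rho> U) auto
    from slice_frechet_derivative[OF this x, of v]
    have "frechet_derivative (\<lambda>x. (d\<rho> ^^ k) U (x, 0) / fact k) (at x) v
      = frechet_derivative (\<lambda>z. (d\<rho> ^^ k) U z / fact k) (at (x, 0)) (v, 0)" .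
    moreover have "frechet_derivative (\<lambda>z. (d\<rho> ^^ k) U z / fact k) (at (x, 0)) (v, 0)
       = frechet_derivative ((d\<rho> ^^ k) U) (at (x, 0)) (v, 0) / fact k"
    proof -
      have "(x, 0) \<in> W" using x J by simp
      then have "((\<lambda>z. (d\<rho> ^^ k) U z / fact k) has_derivative
          (\<lambda>h. frechet_derivative ((d\<rho> ^^ k) U) (at (x, 0)) h / fact k)) (at (x, 0))"
        by (intro bounded_linear.has_derivative[OF bounded_linear_divide]
            smooth_on_has_derivative[OF smooth_funpow_d\<rho>[OF U]])
      from frechet_derivative_at[OF this, symmetric] show ?thesis by simp
    qed
    ultimately show ?thesis by simp
  qed
  have "tay k (\<lambda>z. frechet_derivative U (at z) (v, 0)) = restr (\<lambda>x. frechet_derivative (tay k U) (at x) v)"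
    using J by (auto simp: tay_def[of k "\<lambda>z. frechet_derivative U (at z) (v, 0)"] restr_def com * fun_eq_iff)
  moreover have "(\<Sum>i\<le>k. (if i = 0 then restr (\<lambda>x. frechet_derivative (tay (k - i) U) (at x) v) else 0))
    = restr (\<lambda>x. frechet_derivative (tay k U) (at x) v)"
    by (subst sum.remove[of _ 0]) simp_all
  ultimately show "tay k (\<lambda>z. frechet_derivative U (at z) (v, 0))
    = (\<Sum>i\<le>k. (if i = 0 then restr (\<lambda>x. frechet_derivative (tay (k - i) U) (at x) v) else 0))" by simp
qed

lemma rho_op_zero: "rho_op (\<lambda>U z. 0) (\<lambda>i u. 0)"
proof -
  have "d\<rho> (\<lambda>z :: 'e \<times> real. 0 :: real) = (\<lambda>z. 0)"
    by (simp add: frechet_derivative_at[OF has_derivative_const, symmetric])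
  then have "(d\<rho> ^^ k) (\<lambda>z :: 'e \<times> real. 0 :: real) = (\<lambda>z. 0)" for k :: nat
    by (induction k) auto
  then have "tay k (\<lambda>z. 0) = 0" for k by (auto simp: tay_def restr_def)
  then show ?thesis
    unfolding rho_op_def linear_within_def
    by (auto intro!: smooth_W simp: subspace_0[OF subspace_E])
qed

lemma rho_op_add:
  assumes "rho_op T C" "rho_op T' C'"
  shows "rho_op (\<lambda>U z. T U z + T' U z) (\<lambda>i u. C i u + C' i u)"
  unfolding rho_op_def
proof (intro conjI allI impI)
  fix i
  show "linear_within E (\<lambda>u. C i u + C' i u)"
    using rho_opD(1)[OF assms(1), of i] rho_opD(1)[OF assms(2), of i]
    by (auto simp: linear_within_def scaleR_right_distrib intro!: subspace_add[OF subspace_E])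
qed (auto intro!: smooth_W rho_opD(2)[OF assms(1)] rho_opD(2)[OF assms(2)]
      simp: tay_add rho_opD(2,3)[OF assms(1)] rho_opD(2,3)[OF assms(2)] sum.distrib)

lemma rho_op_sum:
  assumes "\<And>b. b \<in> B \<Longrightarrow> \<exists>C. rho_op (T b) C"
  shows "\<exists>C. rho_op (\<lambda>U z. \<Sum>b\<in>B. T b U z) C"
  using assms
proof (induction B rule: infinite_finite_induct)
  case (insert b B)
  then obtain C C' where "rho_op (T b) C" "rho_op (\<lambda>U z. \<Sum>b\<in>B. T b U z) C'" by blast
  then show ?case using insert rho_op_add[of "T b" C] by auto
qed (auto intro: rho_op_zero)

lemma rho_op_compose:
  assumes T: "rho_op T C" and T': "rho_op T' C'"
  shows "rho_op (\<lambda>U. T (T' U)) (\<lambda>k u. \<Sum>i\<le>k. C i (C' (k - i) u))"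
  unfolding rho_op_def
proof (intro conjI allI impI)
  fix k
  have "linear_within E (\<lambda>u. C i (C' j u))" for i j
    using rho_opD(1)[OF T, of i] rho_opD(1)[OF T', of j] by (auto simp: linear_within_def)
  then have "linear_within E (\<lambda>u. \<Sum>i\<le>k. 1 *\<^sub>R C i (C' (k - i) u))"
    by (intro linear_within_lincomb[OF subspace_E])
  then show "linear_within E (\<lambda>u. \<Sum>i\<le>k. C i (C' (k - i) u))" by simp
next
  fix U :: "'e \<times> real \<Rightarrow> real" and k
  assume U: "smooth_on W U"
  show "smooth_on W (T (T' U))" by (intro rho_opD(2)[OF T] rho_opD(2)[OF T'] U)
  have "tay k (T (T' U)) = (\<Sum>i\<le>k. C i (\<Sum>j\<le>k - i. C' j (tay (k - i - j) U)))"
    by (simp add: rho_opD(3)[OF T] rho_opD(2,3)[OF T'] U)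
  also have "\<dots> = (\<Sum>i\<le>k. \<Sum>j\<le>k - i. C i (C' j (tay (k - i - j) U)))"
    by (intro sum.cong refl linear_within_sum[OF subspace_E rho_opD(1)[OF T]]
        linear_withinD(1)[OF rho_opD(1)[OF T']] tay_in_E U)
  also have "\<dots> = (\<Sum>m\<le>k. \<Sum>i\<le>m. C i (C' (m - i) (tay (k - m) U)))"
  proof -
    have "(\<Sum>i\<le>k. \<Sum>j\<le>k - i. g i j) = (\<Sum>m\<le>k. \<Sum>i\<le>m. g i (m - i))" for g :: "nat \<Rightarrow> nat \<Rightarrow> 'e \<Rightarrow> real"
      by (simp add: sum.Sigma)
         (rule sum.reindex_bij_witness[where i = "\<lambda>(m, i). (i, m - i)" and j = "\<lambda>(i, j). (i + j, i)"], auto)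
    from this[of "\<lambda>i j. C i (C' j (tay (k - i - j) U))"] show ?thesis by (simp add: diff_diff_left)
  qed
  finally show "tay k (T (T' U)) = (\<Sum>m\<le>k. \<Sum>i\<le>m. C i (C' (m - i) (tay (k - m) U)))" .
qed

lemma ex_rho_op_mult: "smooth_on W a \<Longrightarrow> \<exists>C. rho_op T C \<Longrightarrow> \<exists>C. rho_op (\<lambda>U z. a z * T U z) C"
  using rho_op_compose[OF rho_op_mult] by blast

lemma ex_rho_op_derivative: "\<exists>C. rho_op T C \<Longrightarrow> \<exists>C. rho_op (\<lambda>U z. frechet_derivative (T U) (at z) (v, 0)) C"
  using rho_op_compose[OF rho_op_derivative] by blast

lemma ex_rho_op_add:
  "\<exists>C. rho_op T C \<Longrightarrow> \<exists>C. rho_op T' C \<Longrightarrow> \<exists>C. rho_op (\<lambda>U z. T U z + T' U z) C"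
  using rho_op_add by blast

end

section \<open>Juhl's formulas in a chart\<close>

context chart_family
begin

text \<open>In divergence form the Laplacian of the slices is a composition of derivatives in \<open>x\<close>,
  multiplications by smooth functions and sums.\<close>

lemma ex_rho_op_lap: "\<exists>C. rho_op (lap H) C"
proof -
  define a where "a c b z = sharp (H z) (\<lambda>w. c \<bullet> w) \<bullet> b" for c b :: 'e and z
  define \<kappa> where "\<kappa> b z = metric_trace (H z) (metric_deriv H z (b, 0)) / 2" for b :: 'e and z
  define G where "G b U z = (\<Sum>c\<in>Basis. a c b z * frechet_derivative U (at z) (c, 0))" for b U z
  have li: "linear (\<lambda>w. c \<bullet> w)" for c :: 'e by (rule bounded_linear.linear[OF bounded_linear_inner_right])
  have sa: "smooth_on W (a c b)" for c b unfolding a_def by (intro smooth_W H li)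
  have sk: "smooth_on W (\<kappa> b)" for b unfolding \<kappa>_def
    by (intro smooth_on_divide open_W smooth_on_metric_trace_deriv H smooth_on_const) auto
  have Gg: "grad H U z \<bullet> b = G b U z" if U: "smooth_on W U" and z: "z \<in> W" for U z b
  proof -
    note B = metric_onD(1)[OF H z]
    have "grad H U z = (\<Sum>c\<in>Basis. frechet_derivative U (at z) (c, 0) *\<^sub>R sharp (H z) (\<lambda>w. c \<bullet> w))"
      unfolding grad_def
    proof (rule sharp_eqI[OF B])
      fix v
      note l = metric_formD(2)[OF B]
      have "H z (\<Sum>c\<in>Basis. frechet_derivative U (at z) (c, 0) *\<^sub>R sharp (H z) (\<lambda>w. c \<bullet> w)) v
         = (\<Sum>c\<in>Basis. frechet_derivative U (at z) (c, 0) * (c \<bullet> v))"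
        by (simp add: linear_sum[OF l] linear_scale[OF l] sharp_works[OF B li])
      also have "\<dots> = frechet_derivative U (at z) (v, 0)"
        by (subst linear_Basis_expansion[OF linear_slots(1)[OF smooth_on_linear_derivative[OF U z]], of v])
           (simp add: inner_commute mult.commute)
      finally show "H z (\<Sum>c\<in>Basis. frechet_derivative U (at z) (c, 0) *\<^sub>R sharp (H z) (\<lambda>w. c \<bullet> w)) v
         = frechet_derivative U (at z) (v, 0)" .
    qed
    then show ?thesis by (simp add: G_def a_def inner_sum_left mult.commute)
  qed
  have lap_eq: "lap H U z = (\<Sum>b\<in>Basis. frechet_derivative (G b U) (at z) (b, 0)) + (\<Sum>b\<in>Basis. \<kappa> b z * G b U z)"
    if U: "smooth_on W U" and z: "z \<in> W" for U z
  proof -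
    have "frechet_derivative (grad H U) (at z) (b, 0) \<bullet> b = frechet_derivative (G b U) (at z) (b, 0)" for b
    proof -
      have "frechet_derivative (G b U) (at z) = frechet_derivative (\<lambda>z. grad H U z \<bullet> b) (at z)"
        by (rule frechet_derivative_cong_open(1)[OF open_W z]) (simp add: Gg[OF U])
      then show ?thesis
        using frechet_derivative_at[OF has_derivative_inner_left[OF
              smooth_on_has_derivative[OF smooth_on_grad[OF open_W H U] z]], of b, symmetric] by simp
    qed
    moreover have "metric_trace (H z) (metric_deriv H z (grad H U z, 0)) / 2 = (\<Sum>b\<in>Basis. \<kappa> b z * G b U z)"
      unfolding metric_trace_deriv_expand[OF open_W z H, of "(grad H U z, 0)"] sum_Basis_prod
      by (simp add: \<kappa>_def Gg[OF U z] sum_divide_distrib mult.commute)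
    ultimately show ?thesis by (simp add: lap_def)
  qed
  have exG: "\<exists>C. rho_op (G b) C" for b
    unfolding G_def[abs_def]
    by (intro rho_op_sum ex_rho_op_mult sa ex_rho_op_derivative exI[of _ "\<lambda>i u. if i = 0 then u else 0"])
       (auto simp: rho_op_def linear_within_def subspace_0[OF subspace_E] if_distrib[of "\<lambda>f. f _"] sum.delta' cong: if_cong)
  have "\<exists>C. rho_op (\<lambda>U z. (\<Sum>b\<in>Basis. frechet_derivative (G b U) (at z) (b, 0)) + (\<Sum>b\<in>Basis. \<kappa> b z * G b U z)) C"
    by (intro ex_rho_op_add rho_op_sum ex_rho_op_derivative ex_rho_op_mult sk exG)
  then obtain C where C: "rho_op (\<lambda>U z. (\<Sum>b\<in>Basis. frechet_derivative (G b U) (at z) (b, 0))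
      + (\<Sum>b\<in>Basis. \<kappa> b z * G b U z)) C" by blast
  have "rho_op (lap H) C" by (rule rho_op_cong[OF C lap_eq])
  then show ?thesis by blast
qed

text \<open>The function \<open>w = \<surd>v\<close> in a chart.\<close>

definition w :: "'e \<times> real \<Rightarrow> real" where
  "w z = sqrt (vol_density (H z) / vol_density (H (fst z, 0)))"

lemma slice0_in_W: "z \<in> W \<Longrightarrow> (fst z, 0) \<in> W" using J by auto

lemma vol_pos: "z \<in> W \<Longrightarrow> 0 < vol_density (H z)" using vol_density_pos metric_onD(1)[OF H] by blast

lemma w_pos: "z \<in> W \<Longrightarrow> 0 < w z"
  unfolding w_def using vol_pos slice0_in_W by (simp add: divide_pos_pos del: mem_Sigma_iff)

lemma w_0: "x \<in> \<Omega> \<Longrightarrow> w (x, 0) = 1"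
  unfolding w_def using vol_pos[of "(x, 0)"] J by simp

lemma smooth_w: "smooth_on W w"
proof -
  have v: "smooth_on W (\<lambda>z. vol_density (H z))" by (intro smooth_W H)
  have "smooth_on W (\<lambda>z. (fst z, 0 :: real))"
    by (intro smooth_on_Pair smooth_on_fst smooth_on_const open_W)
  then have v0: "smooth_on W (\<lambda>z. vol_density (H (fst z, 0)))"
    using slice0_in_W by (intro smooth_on_compose[OF open_W open_W v]) auto
  show ?thesis
    unfolding w_def[abs_def] using vol_pos slice0_in_W
    by (intro smooth_on_sqrt smooth_on_divide open_W v v0 divide_pos_pos) (auto simp del: mem_Sigma_iff simp: less_imp_neq[symmetric])
qed

text \<open>\<open>w\<^sup>2\<close> is the volume density up to a factor that does not depend on \<open>\<rho>\<close>.\<close>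

lemma d\<rho>_w: assumes z: "z \<in> W" shows "2 * d\<rho> w z = log_vol_deriv H z * w z"
proof -
  let ?v = "\<lambda>z. vol_density (H z)"
  obtain x r where xr: "z = (x, r)" by (cases z)
  have r: "r \<in> J" "x \<in> \<Omega>" using z xr by auto
  have vd: "((\<lambda>s. ?v (x, s)) has_derivative (\<lambda>h. ?v z * metric_trace (H z) (metric_deriv H z (0, h)) / 2)) (at r)"
  proof -
    have "smooth_on W ?v" by (intro smooth_W H)
    from slice_derivative(2)[OF this, of x r] show ?thesis
      using z xr frechet_derivative_at[OF vol_density_has_derivative[OF open_W z H], symmetric] by simp
  qed
  have c: "metric_trace (H z) (metric_deriv H z (0, h)) = h * (2 * log_vol_deriv H z)" for h
    unfolding metric_trace_deriv_expand[OF open_W z H, of "(0, h)"] sum_Basis_prod log_vol_deriv_def by simp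
  have D: "((\<lambda>s. ?v (x, s)) has_real_derivative ?v z * log_vol_deriv H z) (at r)"
  proof -
    have "(\<lambda>h. ?v z * (h * (2 * log_vol_deriv H z)) / 2) = (*) (?v z * log_vol_deriv H z)"
      by (auto simp: fun_eq_iff)
    with vd show ?thesis unfolding c has_field_derivative_def by simp
  qed
  have p: "0 < ?v (x, r)" "0 < ?v (x, 0)" using vol_pos[OF z] vol_pos[OF slice0_in_W[OF z]] xr by auto
  have "((\<lambda>s. sqrt (?v (x, s) / ?v (x, 0))) has_real_derivative
      (?v z * log_vol_deriv H z / ?v (x, 0)) * (inverse (sqrt (?v (x, r) / ?v (x, 0))) / 2)) (at r)"
    using p by (auto intro!: derivative_eq_intros D simp: divide_less_0_iff mult.commute mult.left_commute)
  moreover have "((\<lambda>s. w (x, s)) has_derivative (\<lambda>h. frechet_derivative w (at z) (0, h))) (at r)"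
    using slice_derivative(2)[OF smooth_w, of x r] z xr by simp
  ultimately have "(\<lambda>h. frechet_derivative w (at z) (0, h)) =
     (*) ((?v z * log_vol_deriv H z / ?v (x, 0)) * (inverse (sqrt (?v (x, r) / ?v (x, 0))) / 2))"
    unfolding has_field_derivative_def w_def fst_conv by (rule has_derivative_unique[rotated])
  from fun_cong[OF this, of 1]
  have "2 * d\<rho> w z = log_vol_deriv H z * ((?v (x, r) / ?v (x, 0)) * inverse (sqrt (?v (x, r) / ?v (x, 0))))"
    by (simp add: xr)
  also have "(?v (x, r) / ?v (x, 0)) * inverse (sqrt (?v (x, r) / ?v (x, 0))) = sqrt (?v (x, r) / ?v (x, 0))"
    using p by (metis divide_inverse divide_pos_pos less_imp_le real_div_sqrt)
  finally show ?thesis by (simp add: w_def[abs_def] xr)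
qed

lemma lap_const: "z \<in> W \<Longrightarrow> lap H (\<lambda>z. c) z = 0"
proof -
  assume z: "z \<in> W"
  have g: "grad H (\<lambda>z. c) z = 0" if "z \<in> W" for z
    unfolding grad_def
    by (rule sharp_eqI[OF metric_onD(1)[OF H that]])
       (simp add: frechet_derivative_at[OF has_derivative_const, symmetric]
         linear_0[OF metric_formD(2)[OF metric_onD(1)[OF H that]]])
  have "frechet_derivative (grad H (\<lambda>z. c)) (at z) = frechet_derivative (\<lambda>z. 0) (at z)"
    by (rule frechet_derivative_cong_open(1)[OF open_W z g])
  moreover have "metric_trace (H z) (metric_deriv H z (0, 0)) = 0"
    unfolding metric_trace_deriv_expand[OF open_W z H, of "(0, 0)"] sum_Basis_prod by simp
  ultimately show ?thesis
    by (simp add: lap_def g[OF z] frechet_derivative_at[OF has_derivative_const, symmetric])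
qed

text \<open>The operator \<open>M(\<rho>)\<close>, and the operators \<open>-2\<rho>\<partial>\<^sub>\<rho>\<^sup>2 + 2c\<partial>\<^sub>\<rho> + M(\<rho>)\<close> to which conjugation with \<open>w\<close>
  reduces the ambient Laplacian: the conjugation removes the term with \<open>\<partial>\<^sub>\<rho>\<close> and the logarithmic
  derivative of the volume density.\<close>

definition Mop :: "('e \<times> real \<Rightarrow> real) \<Rightarrow> 'e \<times> real \<Rightarrow> real" where
  "Mop V z = w z * lap H (\<lambda>z. inverse (w z) * V z) z
     + ((2 * snd z * d\<rho> (d\<rho> w) z - (real DIM('e) - 2) * d\<rho> w z) * inverse (w z)) * V z"

definition Dop :: "real \<Rightarrow> ('e \<times> real \<Rightarrow> real) \<Rightarrow> 'e \<times> real \<Rightarrow> real" where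
  "Dop c V z = - 2 * (snd z * d\<rho> (d\<rho> V) z) + 2 * c * d\<rho> V z + Mop V z"

lemma w_nonzero: "z \<in> W \<Longrightarrow> w z \<noteq> 0" using w_pos by force

lemma smooth_inverse_w: "smooth_on W (\<lambda>z. inverse (w z))"
  by (intro smooth_W smooth_w w_nonzero)

lemma ex_rho_op_Mop: "\<exists>C. rho_op Mop C"
proof -
  define q where "q = (\<lambda>z. (2 * snd z * d\<rho> (d\<rho> w) z - (real DIM('e) - 2) * d\<rho> w z) * inverse (w z))"
  have sm: "smooth_on W q"
    unfolding q_def by (intro smooth_on_mult smooth_on_diff smooth_on_const smooth_on_snd smooth_on_frechet_derivative
         open_W smooth_w smooth_inverse_w)
  obtain C where "rho_op (lap H) C" using ex_rho_op_lap by blast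
  from rho_op_compose[OF this rho_op_mult[OF smooth_inverse_w]]
  have ex: "\<exists>C. rho_op (\<lambda>V. lap H (\<lambda>z. inverse (w z) * V z)) C" by blast
  have "Mop = (\<lambda>V z. w z * lap H (\<lambda>z. inverse (w z) * V z) z + q z * V z)"
    unfolding Mop_def[abs_def] q_def ..
  moreover have "\<exists>C. rho_op (\<lambda>V z. q z * V z) C" using rho_op_mult[OF sm] by blast
  ultimately show ?thesis using ex_rho_op_add[OF ex_rho_op_mult[OF smooth_w ex]] by simp
qed

text \<open>The expansion of \<open>M(\<rho>)\<close> in powers of \<open>\<rho>\<close>.\<close>

definition Mc :: "nat \<Rightarrow> ('e \<Rightarrow> real) \<Rightarrow> 'e \<Rightarrow> real" where
  "Mc = (SOME C. rho_op Mop C)"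

lemma rho_op_Mop: "rho_op Mop Mc"
  unfolding Mc_def using ex_rho_op_Mop by (rule someI_ex)

lemma smooth_Dop: "smooth_on W V \<Longrightarrow> smooth_on W (Dop c V)"
  unfolding Dop_def[abs_def]
  by (intro smooth_on_add smooth_on_mult smooth_on_const smooth_on_snd smooth_on_frechet_derivative
      open_W rho_opD(2)[OF rho_op_Mop])

text \<open>For \<open>V = U w\<close> the product rule yields \<open>- 4 \<rho> U' w'\<close> and \<open>2 c U w'\<close>, where the first term is \<open>- 2 \<rho> w U'\<close>
  times the logarithmic derivative \<open>2 w' / w\<close> of the volume density. The terms of order zero in
  \<open>Mop\<close> cancel \<open>- 2 \<rho> U w''\<close> and replace \<open>2 c\<close> by \<open>2 c - (n - 2) = 2 s\<close>.\<close>

lemma conjugation: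
  assumes U: "smooth_on W U" and z: "z \<in> W" and V: "\<And>z. z \<in> W \<Longrightarrow> V z = U z * w z"
  shows "Dop (s + real DIM('e) / 2 - 1) V z = w z * (lap H U z - 2 * snd z * d\<rho> (d\<rho> U) z
     + (real DIM('e) - 2) * d\<rho> U z - 2 * snd z * log_vol_deriv H z * d\<rho> U z
     + s * (2 * d\<rho> U z + log_vol_deriv H z * U z))"
proof -
  have d1: "d\<rho> V z = U z * d\<rho> w z + d\<rho> U z * w z" if "z \<in> W" for z
  proof -
    have "frechet_derivative V (at z) = frechet_derivative (\<lambda>z. U z * w z) (at z)"
      by (rule frechet_derivative_cong_open(1)[OF open_W that V])
    then show ?thesis
      using frechet_derivative_at[OF has_derivative_mult[OF smooth_on_has_derivative[OF U that]
            smooth_on_has_derivative[OF smooth_w that]], symmetric] by simp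
  qed
  have d2: "d\<rho> (d\<rho> V) z = U z * d\<rho> (d\<rho> w) z + 2 * d\<rho> U z * d\<rho> w z + d\<rho> (d\<rho> U) z * w z"
  proof -
    have "frechet_derivative (d\<rho> V) (at z) = frechet_derivative (\<lambda>z. U z * d\<rho> w z + d\<rho> U z * w z) (at z)"
      by (rule frechet_derivative_cong_open(1)[OF open_W z d1])
    then show ?thesis
      using frechet_derivative_at[OF has_derivative_add[OF
          has_derivative_mult[OF smooth_on_has_derivative[OF U z]
            smooth_on_has_derivative[OF smooth_on_frechet_derivative[OF smooth_w] z]]
          has_derivative_mult[OF smooth_on_has_derivative[OF smooth_on_frechet_derivative[OF U] z]
            smooth_on_has_derivative[OF smooth_w z]]], symmetric] by simp
  qed
  have l: "lap H (\<lambda>z. inverse (w z) * V z) z = lap H U z"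
  proof -
    have e: "inverse (w y) * V y = U y" if "y \<in> W" for y using V[OF that] w_nonzero[OF that] by simp
    have "grad H (\<lambda>z. inverse (w z) * V z) y = grad H U y" if "y \<in> W" for y
      unfolding grad_def using frechet_derivative_cong_open(1)[OF open_W that e] by simp
    then show ?thesis
      unfolding lap_def using frechet_derivative_cong_open(1)[OF open_W z, of "grad H (\<lambda>z. inverse (w z) * V z)" "grad H U"] z
      by simp
  qed
  have lw: "log_vol_deriv H z = 2 * d\<rho> w z / w z" using d\<rho>_w[OF z] w_nonzero[OF z] by (simp add: field_simps)
  show ?thesis
    unfolding Dop_def Mop_def l d1[OF z] d2 V[OF z] lw using w_nonzero[OF z]
    by (simp add: field_simps)
qed

lemma cone_laplacian_powr:
  assumes V: "smooth_on W V" and z: "z \<in> W" and t: "t > 0"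
  shows "coord_laplacian (cone_form H) (\<lambda>(t, z). t powr s * (V z / w z)) (t, z)
     = t powr (s - 2) * (Dop (s + real DIM('e) / 2 - 1) V z / w z)"
proof -
  have U: "smooth_on W (\<lambda>z. V z / w z)" by (intro smooth_W V smooth_w w_nonzero)
  have p: "smooth_on {0<..} (\<lambda>t::real. t powr s)" by (rule smooth_on_real_powr)
  have d: "((\<lambda>t. t powr s) has_real_derivative s * t powr (s - 1)) (at t)" if "t > 0" for t :: real
    using that by (auto intro!: derivative_eq_intros simp: powr_diff)
  have V: "V z = V z / w z * w z" if "z \<in> W" for z using w_nonzero[OF that] by simp
  have e: "t powr s / t\<^sup>2 = t powr (s - 2)" "s * t powr (s - 1) / t = s * t powr (s - 2)"
    using t by (simp_all add: powr_diff power2_eq_square)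
  have c: "Dop (s + real DIM('e) / 2 - 1) V z = w z * (lap H (\<lambda>z. V z / w z) z - 2 * snd z * d\<rho> (d\<rho> (\<lambda>z. V z / w z)) z
     + (real DIM('e) - 2) * d\<rho> (\<lambda>z. V z / w z) z - 2 * snd z * log_vol_deriv H z * d\<rho> (\<lambda>z. V z / w z) z
     + s * (2 * d\<rho> (\<lambda>z. V z / w z) z + log_vol_deriv H z * (V z / w z)))"
    by (rule conjugation[OF U z V])
  show ?thesis
    by (rule trans[OF cone_laplacian_product[OF open_W z H U p d t]], assumption,
        unfold c e nonzero_mult_div_cancel_left[OF w_nonzero[OF z]])
       (simp only: distrib_left mult.assoc mult.left_commute)
qed

lemma cone_laplacian_ln:
  assumes z: "z \<in> W" and t: "t > 0"
  shows "coord_laplacian (cone_form H) (\<lambda>(t, z). ln t) (t, z) = t powr (- 2) * (2 * d\<rho> w z / w z)"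
proof -
  have U: "smooth_on W (\<lambda>z. 1 :: real)" by (intro smooth_W)
  have p: "smooth_on {0<..} (\<lambda>t::real. ln t)" by (intro smooth_on_ln smooth_on_ident) auto
  have d: "(ln has_real_derivative 1 / t) (at t)" if "t > 0" for t :: real
    using that by (auto intro!: derivative_eq_intros)
  have c: "d\<rho> (\<lambda>z. c) = (\<lambda>z. 0)" for c :: real
    by (simp add: frechet_derivative_at[OF has_derivative_const, symmetric])
  have lw: "log_vol_deriv H z = 2 * d\<rho> w z / w z" using d\<rho>_w[OF z] w_nonzero[OF z] by (simp add: field_simps)
  show ?thesis
    using cone_laplacian_product[OF open_W z H U p d t] lap_const[OF z] t
    by (simp add: c lw powr_minus powr_numeral field_simps power2_eq_square)
qed

lemma tay_const: "tay i (\<lambda>z. c) = (if i = 0 then restr (\<lambda>x. c) else 0)"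
proof -
  have c: "d\<rho> (\<lambda>z. c) = (\<lambda>z. 0)" for c :: real
    by (simp add: frechet_derivative_at[OF has_derivative_const, symmetric])
  have e: "(d\<rho> ^^ i) (\<lambda>z. c) = (\<lambda>z. if i = 0 then c else 0)"
    by (induction i) (auto simp: c)
  show ?thesis unfolding tay_def e by (auto simp: restr_def fun_eq_iff)
qed

lemma tay_cmult: "smooth_on W U \<Longrightarrow> tay k (\<lambda>z. c * U z) = c *\<^sub>R tay k U"
proof -
  assume U: "smooth_on W U"
  have "tay k (\<lambda>z. c * U z) x = c * tay k U x" for x
    unfolding tay_mult[OF smooth_on_const[OF open_W] U]
    by (subst sum.remove[of _ 0]) (auto simp: tay_const restr_def tay_def)
  then show ?thesis by (simp add: fun_eq_iff)
qed

lemma tay_rho_times: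
  assumes U: "smooth_on W U"
  shows "tay k (\<lambda>z. snd z * U z) = (case k of 0 \<Rightarrow> 0 | Suc m \<Rightarrow> tay m U)"
proof -
  have "d\<rho> snd = (\<lambda>z :: 'e \<times> real. 1)"
    by (simp add: frechet_derivative_at[OF bounded_linear_imp_has_derivative[OF bounded_linear_snd], symmetric])
  then have "real (Suc i) *\<^sub>R tay (Suc i) snd = tay i (\<lambda>z. 1)" for i
    using tay_d\<rho>[of i snd] by simp
  then have "tay (Suc i) snd x = tay i (\<lambda>z. 1) x / real (Suc i)" for i x
    by (metis nonzero_mult_div_cancel_left of_nat_eq_0_iff nat.distinct(1) scaleR_fun_apply real_scaleR_def)
  then have S: "tay (Suc i) snd x = (if i = 0 \<and> x \<in> \<Omega> then 1 else 0)" for i x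
    by (cases i) (simp_all add: tay_const restr_def)
  have t0: "tay 0 snd = 0" by (auto simp: tay_def restr_def)
  show ?thesis
  proof (cases k)
    case 0
    then show ?thesis by (auto simp: tay_def restr_def)
  next
    case (Suc m)
    have "tay (Suc m) (\<lambda>z. snd z * U z) x = tay m U x" for x
    proof -
      have "tay (Suc m) (\<lambda>z. snd z * U z) x = (\<Sum>i\<le>m. tay (Suc i) snd x * tay (m - i) U x)"
        unfolding tay_mult[OF smooth_on_snd[OF open_W] U] by (subst sum.atMost_Suc_shift) (simp add: t0)
      also have "\<dots> = tay m U x"
      proof (cases "x \<in> \<Omega>")
        case True
        then show ?thesis by (subst sum.remove[of _ 0]) (simp_all add: S)
      next
        case False
        then have "tay m U x = 0" by (simp add: tay_def restr_def)
        with False show ?thesis by (simp add: S)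
      qed
      finally show ?thesis .
    qed
    then show ?thesis using Suc by (simp add: fun_eq_iff)
  qed
qed

lemma tay_Dop:
  assumes V: "smooth_on W V"
  shows "tay k (Dop c V) = dop Mc c (\<lambda>k. tay k V) k"
proof -
  have s: "smooth_on W (d\<rho> (d\<rho> V))" "smooth_on W (\<lambda>z. snd z * d\<rho> (d\<rho> V) z)"
    "smooth_on W (d\<rho> V)" "smooth_on W (Mop V)"
    by (intro smooth_on_mult smooth_on_snd smooth_on_frechet_derivative open_W V rho_opD(2)[OF rho_op_Mop])+
  have "tay k (Dop c V) = tay k (\<lambda>z. - 2 * (snd z * d\<rho> (d\<rho> V) z) + 2 * c * d\<rho> V z) + tay k (Mop V)"
    unfolding Dop_def[abs_def] by (intro tay_add smooth_on_add smooth_on_mult[OF open_W smooth_on_const] open_W s)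
  also have "tay k (\<lambda>z. - 2 * (snd z * d\<rho> (d\<rho> V) z) + 2 * c * d\<rho> V z)
     = tay k (\<lambda>z. - 2 * (snd z * d\<rho> (d\<rho> V) z)) + tay k (\<lambda>z. 2 * c * d\<rho> V z)"
    by (intro tay_add smooth_on_mult[OF open_W smooth_on_const] open_W s)
  also have "\<dots> = (- 2) *\<^sub>R (case k of 0 \<Rightarrow> 0 | Suc m \<Rightarrow> tay m (d\<rho> (d\<rho> V))) + (2 * c) *\<^sub>R tay k (d\<rho> V)"
    by (simp add: tay_cmult[OF s(2), of k "- 2", simplified] tay_cmult[OF s(3)] tay_rho_times[OF s(1)])
  also have "(case k of 0 \<Rightarrow> 0 | Suc m \<Rightarrow> tay m (d\<rho> (d\<rho> V))) = (real k * real (Suc k)) *\<^sub>R tay (Suc k) V"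
    by (cases k) (simp_all add: tay_d\<rho> del: of_nat_Suc)
  also have "tay k (d\<rho> V) = real (Suc k) *\<^sub>R tay (Suc k) V" by (rule tay_d\<rho>)
  also have "tay k (Mop V) = (\<Sum>i\<le>k. Mc i (tay (k - i) V))" by (rule rho_opD(3)[OF rho_op_Mop V])
  finally have "tay k (Dop c V) = (- 2 * (real k * real (Suc k)) + 2 * c * real (Suc k)) *\<^sub>R tay (Suc k) V
      + (\<Sum>i\<le>k. Mc i (tay (k - i) V))"
    by (simp only: scaleR_scaleR scaleR_left_distrib)
  moreover have "- 2 * (real k * real (Suc k)) + 2 * c * real (Suc k) = 2 * real (Suc k) * (c - real k)"
    by (simp add: algebra_simps)
  ultimately show ?thesis by (simp only: dop_def)
qed

primrec Dops :: "real \<Rightarrow> nat \<Rightarrow> ('e \<times> real \<Rightarrow> real) \<Rightarrow> 'e \<times> real \<Rightarrow> real" where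
  "Dops c 0 V = V"
| "Dops c (Suc j) V = Dop (c - 2 * real j) (Dops c j V)"

lemma smooth_Dops: "smooth_on W V \<Longrightarrow> smooth_on W (Dops c j V)"
  by (induction j) (simp_all add: smooth_Dop)

lemma tay_Dops:
  assumes "smooth_on W V"
  shows "(\<lambda>k. tay k (Dops c j V)) = dops Mc c j (\<lambda>k. tay k V)"
proof (induction j)
  case (Suc j)
  show ?case by (simp only: Dops.simps dops.simps tay_Dop[OF smooth_Dops[OF assms]] Suc.IH)
qed simp


subsection \<open>The formulas\<close>

text \<open>The GJMS operator in a chart, computed from the extension that does not depend on \<open>\<rho>\<close>.\<close>

definition Pop :: "nat \<Rightarrow> ('e \<Rightarrow> real) \<Rightarrow> 'e \<Rightarrow> real" where
  "Pop N u = dops Mc (real N - 1) N (\<lambda>k. if k = 0 then u else 0) 0"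

lemmas Mc_linear = rho_opD(1)[OF rho_op_Mop]

lemma const_seq_in: "u \<in> E \<Longrightarrow> (if k = 0 then u else 0) \<in> E"
  using subspace_0[OF subspace_E] by simp

lemma Dops_at_0: "smooth_on W V \<Longrightarrow> tay 0 (Dops (real N - 1) N V) = Pop N (tay 0 V)"
  using fun_cong[OF tay_Dops[of V "real N - 1" N], of 0]
  by (simp add: Pop_def)
     (rule dops_depends_on_0[OF subspace_E Mc_linear]; simp add: tay_in_E const_seq_in subspace_0[OF subspace_E])

lemma linear_within_Pop: "linear_within E (Pop N)"
  unfolding linear_within_def
proof (intro conjI ballI allI)
  fix u v c assume u: "u \<in> E"
  show "Pop N u \<in> E" unfolding Pop_def by (rule dops_in[OF subspace_E Mc_linear const_seq_in[OF u]])
  have "(\<lambda>k. if k = 0 then c *\<^sub>R u else 0) = (\<lambda>k :: nat. c *\<^sub>R (if k = 0 then u else 0))" by auto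
  then show "Pop N (c *\<^sub>R u) = c *\<^sub>R Pop N u"
    unfolding Pop_def
    using dops_scale[where V = "\<lambda>k. if k = 0 then u else 0", OF subspace_E Mc_linear const_seq_in[OF u]] by simp
  assume v: "v \<in> E"
  have "(\<lambda>k. if k = 0 then u + v else 0) = (\<lambda>k :: nat. (if k = 0 then u else 0) + (if k = 0 then v else 0))" by auto
  then show "Pop N (u + v) = Pop N u + Pop N v"
    unfolding Pop_def
    using dops_add[where V = "\<lambda>k. if k = 0 then u else 0" and W = "\<lambda>k. if k = 0 then v else 0",
        OF subspace_E Mc_linear const_seq_in[OF u] const_seq_in[OF v]] by simp
qed

text \<open>The normalization that turns the expansion of \<open>M(\<rho>)\<close> into
  \<open>\<Sum> Mnorm N (- \<rho> / 2)\<^bsup>N-1\<^esup> / (N - 1)!\<^sup>2\<close>.\<close>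

definition Mnorm :: "nat \<Rightarrow> ('e \<Rightarrow> real) \<Rightarrow> 'e \<Rightarrow> real" where
  "Mnorm j v = ((fact (j - 1))\<^sup>2 * (- 2) ^ (j - 1)) *\<^sub>R Mc (j - 1) v"

lemma Pop_eq_juhl_sum:
  assumes u: "u \<in> E" and N: "1 \<le> N"
  shows "Pop N u = (fact (N - 1))\<^sup>2 *\<^sub>R juhl_sum N Mnorm N (\<lambda>a. Mnorm a u)"
proof -
  note z = dops_zero[OF subspace_E Mc_linear]
  have "(if (0 :: nat) = 0 then u else 0) = u" by simp
  from formal_juhl[where E = E and M = Mc and f = "\<lambda>k. 0" and V = "\<lambda>k. if k = 0 then u else 0",
      OF subspace_E Mc_linear subspace_0[OF subspace_E] u const_seq_in[OF u] this N]
  show ?thesis unfolding z Mnorm_def[abs_def] Pop_def by simp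
qed

lemma Mnorm_eq_m_sum: "u \<in> E \<Longrightarrow> 1 \<le> N \<Longrightarrow> Mnorm N u = m_sum Pop N u"
  by (rule juhl_inversion_unique[OF subspace_E linear_within_Pop Pop_eq_juhl_sum])

lemma op_comp_Mnorm_eq:
  assumes "\<forall>j\<in>set I. 1 \<le> j" "u \<in> E"
  shows "op_comp Mnorm I u = op_comp (m_sum Pop) I u \<and> op_comp (m_sum Pop) I u \<in> E"
  using assms
proof (induction I)
  case (Cons i I)
  then show ?case
    using linear_withinD(1)[OF linear_within_m_sum[OF subspace_E linear_within_Pop]]
    by (simp add: op_comp_Cons Mnorm_eq_m_sum)
qed (simp add: op_comp_def)

text \<open>This is \<open>formal_juhl\<close> for \<open>u = 0\<close>, \<open>V = 0\<close> and \<open>f = 2 \<partial>\<^sub>\<rho> w\<close>. The coefficient of \<open>\<rho>\<^bsup>a-1\<^esup>\<close> in \<open>f\<close> is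
  \<open>2 a\<close> times that of \<open>\<rho>\<^bsup>a\<^esup>\<close> in \<open>w\<close>, and with the normalization it leads to
  \<open>a! (a - 1)! (-2)\<^bsup>a\<^esup> = a! (a - 1)! 2\<^bsup>2a\<^esup> (-1/2)\<^bsup>a\<^esup>\<close>. The last power relates the Taylor coefficients in
  \<open>\<rho>\<close> to those in \<open>r\<close>.\<close>

lemma Q_formula:
  assumes N: "1 \<le> N"
  shows "tay 0 (Dops (real N - 3) (N - 1) (\<lambda>z. 2 * d\<rho> w z)) =
    - (\<Sum>(I, a)\<in>splittings N. (n_coeff (I @ [a]) * fact a * fact (a - 1) * 2 ^ (2 * a)) *\<^sub>R
         op_comp (m_sum Pop) I ((- 1 / 2) ^ a *\<^sub>R tay a w))"
proof -
  let ?f = "\<lambda>k. tay k (\<lambda>z. 2 * d\<rho> w z)"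
  have sm: "smooth_on W (\<lambda>z. 2 * d\<rho> w z)" by (intro smooth_W smooth_w)
  have f: "?f k = (2 * real (Suc k)) *\<^sub>R tay (Suc k) w" for k
    by (simp add: tay_cmult[OF smooth_on_frechet_derivative[OF smooth_w]] tay_d\<rho>)
  let ?y = "\<lambda>a. ((fact (a - 1))\<^sup>2 * (- 2) ^ (a - 1)) *\<^sub>R (Mc (a - 1) 0 - ?f (a - 1))"
  have E0: "0 \<in> E" by (rule subspace_0[OF subspace_E])
  note z = dops_zero[OF subspace_E Mc_linear]
  have "tay 0 (Dops (real N - 3) (N - 1) (\<lambda>z. 2 * d\<rho> w z)) = dops Mc (real N - 3) (N - 1) ?f 0"
    using fun_cong[OF tay_Dops[OF sm, of "real N - 3" "N - 1"], of 0] by simp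
  also have "\<dots> = - ((fact (N - 1))\<^sup>2 *\<^sub>R juhl_sum N Mnorm N ?y)"
    using formal_juhl[where E = E and M = Mc and f = ?f and V = "\<lambda>k. 0",
        OF subspace_E Mc_linear tay_in_E[OF sm] E0 E0 refl N]
    unfolding z Mnorm_def[abs_def] by simp
  also have "(fact (N - 1))\<^sup>2 *\<^sub>R juhl_sum N Mnorm N ?y = (\<Sum>(I, a)\<in>splittings N. (n_coeff (I @ [a]) * fact a * fact (a - 1) * 2 ^ (2 * a)) *\<^sub>R
         op_comp (m_sum Pop) I ((- 1 / 2) ^ a *\<^sub>R tay a w))"
    unfolding juhl_sum_def scaleR_sum_right
  proof (intro sum.cong refl, clarify)
    fix I a assume Ia: "(I, a) \<in> splittings N"
    have I: "\<forall>j\<in>set I. 1 \<le> j" and a: "1 \<le> a" using splittings_le[OF Ia] by auto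
    have mem: "I @ [a] \<in> compositions N" using Ia by (auto simp: splittings_def compositions_def)
    have ta: "tay a w \<in> E" by (rule tay_in_E[OF smooth_w])
    let ?c = "(fact a :: real) * fact (a - 1) * 2 ^ (2 * a) * (- 1 / 2) ^ a"
    have fa: "fact a = real a * fact (a - 1)" using a by (simp add: fact_reduce)
    have pw: "2 ^ (2 * a) * (- 1 / 2) ^ a = (- 2 :: real) ^ a"
      by (simp add: power_mult power_mult_distrib[symmetric])
    have pa: "(- 2 :: real) ^ a = - 2 * (- 2) ^ (a - 1)" using a by (cases a) auto
    have "?y a = ?c *\<^sub>R tay a w"
    proof -
      have "?c = fact a * fact (a - 1) * (2 ^ (2 * a) * (- 1 / 2) ^ a)" by simp
      also have "\<dots> = - ((fact (a - 1))\<^sup>2 * (- 2) ^ (a - 1) * (2 * real a))"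
        unfolding pw pa fa by (simp add: power2_eq_square)
      finally show ?thesis
        using a by (simp add: f linear_within_0[OF subspace_E Mc_linear] del: of_nat_Suc)
    qed
    moreover have lo: "linear_within E (op_comp Mnorm I)"
    proof -
      have "linear_within E (op_comp (m_sum Pop) I)"
        by (rule linear_within_op_comp[OF subspace_E])
           (rule linear_within_m_sum[where P = Pop, OF subspace_E linear_within_Pop])
      then show ?thesis
        unfolding linear_within_def
        using op_comp_Mnorm_eq[OF I] subspace_add[OF subspace_E] subspace_scale[OF subspace_E] by simp
    qed
    ultimately have "op_comp Mnorm I (?y a) = ?c *\<^sub>R op_comp (m_sum Pop) I (tay a w)"
      using op_comp_Mnorm_eq[OF I ta] linear_withinD(3)[OF lo ta] by simp
    moreover have "op_comp (m_sum Pop) I ((- 1 / 2) ^ a *\<^sub>R tay a w) = (- 1 / 2) ^ a *\<^sub>R op_comp (m_sum Pop) I (tay a w)"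
      using op_comp_Mnorm_eq[OF I ta] op_comp_Mnorm_eq[OF I subspace_scale[OF subspace_E ta]] linear_withinD(3)[OF lo ta] by metis
    ultimately show "(fact (N - 1))\<^sup>2 *\<^sub>R nu N (I @ [a]) *\<^sub>R op_comp Mnorm I (?y a)
      = (n_coeff (I @ [a]) * fact a * fact (a - 1) * 2 ^ (2 * a)) *\<^sub>R
         op_comp (m_sum Pop) I ((- 1 / 2) ^ a *\<^sub>R tay a w)"
      using n_coeff_eq_nu[OF mem N] by (simp add: mult.assoc)
  qed
  finally show ?thesis .
qed

text \<open>Conjugation turns the constant function into \<open>w\<close>, and the first factor maps \<open>w\<close> to a multiple of
  \<open>\<partial>\<^sub>\<rho> w\<close>, since the Laplacian of the slices annihilates constants.\<close>

lemma Pop_const_1: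
  assumes N: "1 \<le> N"
  shows "tay 0 (Dops (real N - 1) N w) =
    (real N - real DIM('e) / 2) *\<^sub>R tay 0 (Dops (real N - 3) (N - 1) (\<lambda>z. 2 * d\<rho> w z))"
proof -
  have sm: "smooth_on W (\<lambda>z. 2 * d\<rho> w z)" by (intro smooth_W smooth_w)
  let ?c = "real N - real DIM('e) / 2"
  have "Dop (real N - 1) w z = ?c * (2 * d\<rho> w z)" if z: "z \<in> W" for z
  proof -
    have U: "smooth_on W (\<lambda>z. 1 :: real)" by (intro smooth_W)
    have c: "d\<rho> (\<lambda>z. c) = (\<lambda>z. 0)" for c :: real
      by (simp add: frechet_derivative_at[OF has_derivative_const, symmetric])
    show ?thesis
      using conjugation[OF U z, of w "real N - real DIM('e) / 2"] lap_const[OF z] d\<rho>_w[OF z]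
      by (simp add: c algebra_simps)
  qed
  then have t: "tay k (Dop (real N - 1) w) = ?c *\<^sub>R tay k (\<lambda>z. 2 * d\<rho> w z)" for k
    using tay_cong[of "Dop (real N - 1) w" "\<lambda>z. ?c * (2 * d\<rho> w z)"] tay_cmult[OF sm, of k ?c] by simp
  have "tay 0 (Dops (real N - 1) N w) = dops Mc (real N - 1) (Suc (N - 1)) (\<lambda>k. tay k w) 0"
    using fun_cong[OF tay_Dops[OF smooth_w, of "real N - 1" N], of 0] N by simp
  also have "\<dots> = dops Mc (real N - 3) (N - 1) (dop Mc (real N - 1) (\<lambda>k. tay k w)) 0"
    unfolding dops_front by (simp add: algebra_simps)
  also have "dop Mc (real N - 1) (\<lambda>k. tay k w) = (\<lambda>k. ?c *\<^sub>R tay k (\<lambda>z. 2 * d\<rho> w z))"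
    using t tay_Dop[OF smooth_w] by (simp add: fun_eq_iff)
  also have "dops Mc (real N - 3) (N - 1) \<dots> 0 = ?c *\<^sub>R dops Mc (real N - 3) (N - 1) (\<lambda>k. tay k (\<lambda>z. 2 * d\<rho> w z)) 0"
    using dops_scale[where V = "\<lambda>k. tay k (\<lambda>z. 2 * d\<rho> w z)", OF subspace_E Mc_linear tay_in_E[OF sm]] by simp
  also have "dops Mc (real N - 3) (N - 1) (\<lambda>k. tay k (\<lambda>z. 2 * d\<rho> w z)) 0
     = tay 0 (Dops (real N - 3) (N - 1) (\<lambda>z. 2 * d\<rho> w z))"
    using fun_cong[OF tay_Dops[OF sm, of "real N - 3" "N - 1"], of 0] by simp
  finally show ?thesis .
qed

end

section \<open>Even functions of \<open>r\<close>\<close>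

lemma smooth_on_real_derivative:
  fixes F :: "real \<Rightarrow> real"
  assumes "smooth_on S F" "r \<in> S"
  shows "(F has_real_derivative deriv F r) (at r)" "deriv F r = frechet_derivative F (at r) 1"
proof -
  have d: "(F has_derivative frechet_derivative F (at r)) (at r)"
    by (rule smooth_on_has_derivative[OF assms])
  have "frechet_derivative F (at r) = (*) (frechet_derivative F (at r) 1)"
  proof
    fix h
    show "frechet_derivative F (at r) h = frechet_derivative F (at r) 1 * h"
      using linear_scale[OF has_derivative_linear[OF d], of h 1] by simp
  qed
  then have "(F has_real_derivative frechet_derivative F (at r) 1) (at r)"
    using d by (metis has_field_derivative_def)
  moreover from this have "deriv F r = frechet_derivative F (at r) 1" by (rule DERIV_imp_deriv)
  ultimately show "(F has_real_derivative deriv F r) (at r)" "deriv F r = frechet_derivative F (at r) 1"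
    by simp_all
qed

lemma smooth_on_deriv:
  fixes F :: "real \<Rightarrow> real"
  assumes "open S" "smooth_on S F" shows "smooth_on S ((deriv ^^ m) F)"
proof (induction m)
  case (Suc m)
  have "smooth_on S (deriv ((deriv ^^ m) F))"
    by (subst smooth_on_cong[OF assms(1) smooth_on_real_derivative(2)[OF Suc]])
       (auto intro: smooth_intros Suc)
  then show ?case by simp
qed (use assms in simp)

lemma deriv_cong_open:
  fixes F G :: "real \<Rightarrow> real"
  assumes "open S" "r \<in> S" "\<And>s. s \<in> S \<Longrightarrow> F s = G s"
  shows "deriv F r = deriv G r"
proof -
  have "(F has_field_derivative D) (at r) \<longleftrightarrow> (G has_field_derivative D) (at r)" for D
    using has_field_derivative_transform_within_open[OF _ assms(1,2), of F D G]
      has_field_derivative_transform_within_open[OF _ assms(1,2), of G D F] assms(3) by auto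
  then show ?thesis by (simp add: deriv_def)
qed

lemma funpow_deriv_cong:
  fixes F G :: "real \<Rightarrow> real"
  assumes "open S" "\<And>s. s \<in> S \<Longrightarrow> F s = G s"
  shows "r \<in> S \<Longrightarrow> (deriv ^^ m) F r = (deriv ^^ m) G r"
proof (induction m arbitrary: r)
  case (Suc m)
  show ?case using deriv_cong_open[OF assms(1) Suc.prems Suc.IH] by simp
qed (use assms in simp)

lemma funpow_deriv_times_ident:
  fixes G :: "real \<Rightarrow> real"
  assumes S: "open S" and G: "smooth_on S G"
  shows "r \<in> S \<Longrightarrow> (deriv ^^ m) (\<lambda>r. - (r * G r)) r = - (r * (deriv ^^ m) G r + real m * (deriv ^^ (m - 1)) G r)"
proof (induction m arbitrary: r)
  case (Suc m)
  note d = smooth_on_real_derivative(1)[OF smooth_on_deriv[OF S G] Suc.prems]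
  have "(deriv ^^ Suc m) (\<lambda>r. - (r * G r)) r
    = deriv (\<lambda>r. - (r * (deriv ^^ m) G r + real m * (deriv ^^ (m - 1)) G r)) r"
    using deriv_cong_open[OF S Suc.prems Suc.IH] by simp
  also have "\<dots> = - (r * (deriv ^^ Suc m) G r + real (Suc m) * (deriv ^^ m) G r)"
  proof (rule DERIV_imp_deriv)
    have D: "((\<lambda>r. - (r * (deriv ^^ m) G r + real m * (deriv ^^ (m - 1)) G r)) has_real_derivative
       - ((1 * (deriv ^^ m) G r + deriv ((deriv ^^ m) G) r * r) + real m * deriv ((deriv ^^ (m - 1)) G) r)) (at r)"
      by (intro DERIV_minus DERIV_add DERIV_mult DERIV_ident DERIV_cmult d)
    have e: "real m * deriv ((deriv ^^ (m - 1)) G) r = real m * (deriv ^^ m) G r"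
      by (cases m) auto
    show "((\<lambda>r. - (r * (deriv ^^ m) G r + real m * (deriv ^^ (m - 1)) G r)) has_real_derivative
      - (r * (deriv ^^ Suc m) G r + real (Suc m) * (deriv ^^ m) G r)) (at r)"
      by (rule DERIV_cong[OF D], unfold e) (simp add: algebra_simps)
  qed
  finally show ?case by simp
qed simp

context chart_family
begin

text \<open>Since \<open>\<partial>\<^sub>r V = - r V'\<close> with \<open>V' = \<partial>\<^sub>\<rho> V\<close>, the derivative of order \<open>m + 2\<close> of \<open>V\<close> at \<open>r = 0\<close> is \<open>- (m + 1)\<close> times that
  of order \<open>m\<close> of \<open>V'\<close>.\<close>

lemma taylor_coeff_rho_of:
  assumes eps: "0 < \<epsilon>" "\<And>r. r \<in> {-\<epsilon><..<\<epsilon>} \<Longrightarrow> rho_of r \<in> J" and x: "x \<in> \<Omega>" and V: "smooth_on W V"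
  shows "(deriv ^^ (2 * a)) (\<lambda>r. V (x, rho_of r)) 0 / fact (2 * a) = (- 1 / 2) ^ a * (d\<rho> ^^ a) V (x, 0) / fact a"
  using V
proof (induction a arbitrary: V)
  case 0
  then show ?case by (simp add: rho_of_def)
next
  case (Suc a)
  let ?S = "{-\<epsilon><..<\<epsilon>}"
  have S: "open ?S" "0 \<in> ?S" using eps by auto
  let ?G = "\<lambda>r. d\<rho> V (x, rho_of r)"
  have sm: "smooth_on ?S (\<lambda>r. F (x, rho_of r))" if "smooth_on W F" for F :: "'e \<times> real \<Rightarrow> real"
  proof (rule smooth_on_compose[OF S(1) open_W that])
    show "smooth_on ?S (\<lambda>r. (x, rho_of r))"
      unfolding rho_of_def
      by (intro smooth_on_Pair smooth_on_const smooth_on_minus smooth_on_divide smooth_on_power smooth_on_ident S) auto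
  qed (use eps x in auto)
  have G: "smooth_on ?S ?G" by (intro sm smooth_intros Suc.prems)
  have d: "deriv (\<lambda>r. V (x, rho_of r)) r = - (r * ?G r)" if r: "r \<in> ?S" for r
  proof (rule DERIV_imp_deriv)
    have z: "(x, rho_of r) \<in> W" using x eps(2)[OF r] by simp
    have "((\<lambda>r. V (x, rho_of r)) has_derivative (\<lambda>h. frechet_derivative V (at (x, rho_of r)) (0, - (r * h)))) (at r)"
      by (rule has_derivative_compose[where f = "\<lambda>r. (x, rho_of r)" and f' = "\<lambda>h. (0, - (r * h))" and g = V,
            OF _ smooth_on_has_derivative[OF Suc.prems z]])
         (auto simp: rho_of_def intro!: derivative_eq_intros)
    moreover have "(\<lambda>h. frechet_derivative V (at (x, rho_of r)) (0, - (r * h))) = (*) (- (r * ?G r))"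
    proof
      fix h
      note l = smooth_on_linear_derivative[OF Suc.prems z]
      have "(0, - (r * h)) = (- (r * h)) *\<^sub>R (0 :: 'e, 1 :: real)" by simp
      then show "frechet_derivative V (at (x, rho_of r)) (0, - (r * h)) = - (r * ?G r) * h"
        by (simp only: linear_scale[OF l]) simp
    qed
    ultimately show "((\<lambda>r. V (x, rho_of r)) has_real_derivative - (r * ?G r)) (at r)"
      by (simp only: has_field_derivative_def)
  qed
  have "(deriv ^^ (2 * Suc a)) (\<lambda>r. V (x, rho_of r)) 0 = (deriv ^^ Suc (2 * a)) (deriv (\<lambda>r. V (x, rho_of r))) 0"
    by (simp only: mult_Suc_right numeral_2_eq_2 add_Suc add_0 funpow_Suc_right o_apply)
  also have "\<dots> = (deriv ^^ Suc (2 * a)) (\<lambda>r. - (r * ?G r)) 0"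
    by (rule funpow_deriv_cong[OF S(1) d S(2)])
  also have "\<dots> = - (real (Suc (2 * a)) * (deriv ^^ (2 * a)) ?G 0)"
    using funpow_deriv_times_ident[OF S(1) G S(2), of "Suc (2 * a)"] by simp
  finally have "(deriv ^^ (2 * Suc a)) (\<lambda>r. V (x, rho_of r)) 0 / fact (2 * Suc a)
     = - 1 / (2 * real (Suc a)) * ((deriv ^^ (2 * a)) ?G 0 / fact (2 * a))"
  proof -
    assume e: "(deriv ^^ (2 * Suc a)) (\<lambda>r. V (x, rho_of r)) 0 = - (real (Suc (2 * a)) * (deriv ^^ (2 * a)) ?G 0)"
    have f: "fact (2 * Suc a) = (2 * real (Suc a)) * (real (Suc (2 * a)) * fact (2 * a))"
      by (simp add: algebra_simps)
    show ?thesis unfolding e f by (simp del: of_nat_Suc fact_Suc)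
  qed
  also have "(deriv ^^ (2 * a)) ?G 0 / fact (2 * a) = (- 1 / 2) ^ a * (d\<rho> ^^ a) (d\<rho> V) (x, 0) / fact a"
    by (rule Suc.IH) (intro smooth_intros Suc.prems)
  also have "(d\<rho> ^^ a) (d\<rho> V) = (d\<rho> ^^ Suc a) V" by (simp only: funpow_Suc_right o_apply)
  finally show ?case by (simp del: of_nat_Suc funpow.simps)
qed

end


section \<open>From charts to the manifold\<close>

lemma coord_laplacian_cong:
  assumes "open S" "x \<in> S" "\<And>y. y \<in> S \<Longrightarrow> u y = v y"
  shows "coord_laplacian G u x = coord_laplacian G v x"
proof -
  have e: "frechet_derivative u (at y) = frechet_derivative v (at y)" if "y \<in> S" for y
    by (rule frechet_derivative_cong_open(1)[OF assms(1) that assms(3)])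
  have "frechet_derivative (\<lambda>y. vol_density (G y) * (sharp (G y) (frechet_derivative u (at y)) \<bullet> b)) (at x)
    = frechet_derivative (\<lambda>y. vol_density (G y) * (sharp (G y) (frechet_derivative v (at y)) \<bullet> b)) (at x)" for b
    by (rule frechet_derivative_cong_open(1)[OF assms(1,2)]) (simp add: e)
  then show ?thesis by (simp add: coord_laplacian_def codiff_def)
qed

locale manifold_family =
  fixes A :: "('i, 'a::{t2_space, second_countable_topology}, 'e::euclidean_space) atlas"
    and \<epsilon> :: real and \<gamma> :: "('i, 'e) metric_family"
  assumes manifold: "smooth_manifold A" and eps: "0 < \<epsilon>"
    and family: "smooth_metric_family A (rho_range \<epsilon>) \<gamma>"
begin

abbreviation J :: "real set" where "J \<equiv> rho_range \<epsilon>"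

definition H :: "'i \<Rightarrow> 'e \<times> real \<Rightarrow> 'e form2" where
  "H i = (\<lambda>(x, \<rho>). \<gamma> \<rho> i x)"

lemma chart_homeo: "homeomorphism (cdom A i) (cimg A i) (cmap A i) (cinv A i)"
  and open_cdom: "open (cdom A i)" and open_cimg: "open (cimg A i)"
  using manifold by (auto simp: smooth_manifold_def)

lemma cinv_cmap: "q \<in> cdom A i \<Longrightarrow> cinv A i (cmap A i q) = q"
  and cmap_cinv: "x \<in> cimg A i \<Longrightarrow> cmap A i (cinv A i x) = x"
  and cmap_in: "q \<in> cdom A i \<Longrightarrow> cmap A i q \<in> cimg A i"
  and cinv_in: "x \<in> cimg A i \<Longrightarrow> cinv A i x \<in> cdom A i"
  using chart_homeo[of i] by (auto simp: homeomorphism_def)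

lemma riemannian: "\<rho> \<in> J \<Longrightarrow> riemannian_metric A (\<gamma> \<rho>)"
  using family by (auto simp: smooth_metric_family_def)

lemma open_J: "open J" and zero_in_J: "0 \<in> J"
  using eps by (auto simp: rho_range_def)

lemma rho_of_in_J: "r \<in> {-\<epsilon><..<\<epsilon>} \<Longrightarrow> rho_of r \<in> J"
proof -
  assume "r \<in> {-\<epsilon><..<\<epsilon>}"
  then have "r\<^sup>2 < \<epsilon>\<^sup>2" using power_strict_mono[of "\<bar>r\<bar>" \<epsilon> 2] by auto
  then show ?thesis using eps by (auto simp: rho_range_def rho_of_def intro: le_less_trans[of _ 0])
qed

lemma chart: "chart_family (cimg A i) J (H i)"
proof
  show "metric_on (cimg A i \<times> J) (H i)"
    unfolding metric_on_def
  proof (intro conjI ballI allI)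
    fix z assume "z \<in> cimg A i \<times> J"
    then obtain x \<rho> where z: "z = (x, \<rho>)" "x \<in> cimg A i" "\<rho> \<in> J" by auto
    have "bilinear (\<gamma> \<rho> i x)" "\<forall>v w. \<gamma> \<rho> i x v w = \<gamma> \<rho> i x w v" "\<forall>v. v \<noteq> 0 \<longrightarrow> 0 < \<gamma> \<rho> i x v v"
      using riemannian[OF z(3)] z(2) unfolding riemannian_metric_def by blast+
    then show "metric_form (H i z)"
      unfolding metric_form_def H_def z(1) by (metis case_prod_conv less_irrefl)
  next
    fix v w
    have "smooth_on (cimg A i \<times> J) (\<lambda>(x, \<rho>). \<gamma> \<rho> i x v w)"
      using family by (simp add: smooth_metric_family_def)
    moreover have "(\<lambda>(x, \<rho>). \<gamma> \<rho> i x v w) = (\<lambda>x. H i x v w)" by (auto simp: H_def)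
    ultimately show "smooth_on (cimg A i \<times> J) (\<lambda>x. H i x v w)" by simp
  qed
qed (rule open_cimg open_J zero_in_J)+

sublocale C: chart_family "cimg A i" J "H i" for i
  by (rule chart)

lemma ambient_metric_eq: "ambient_metric \<gamma> i = cone_form (H i)"
  by (simp add: ambient_metric_eq_cone_form H_def)

lemma cdom_cone: "cdom (cone_atlas A J) i = {0<..} \<times> cdom A i \<times> J"
  by (simp add: cone_atlas_def)

lemma cinv_cone:
  assumes "t > 0" "x \<in> cimg A i" "\<rho> \<in> J"
  shows "cinv (cone_atlas A J) i (t, x, \<rho>) = (t, cinv A i x, \<rho>)"
  unfolding cinv_def[of "cone_atlas A J"]
proof (rule inv_into_f_eq)
  show "inj_on (cmap (cone_atlas A J) i) (cdom (cone_atlas A J) i)"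
    by (rule inj_on_inverseI[where g = "\<lambda>(t, x, \<rho>). (t, cinv A i x, \<rho>)"])
       (auto simp: cone_atlas_def cinv_cmap)
qed (use assms cinv_in cmap_cinv in \<open>auto simp: cone_atlas_def\<close>)

lemma cinv_times:
  assumes "x \<in> cimg A i" "\<rho> \<in> J"
  shows "cinv (times_atlas A J) i (x, \<rho>) = (cinv A i x, \<rho>)"
  unfolding cinv_def[of "times_atlas A J"]
proof (rule inv_into_f_eq)
  show "inj_on (cmap (times_atlas A J) i) (cdom (times_atlas A J) i)"
    by (rule inj_on_inverseI[where g = "\<lambda>(x, \<rho>). (cinv A i x, \<rho>)"])
       (auto simp: times_atlas_def cinv_cmap)
qed (use assms cinv_in cmap_cinv in \<open>auto simp: times_atlas_def\<close>)

lemma cimg_times: "cimg (times_atlas A J) i = cimg A i \<times> J"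
  by (force simp: cimg_def times_atlas_def)

lemma transition_facts:
  defines "S j i \<equiv> cmap A j ` (cdom A j \<inter> cdom A i)"
  shows "open (S j i)" "smooth_on (S j i) (transition A j i)" "S j i \<subseteq> cimg A j"
    "x \<in> S j i \<Longrightarrow> cinv A j x \<in> cdom A i" "x \<in> S j i \<Longrightarrow> transition A j i x \<in> cimg A i"
    "x \<in> S j i \<Longrightarrow> cinv A i (transition A j i x) = cinv A j x"
    "x \<in> S j i \<Longrightarrow> inj (frechet_derivative (transition A j i) (at x))"
proof -
  have op: "open (S j i)" for i j
  proof -
    have "S j i = cimg A j \<inter> cinv A j -` cdom A i"
    proof (intro equalityI subsetI)
      fix x assume "x \<in> cimg A j \<inter> cinv A j -` cdom A i"
      then show "x \<in> S j i"
        unfolding S_def using cinv_in[of x j] cmap_cinv[of x j] by (intro image_eqI[of _ _ "cinv A j x"]) auto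
    qed (auto simp: S_def cmap_in cinv_cmap)
    moreover have "continuous_on (cimg A j) (cinv A j)" using chart_homeo by (simp add: homeomorphism_def)
    ultimately show ?thesis
      using continuous_open_preimage[OF _ open_cimg open_cdom] by metis
  qed
  have sm: "smooth_on (S j i) (transition A j i)" for i j
    using manifold unfolding smooth_manifold_def S_def by blast
  have mem: "cinv A j x \<in> cdom A i" "cmap A j (cinv A j x) = x" "cinv A j x \<in> cdom A j" if "x \<in> S j i" for x i j
    using that by (auto simp: S_def cinv_cmap cmap_in cmap_cinv)
  have tr: "transition A j i x = cmap A i (cinv A j x)" for x i j by (simp add: transition_def)
  have tback: "transition A j i x \<in> S i j" "transition A i j (transition A j i x) = x" if "x \<in> S j i" for x i j
    using mem[OF that] by (auto simp: S_def tr cinv_cmap)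
  show "open (S j i)" "smooth_on (S j i) (transition A j i)" by (rule op, rule sm)
  show "S j i \<subseteq> cimg A j" by (auto simp: S_def cmap_in)
  assume x: "x \<in> S j i"
  show "cinv A j x \<in> cdom A i" "transition A j i x \<in> cimg A i" "cinv A i (transition A j i x) = cinv A j x"
    using mem[OF x] by (auto simp: tr cmap_in cinv_cmap)
  let ?D = "frechet_derivative (transition A j i) (at x)"
    and ?D' = "frechet_derivative (transition A i j) (at (transition A j i x))"
  have "((\<lambda>x. transition A i j (transition A j i x)) has_derivative (\<lambda>v. ?D' (?D v))) (at x)"
    by (rule has_derivative_compose[OF smooth_on_has_derivative[OF sm x] smooth_on_has_derivative[OF sm tback(1)[OF x]]])
  moreover have "((\<lambda>x. transition A i j (transition A j i x)) has_derivative (\<lambda>v. v)) (at x)"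
    by (rule has_derivative_transform_within_open[OF has_derivative_ident op x]) (simp add: tback)
  ultimately have "(\<lambda>v. ?D' (?D v)) = (\<lambda>v. v)" by (rule has_derivative_unique)
  then show "inj ?D" by (metis inj_on_inverseI)
qed

lemma metric_transition:
  assumes "x \<in> cmap A j ` (cdom A j \<inter> cdom A i)" "\<rho> \<in> J"
  shows "\<gamma> \<rho> j x v w = \<gamma> \<rho> i (transition A j i x)
    (frechet_derivative (transition A j i) (at x) v) (frechet_derivative (transition A j i) (at x) w)"
  using riemannian[OF assms(2)] assms(1) unfolding riemannian_metric_def by blast

text \<open>The charts that \<^const>\<open>laplacian\<close> chooses at neighbouring points can differ. By invariance the
  value in a fixed chart is the same, so that iterates can be computed in one chart.\<close>

lemma ambient_laplacian_in_chart:
  assumes F: "\<And>i. smooth_on ({0<..} \<times> cimg A i \<times> J) (F i)"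
    and rep: "\<And>i t x \<rho>. t > 0 \<Longrightarrow> x \<in> cimg A i \<Longrightarrow> \<rho> \<in> J \<Longrightarrow> f (t, cinv A i x, \<rho>) = F i (t, x, \<rho>)"
    and p: "t > 0" "x \<in> cimg A i" "\<rho> \<in> J"
  shows "ambient_laplacian A \<epsilon> \<gamma> f (t, cinv A i x, \<rho>) = coord_laplacian (cone_form (H i)) (F i) (t, x, \<rho>)"
proof -
  let ?p = "(t, cinv A i x, \<rho>)"
  define j where "j = (SOME j. ?p \<in> cdom (cone_atlas A J) j)"
  have "?p \<in> cdom (cone_atlas A J) i" using p cinv_in by (simp add: cdom_cone)
  then have "?p \<in> cdom (cone_atlas A J) j" unfolding j_def by (rule someI)
  then have qj: "cinv A i x \<in> cdom A j" by (simp add: cdom_cone)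
  define y where "y = cmap A j (cinv A i x)"
  have y: "y \<in> cimg A j" "cinv A j y = cinv A i x" using qj by (simp_all add: y_def cmap_in cinv_cmap)
  let ?O = "cmap A j ` (cdom A j \<inter> cdom A i)" and ?T = "transition A j i"
  let ?S = "{0::real<..} \<times> ?O \<times> J" and ?Phi = "\<lambda>p. (fst p, ?T (fst (snd p)), snd (snd p))"
  note T = transition_facts[where j = j and i = i]
  have y0: "y \<in> ?O" using qj cinv_in[OF p(2)] by (auto simp: y_def)
  have Ty: "?T y = x" using y by (simp add: transition_def cmap_cinv p)
  have "ambient_laplacian A \<epsilon> \<gamma> f ?p = coord_laplacian (cone_form (H j)) (f \<circ> cinv (cone_atlas A J) j) (t, y, \<rho>)"
    unfolding ambient_laplacian_def laplacian_def Let_def j_def[symmetric]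
    by (simp add: ambient_metric_eq y_def cone_atlas_def)
  also have "\<dots> = coord_laplacian (cone_form (H j)) (\<lambda>p. F i (?Phi p)) (t, y, \<rho>)"
  proof (rule coord_laplacian_cong[where S = ?S])
    show "open ?S" by (intro open_cone open_Times T open_J)
    show "(t, y, \<rho>) \<in> ?S" using p y0 by simp
    fix p assume "p \<in> ?S"
    then obtain t' y' \<rho>' where p': "p = (t', y', \<rho>')" "t' > 0" "y' \<in> ?O" "\<rho>' \<in> J" by auto
    then have "y' \<in> cimg A j" using T(3) by blast
    then show "(f \<circ> cinv (cone_atlas A J) j) p = F i (?Phi p)"
      using p' rep[OF p'(2) T(5)[OF p'(3)] p'(4)] T(6)[OF p'(3)] by (simp add: cinv_cone)
  qed
  also have "\<dots> = coord_laplacian (cone_form (H i)) (F i) (?Phi (t, y, \<rho>))"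
  proof (rule coord_laplacian_change_of_coordinates[where S = ?S and S' = "{0<..} \<times> cimg A i \<times> J"])
    show oS: "open ?S" by (intro open_cone open_Times T open_J)
    show "(t, y, \<rho>) \<in> ?S" using p y0 by simp
    show "open ({0::real<..} \<times> cimg A i \<times> J)" by (rule open_cone[OF C.open_W])
    show "?Phi p \<in> {0<..} \<times> cimg A i \<times> J" if "p \<in> ?S" for p using that T(5) by auto
    have sT: "smooth_on ?S (\<lambda>p. ?T (fst (snd p)))"
      by (rule smooth_on_compose[OF oS T(1) T(2)])
         (auto intro!: smooth_on_fst' smooth_on_snd' smooth_on_ident oS)
    show "smooth_on ?S ?Phi"
      by (intro smooth_on_Pair sT smooth_on_fst' smooth_on_snd' smooth_on_ident oS)
    show G: "metric_on ?S (cone_form (H j))"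
    proof -
      have "metric_on (?O \<times> J) (H j)"
        using C.H[of j] T(3) smooth_on_subset[of "cimg A j \<times> J" _ "?O \<times> J"]
        unfolding metric_on_def by (metis (no_types, lifting) Sigma_mono subset_iff order_refl)
      then show ?thesis by (intro metric_on_cone_form open_Times T open_J)
    qed
    show "metric_on ({0<..} \<times> cimg A i \<times> J) (cone_form (H i))"
      by (intro metric_on_cone_form C.open_W C.H)
    show "smooth_on ({0<..} \<times> cimg A i \<times> J) (F i)" by (rule F)
    fix p assume "p \<in> ?S"
    then obtain t' y' \<rho>' where p': "p = (t', y', \<rho>')" "t' > 0" "y' \<in> ?O" "\<rho>' \<in> J" by auto
    let ?D = "frechet_derivative ?T (at y')"
    have "((\<lambda>p. ?T (fst (snd p))) has_derivative (\<lambda>h. ?D (fst (snd h)))) (at p)"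
    proof (rule has_derivative_compose[of "\<lambda>p. fst (snd p)" "\<lambda>h. fst (snd h)"])
      show "((\<lambda>p. fst (snd p)) has_derivative (\<lambda>h. fst (snd h))) (at p)"
        by (intro has_derivative_fst has_derivative_snd has_derivative_ident)
      show "(?T has_derivative ?D) (at (fst (snd p)))"
        using smooth_on_has_derivative[OF T(2) p'(3)] p'(1) by simp
    qed
    then have "(?Phi has_derivative (\<lambda>h. (fst h, ?D (fst (snd h)), snd (snd h)))) (at p)"
      by (intro has_derivative_Pair has_derivative_fst has_derivative_snd has_derivative_ident)
    from frechet_derivative_at[OF this, symmetric]
    have D: "frechet_derivative ?Phi (at p) = (\<lambda>h. (fst h, ?D (fst (snd h)), snd (snd h)))" .
    show "inj (frechet_derivative ?Phi (at p))"
      unfolding D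
    proof (rule injI)
      fix a b :: "real \<times> 'e \<times> real"
      assume e: "(fst a, ?D (fst (snd a)), snd (snd a)) = (fst b, ?D (fst (snd b)), snd (snd b))"
      then have "fst (snd a) = fst (snd b)" using injD[OF T(7)[OF p'(3)]] by blast
      with e show "a = b" by (simp add: prod_eq_iff)
    qed
    show "cone_form (H j) p v w = cone_form (H i) (?Phi p) (frechet_derivative ?Phi (at p) v) (frechet_derivative ?Phi (at p) w)"
      for v w
      unfolding D by (cases v; cases w)
        (simp add: cone_form_def p'(1) H_def metric_transition[OF p'(3,4), symmetric] split_beta)
  qed
  finally show ?thesis by (simp add: Ty)
qed

lemma ambient_laplacian_powers:
  assumes V: "\<And>i. smooth_on (cimg A i \<times> J) (V i)"
    and rep: "\<And>i t x \<rho>. t > 0 \<Longrightarrow> x \<in> cimg A i \<Longrightarrow> \<rho> \<in> J \<Longrightarrow>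
      f (t, cinv A i x, \<rho>) = t powr s * (V i (x, \<rho>) / C.w i (x, \<rho>))"
    and p: "t > 0" "x \<in> cimg A i" "\<rho> \<in> J"
  shows "(ambient_laplacian A \<epsilon> \<gamma> ^^ k) f (t, cinv A i x, \<rho>)
     = t powr (s - 2 * real k) * (C.Dops i (s + real DIM('e) / 2 - 1) k (V i) (x, \<rho>) / C.w i (x, \<rho>))"
  using p
proof (induction k arbitrary: i t x \<rho>)
  case (Suc k)
  let ?c = "s + real DIM('e) / 2 - 1"
  let ?F = "\<lambda>i (t, z). t powr (s - 2 * real k) * (C.Dops i ?c k (V i) z / C.w i z)"
  have smF: "smooth_on ({0<..} \<times> cimg A i \<times> J) (?F i)" for i
  proof -
    note o = open_cone[OF C.open_W[of i]]
    have "smooth_on (cimg A i \<times> J) (\<lambda>z. C.Dops i ?c k (V i) z / C.w i z)"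
      by (intro smooth_on_divide C.open_W C.smooth_Dops V C.smooth_w C.w_nonzero)
    then show ?thesis
      unfolding case_prod_unfold
      by (intro smooth_on_mult o smooth_on_powr smooth_on_fst smooth_on_compose[OF o C.open_W _ smooth_on_snd[OF o]]) auto
  qed
  have "(ambient_laplacian A \<epsilon> \<gamma> ^^ Suc k) f (t, cinv A i x, \<rho>)
     = coord_laplacian (cone_form (H i)) (?F i) (t, x, \<rho>)"
    using ambient_laplacian_in_chart[where F = ?F and f = "(ambient_laplacian A \<epsilon> \<gamma> ^^ k) f", OF smF _ Suc.prems]
      Suc.IH by simp
  also have "\<dots> = t powr (s - 2 * real k - 2) * (C.Dop i (s - 2 * real k + real DIM('e) / 2 - 1)
      (C.Dops i ?c k (V i)) (x, \<rho>) / C.w i (x, \<rho>))"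
    by (rule C.cone_laplacian_powr[OF C.smooth_Dops[OF V]]) (use Suc.prems in auto)
  finally show ?case by (simp add: algebra_simps)
qed (use rep in simp)

end

section \<open>GJMS operators and \<open>Q\<close>-curvatures on the manifold\<close>

context manifold_family
begin

text \<open>The local expression of a function on the manifold in a chart.\<close>

definition loc :: "'i \<Rightarrow> ('a \<Rightarrow> real) \<Rightarrow> 'e \<Rightarrow> real" where
  "loc i u = C.restr i (\<lambda>x. u (cinv A i x))"

lemma loc_apply: "x \<in> cimg A i \<Longrightarrow> loc i u x = u (cinv A i x)"
  by (simp add: loc_def C.restr_def)

lemma loc_in_E: "smooth_fun A u \<Longrightarrow> loc i u \<in> C.E i"
  unfolding loc_def by (rule C.restr_in_E) (simp add: smooth_fun_def o_def)

lemma smooth_funI: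
  assumes "\<And>i. loc i u \<in> C.E i" shows "smooth_fun A u"
  unfolding smooth_fun_def
proof
  fix i
  have "smooth_on (cimg A i) (loc i u)" using assms[of i] by (simp add: C.E_def)
  then show "smooth_on (cimg A i) (u \<circ> cinv A i)"
    by (subst smooth_on_cong[OF open_cimg, where g = "loc i u"]) (auto simp: loc_apply)
qed

lemma loc_eqI:
  assumes "v \<in> C.E i" "\<And>x. x \<in> cimg A i \<Longrightarrow> u (cinv A i x) = v x"
  shows "loc i u = v"
  using assms by (auto simp: loc_def C.restr_def C.E_def fun_eq_iff)

text \<open>By \<open>Dops_at_0\<close> all smooth extensions yield the same number, and the extension that is constant
  in \<open>\<rho>\<close> shows that there is one.\<close>

lemma gjms_in_chart:
  assumes u: "smooth_fun A u" and x: "x \<in> cimg A i"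
  shows "gjms A \<epsilon> \<gamma> N u (cinv A i x) = C.Pop i N (loc i u) x"
proof -
  have val: "(ambient_laplacian A \<epsilon> \<gamma> ^^ N)
        (\<lambda>(t, q, \<rho>). t powr (real N - real DIM('e) / 2) * U (q, \<rho>)) (1, cinv A i x, 0) = C.Pop i N (loc i u) x"
    if U: "smooth_extension A \<epsilon> u U" for U
  proof -
    define V where "V i z = U (cinv A i (fst z), snd z) * C.w i z" for i and z :: "'e \<times> real"
    have smV: "smooth_on (cimg A i \<times> J) (V i)" for i
    proof -
      have "smooth_on (cimg A i \<times> J) (U \<circ> cinv (times_atlas A J) i)"
        using U unfolding smooth_extension_def smooth_fun_def cimg_times[symmetric] by blast
      then have "smooth_on (cimg A i \<times> J) (\<lambda>z. U (cinv A i (fst z), snd z))"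
        by (subst smooth_on_cong[OF C.open_W, of _ _ "U \<circ> cinv (times_atlas A J) i"]) (auto simp: cinv_times)
      then show ?thesis unfolding V_def[abs_def] by (intro smooth_on_mult C.open_W C.smooth_w)
    qed
    let ?s = "real N - real DIM('e) / 2"
    have rep: "(case (t, cinv A i x, \<rho>) of (t, q, \<rho>) \<Rightarrow> t powr ?s * U (q, \<rho>)) = t powr ?s * (V i (x, \<rho>) / C.w i (x, \<rho>))"
      if "t > 0" "x \<in> cimg A i" "\<rho> \<in> J" for i t x \<rho>
      using C.w_nonzero[of "(x, \<rho>)" i] that by (simp add: V_def)
    have "(ambient_laplacian A \<epsilon> \<gamma> ^^ N) (\<lambda>(t, q, \<rho>). t powr ?s * U (q, \<rho>)) (1, cinv A i x, 0)
      = 1 powr (?s - 2 * real N) * (C.Dops i (?s + real DIM('e) / 2 - 1) N (V i) (x, 0) / C.w i (x, 0))"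
      by (rule ambient_laplacian_powers[where V = V and f = "\<lambda>(t, q, \<rho>). t powr ?s * U (q, \<rho>)", OF smV rep])
         (use x zero_in_J in auto)
    also have "\<dots> = C.tay i 0 (C.Dops i (real N - 1) N (V i)) x"
      using x by (simp add: C.w_0 C.tay_def C.restr_def)
    also have "\<dots> = C.Pop i N (C.tay i 0 (V i)) x" by (simp only: C.Dops_at_0[OF smV])
    also have "C.tay i 0 (V i) = loc i u"
      using U cinv_in unfolding smooth_extension_def carrier_def
      by (auto simp: C.tay_def loc_def C.restr_def V_def C.w_0 fun_eq_iff)
    finally show ?thesis .
  qed
  have "smooth_extension A \<epsilon> u (\<lambda>(q, \<rho>). u q)"
    unfolding smooth_extension_def smooth_fun_def cimg_times
  proof (intro conjI allI ballI)
    fix i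
    have "smooth_on (cimg A i) (\<lambda>x. u (cinv A i x))" using u by (simp add: smooth_fun_def o_def)
    then have "smooth_on (cimg A i \<times> J) (\<lambda>z. u (cinv A i (fst z)))"
      by (rule smooth_on_compose[OF C.open_W open_cimg _ smooth_on_fst[OF C.open_W]]) auto
    then show "smooth_on (cimg A i \<times> J) ((\<lambda>(q, \<rho>). u q) \<circ> cinv (times_atlas A J) i)"
      by (subst smooth_on_cong[OF C.open_W, of _ _ "\<lambda>z. u (cinv A i (fst z))"]) (auto simp: cinv_times)
  qed simp
  then show ?thesis
    unfolding gjms_def using val by (intro the_equality) metis+
qed

lemma loc_gjms: "smooth_fun A u \<Longrightarrow> loc i (gjms A \<epsilon> \<gamma> N u) = C.Pop i N (loc i u)"
  by (rule loc_eqI) (simp_all add: gjms_in_chart linear_withinD(1)[OF C.linear_within_Pop] loc_in_E)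

lemma smooth_gjms: "smooth_fun A u \<Longrightarrow> smooth_fun A (gjms A \<epsilon> \<gamma> N u)"
  by (rule smooth_funI) (simp add: loc_gjms linear_withinD(1)[OF C.linear_within_Pop] loc_in_E)

lemma loc_op_comp:
  assumes "\<And>j u. smooth_fun A u \<Longrightarrow> smooth_fun A (P j u)"
    and "\<And>j u. smooth_fun A u \<Longrightarrow> loc i (P j u) = Q j (loc i u)" and "smooth_fun A u"
  shows "smooth_fun A (op_comp P I u) \<and> loc i (op_comp P I u) = op_comp Q I (loc i u)"
  by (induction I) (simp_all add: op_comp_def assms)

lemma loc_m_op:
  assumes "smooth_fun A u"
  shows "loc i (m_op A \<epsilon> \<gamma> N u) = m_sum (C.Pop i) N (loc i u)"
proof -
  have "loc i (op_comp (gjms A \<epsilon> \<gamma>) I u) = op_comp (C.Pop i) I (loc i u)" for I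
    using loc_op_comp[where P = "gjms A \<epsilon> \<gamma>", OF smooth_gjms loc_gjms assms] by blast
  then have "op_comp (gjms A \<epsilon> \<gamma>) I u (cinv A i x) = op_comp (C.Pop i) I (loc i u) x" if "x \<in> cimg A i" for I x
    using that by (simp add: loc_apply[symmetric])
  then show ?thesis
    by (intro loc_eqI linear_withinD(1)[OF linear_within_m_sum[where P = "C.Pop i", OF C.subspace_E C.linear_within_Pop]]
         loc_in_E assms)
       (simp add: m_op_def m_sum_def sum_fun_apply)
qed

lemma smooth_m_op: "smooth_fun A u \<Longrightarrow> smooth_fun A (m_op A \<epsilon> \<gamma> N u)"
  by (rule smooth_funI)
     (simp add: loc_m_op loc_in_E linear_withinD(1)[OF linear_within_m_sum[where P = "C.Pop _", OF C.subspace_E C.linear_within_Pop]])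

text \<open>A change of the chart multiplies both volume densities by the absolute value of the same
  Jacobian determinant.\<close>

lemma vol_ratio_in_chart:
  assumes g: "\<And>i x. x \<in> cimg A i \<Longrightarrow> \<gamma> 0 i x = g i x" and x: "x \<in> cimg A i" and r: "r \<in> {-\<epsilon><..<\<epsilon>}"
  shows "sqrt (vol_ratio A g \<gamma> (cinv A i x) r) = C.w i (x, rho_of r)"
proof -
  let ?q = "cinv A i x"
  define j where "j = (SOME j. ?q \<in> cdom A j)"
  have "?q \<in> cdom A j" unfolding j_def by (rule someI[of _ i]) (rule cinv_in[OF x])
  define y where "y = cmap A j ?q"
  have y: "y \<in> cimg A j" "y \<in> cmap A j ` (cdom A j \<inter> cdom A i)"
    using \<open>?q \<in> cdom A j\<close> cinv_in[OF x] by (auto simp: y_def cmap_in)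
  have Ty: "transition A j i y = x"
    using \<open>?q \<in> cdom A j\<close> by (simp add: transition_def y_def cinv_cmap cmap_cinv x)
  let ?D = "frechet_derivative (transition A j i) (at y)"
  have lD: "linear ?D" by (rule smooth_on_linear_derivative[OF transition_facts(2) y(2)])
  (* the Jacobian of the transition map from the chosen chart *)
  define c where "c = \<bar>det (\<chi> a b. ?D (basis_vec b) \<bullet> basis_vec a :: real ^ 'e basis_index ^ 'e basis_index)\<bar>"
  have vd: "vol_density (\<gamma> \<rho> j y) = c * vol_density (\<gamma> \<rho> i x)" if "\<rho> \<in> J" for \<rho>
  proof -
    have "bilinear (\<gamma> \<rho> i x)" using riemannian[OF that] x unfolding riemannian_metric_def by blast
    moreover have "\<gamma> \<rho> j y = (\<lambda>v w. \<gamma> \<rho> i x (?D v) (?D w))"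
      using metric_transition[OF y(2) that] Ty by (simp add: fun_eq_iff)
    ultimately show ?thesis
      using gram_det_pullback[OF _ lD, of "\<gamma> \<rho> i x"]
      by (simp add: vol_density_def c_def abs_mult real_sqrt_mult)
  qed
  have pos: "0 < vol_density (\<gamma> 0 j y)" "0 < vol_density (\<gamma> 0 i x)"
    using C.vol_pos[of "(y, 0)" j] C.vol_pos[of "(x, 0)" i] y(1) x zero_in_J by (simp_all add: H_def)
  have "c \<noteq> 0" using vd[OF zero_in_J] pos(1) by auto
  have "vol_ratio A g \<gamma> ?q r = vol_density (\<gamma> (rho_of r) j y) / vol_density (\<gamma> 0 j y)"
    by (simp add: vol_ratio_def Let_def j_def[symmetric] y_def[symmetric] g[OF y(1)])
  also have "\<dots> = vol_density (\<gamma> (rho_of r) i x) / vol_density (\<gamma> 0 i x)"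
    unfolding vd[OF rho_of_in_J[OF r]] vd[OF zero_in_J] using \<open>c \<noteq> 0\<close> by simp
  finally show ?thesis unfolding C.w_def by (simp add: H_def)
qed

lemma loc_w_coeff:
  assumes g: "\<And>i x. x \<in> cimg A i \<Longrightarrow> \<gamma> 0 i x = g i x"
  shows "loc i (w_coeff A g \<gamma> (2 * a)) = (- 1 / 2) ^ a *\<^sub>R C.tay i a (C.w i)"
proof (rule loc_eqI)
  show "(- 1 / 2) ^ a *\<^sub>R C.tay i a (C.w i) \<in> C.E i"
    by (intro subspace_scale[OF C.subspace_E] C.tay_in_E C.smooth_w)
  fix x assume x: "x \<in> cimg A i"
  let ?S = "{-\<epsilon><..<\<epsilon>}"
  have "w_coeff A g \<gamma> (2 * a) (cinv A i x) = (deriv ^^ (2 * a)) (\<lambda>r. C.w i (x, rho_of r)) 0 / fact (2 * a)"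
    unfolding w_coeff_def
    by (subst funpow_deriv_cong[where S = ?S and G = "\<lambda>r. C.w i (x, rho_of r)"])
       (use eps vol_ratio_in_chart[OF g x] in auto)
  also have "\<dots> = (- 1 / 2) ^ a * (d\<rho> ^^ a) (C.w i) (x, 0) / fact a"
    by (rule C.taylor_coeff_rho_of[OF eps rho_of_in_J x C.smooth_w])
  finally show "w_coeff A g \<gamma> (2 * a) (cinv A i x) = ((- 1 / 2) ^ a *\<^sub>R C.tay i a (C.w i)) x"
    using x by (simp add: C.tay_def C.restr_def)
qed

lemma smooth_w_coeff:
  assumes g: "\<And>i x. x \<in> cimg A i \<Longrightarrow> \<gamma> 0 i x = g i x"
  shows "smooth_fun A (w_coeff A g \<gamma> (2 * a))"
  by (rule smooth_funI)
     (simp only: loc_w_coeff[OF g] subspace_scale[OF C.subspace_E] C.tay_in_E[OF C.smooth_w])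

text \<open>Both the critical and the noncritical \<open>Q\<close>-curvature apply the last \<open>N - 1\<close> factors to
  \<open>\<partial>\<^sub>\<rho> w\<close>: in the first case \<open>log t\<close>, in the second the constant function is used up by the first
  factor.\<close>

lemma q_curvature_in_chart:
  assumes N: "1 \<le> N" and x: "x \<in> cimg A i"
  shows "(- 1) ^ N * q_curvature A \<epsilon> \<gamma> N (cinv A i x)
    = - C.tay i 0 (C.Dops i (real N - 3) (N - 1) (\<lambda>z. 2 * d\<rho> (C.w i) z)) x"
proof (cases "2 * N = DIM('e)")
  case False
  let ?Z = "C.tay i 0 (C.Dops i (real N - 3) (N - 1) (\<lambda>z. 2 * d\<rho> (C.w i) z)) x"
  have one: "smooth_fun A (\<lambda>_. 1)" unfolding smooth_fun_def o_def by (intro allI smooth_on_const open_cimg)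
  have "C.tay i 0 (C.w i) = loc i (\<lambda>_. 1)"
    by (auto simp: C.tay_def loc_def C.restr_def C.w_0 fun_eq_iff)
  then have "gjms A \<epsilon> \<gamma> N (\<lambda>_. 1) (cinv A i x) = C.tay i 0 (C.Dops i (real N - 1) N (C.w i)) x"
    by (simp only: gjms_in_chart[OF one x] C.Dops_at_0[OF C.smooth_w])
  also have "\<dots> = (real N - real DIM('e) / 2) * ?Z"
    by (simp only: C.Pop_const_1[OF N] scaleR_fun_apply real_scaleR_def)
  finally have e: "gjms A \<epsilon> \<gamma> N (\<lambda>_. 1) (cinv A i x) = - (real DIM('e) / 2 - real N) * ?Z" by simp
  have "real DIM('e) / 2 - real N \<noteq> 0" using False by (auto simp: field_simps)
  moreover have "c * (- b * z / (c * b)) = - z" if "c \<noteq> 0" "b \<noteq> 0" for b c z :: real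
    using that by simp
  moreover have "(- 1 :: real) ^ N \<noteq> 0" by simp
  ultimately show ?thesis using False unfolding q_curvature_def e by presburger
next
  case True
  let ?V = "\<lambda>i z. 2 * d\<rho> (C.w i) z"
  let ?L = "ambient_laplacian A \<epsilon> \<gamma>" and ?ln = "\<lambda>(t :: real, q :: 'a, \<rho> :: real). ln t"
  have smV: "smooth_on (cimg A i \<times> J) (?V i)" for i
    by (intro smooth_on_mult smooth_on_const C.open_W smooth_on_frechet_derivative C.smooth_w)
  have first: "?L ?ln (t, cinv A i x, \<rho>) = t powr (- 2) * (?V i (x, \<rho>) / C.w i (x, \<rho>))"
    if "t > 0" "x \<in> cimg A i" "\<rho> \<in> J" for i t x \<rho>
  proof -
    have "?L ?ln (t, cinv A i x, \<rho>) = coord_laplacian (cone_form (H i)) (\<lambda>(t, z). ln t) (t, x, \<rho>)"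
    proof (rule ambient_laplacian_in_chart[OF _ _ that])
      fix i
      show "smooth_on ({0<..} \<times> cimg A i \<times> J) (\<lambda>(t :: real, z). ln t)"
        unfolding case_prod_unfold
        by (intro smooth_on_ln smooth_on_fst open_cone C.open_W) auto
    qed simp
    also have "\<dots> = t powr (- 2) * (?V i (x, \<rho>) / C.w i (x, \<rho>))"
      by (rule C.cone_laplacian_ln) (use that in auto)
    finally show ?thesis .
  qed
  have "(?L ^^ N) ?ln (1, cinv A i x, 0) = (?L ^^ (N - 1)) (?L ?ln) (1, cinv A i x, 0)"
    using N by (cases N) (simp_all add: funpow_swap1)
  also have "\<dots> = 1 powr (- 2 - 2 * real (N - 1)) *
      (C.Dops i (- 2 + real DIM('e) / 2 - 1) (N - 1) (?V i) (x, 0) / C.w i (x, 0))"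
    by (rule ambient_laplacian_powers[where V = ?V, OF smV first]) (use x zero_in_J in auto)
  also have "- 2 + real DIM('e) / 2 - 1 = real N - 3" using True by (simp flip: True)
  finally have e: "(?L ^^ N) ?ln (1, cinv A i x, 0) = C.tay i 0 (C.Dops i (real N - 3) (N - 1) (?V i)) x"
    using x by (simp only: C.w_0) (simp add: C.tay_def C.restr_def)
  have "(- 1 :: real) ^ N * ((- 1) ^ (N + 1) * z) = - z" for z by (cases "even N") simp_all
  then show ?thesis unfolding q_curvature_def if_P[OF True] e .
qed

end

theorem theorem1p2:
  fixes A :: "('i, 'a::{t2_space, second_countable_topology}, 'e::euclidean_space) atlas"
    and g :: "('i, 'e) tensor2"
    and \<epsilon> :: real
    and \<gamma> :: "('i, 'e) metric_family"
    and N :: nat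
    and p :: 'a
  assumes "smooth_manifold A"
    and "riemannian_metric A g"
    and "3 \<le> DIM('e)"
    and "poincare_einstein A g \<epsilon> \<gamma>"
    and "1 \<le> N"
    and "even (DIM('e)) \<Longrightarrow> 2 * N \<le> DIM('e)"
    and "p \<in> carrier A"
  shows "(- 1) ^ N * q_curvature A \<epsilon> \<gamma> N p =
    (\<Sum>(I, a) | 1 \<le> a \<and> (\<exists>k. I \<in> compositions k \<and> k + a = N).
       n_coeff (I @ [a]) * fact a * fact (a - 1) * 2 ^ (2 * a)
       * op_comp (m_op A \<epsilon> \<gamma>) I (w_coeff A g \<gamma> (2 * a)) p)"
proof -
  interpret manifold_family A \<epsilon> \<gamma>
    using assms(1,4) by unfold_locales (auto simp: poincare_einstein_def)
  have g: "\<gamma> 0 i x = g i x" if "x \<in> cimg A i" for i x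
    using assms(4) that by (simp add: poincare_einstein_def)
  obtain i where i: "p \<in> cdom A i" using assms(7) by (auto simp: carrier_def)
  define x where "x = cmap A i p"
  have x: "x \<in> cimg A i" "cinv A i x = p" using i by (simp_all add: x_def cmap_in cinv_cmap)
  have term_eq: "op_comp (m_op A \<epsilon> \<gamma>) I (w_coeff A g \<gamma> (2 * a)) p
      = op_comp (m_sum (C.Pop i)) I ((- 1 / 2) ^ a *\<^sub>R C.tay i a (C.w i)) x" for I a
  proof -
    have "loc i (op_comp (m_op A \<epsilon> \<gamma>) I (w_coeff A g \<gamma> (2 * a)))
      = op_comp (m_sum (C.Pop i)) I (loc i (w_coeff A g \<gamma> (2 * a)))"
      using loc_op_comp[where P = "m_op A \<epsilon> \<gamma>", OF smooth_m_op loc_m_op smooth_w_coeff[OF g]] by blast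
    then show ?thesis
      using loc_apply[OF x(1), of "op_comp (m_op A \<epsilon> \<gamma>) I (w_coeff A g \<gamma> (2 * a))"] x(2)
      by (simp only: loc_w_coeff[OF g])
  qed
  have "(- 1) ^ N * q_curvature A \<epsilon> \<gamma> N p
     = (\<Sum>(I, a)\<in>splittings N. (n_coeff (I @ [a]) * fact a * fact (a - 1) * 2 ^ (2 * a)) *\<^sub>R
         op_comp (m_sum (C.Pop i)) I ((- 1 / 2) ^ a *\<^sub>R C.tay i a (C.w i))) x"
    using q_curvature_in_chart[OF assms(5) x(1)] unfolding x(2) C.Q_formula[OF assms(5)] by simp
  also have "\<dots> = (\<Sum>(I, a)\<in>splittings N. n_coeff (I @ [a]) * fact a * fact (a - 1) * 2 ^ (2 * a)
       * op_comp (m_op A \<epsilon> \<gamma>) I (w_coeff A g \<gamma> (2 * a)) p)"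
    by (simp add: sum_fun_apply case_prod_unfold term_eq)
  finally show ?thesis unfolding splittings_def .
qed

end
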